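(* Let $\Bbbk=(\Bbbk_\alpha)_{\alpha\in\mathrm{ON}}$ be an ordinal-indexed tower of fields with $\Bbbk_\alpha\subset\Bbbk_\beta$ of infinite degree whenever $\alpha<\beta$, let $\mathcal{C}_{\Bbbk}$ be the associated category of grounded chains, and let $\mathcal{C}_{\Bbbk}\triangleleft\mathrm{Set}$ be its set decoration. Then the category $\mathcal{C}_{\Bbbk}\triangleleft\mathrm{Set}$ is AB5, does not have (all) $\aleph_0$-indexed products, and has no non-zero injective objects and no non-zero projective objects.
   Context: Set theory: ZFC (with proper classes treated in the metatheory) or NBG with choice. $\mathrm{ON}$ is the (large) well-ordered class of ordinals. The tower is a functor $\alpha\mapsto\Bbbk_\alpha$ from $(\mathrm{ON},\le)$ to fields, its maps viewed as inclusions $\Bbbk_\alpha\subset\Bbbk_\beta$ for $\alpha\le\beta$, with $\Bbbk_\beta$ of infinite degree over $\Bbbk_\alpha$ whenever $\alpha<\beta$. Let $\overline{\mathcal{C}}_{\Bbbk}$ have as objects families $V=(V_\alpha)_{\alpha\in\mathrm{ON}}$ of $\Bbbk_\alpha$-vector spaces with $\Bbbk_\alpha$-linear maps $\nu_{\beta\alpha}:V_\alpha\to V_\beta$ for $\alpha\le\beta$, satisfying $\nu_{\alpha\alpha}=\mathrm{id}$ and $\nu_{\gamma\beta}\nu_{\beta\alpha}=\nu_{\gamma\alpha}$; morphisms are families of $\Bbbk_\alpha$-linear maps $V_\alpha\to W_\alpha$ commuting with the $\nu$'s. An object is $\alpha$-grounded if for all $\beta>\alpha$, $V_\beta$ is the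 $\Bbbk_\beta$-span of $\nu_{\beta\alpha}(V_\alpha)$; it is grounded if it is $\alpha$-grounded for some ordinal $\alpha$. $\mathcal{C}_{\Bbbk}$ is the full subcategory of $\overline{\mathcal{C}}_{\Bbbk}$ on the grounded objects. Set decoration: for an additive category $\mathcal{C}$, the category $\mathcal{C}\triangleleft\mathrm{Set}$ has as objects triples $(c,S,f)$ with $c\in\mathcal{C}$, $S$ a set and $f:S\to\mathcal{C}(c,c)$ a function; by convention $f(s):=0\in\mathcal{C}(c,c)$ for $s\notin S$. A morphism $(c,S,f)\to(c',S',f')$ is a morphism $\psi\in\mathcal{C}(c,c')$ with $\psi\circ f(s)=f'(s)\circ\psi$ for all $s\in S\cup S'$. AB5 means: abelian, cocomplete, with exact (small) filtered colimits. *)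

theory Defs
  imports "HOL-Algebra.Embedded_Algebras" "HOL-Library.FuncSet"
begin

section \<open>Sets, classes and ordinals\<close>

text \<open>A type \<^typ>\<open>'a\<close> of this class is a universe of sets: its elements are the sets,
  arbitrary HOL subsets of the type are the classes, and HOL functions are the class functions.
  Pairing follows from replacement and power set; (global) choice is inherited from HOL.\<close>

class set_universe =
  fixes elts :: "'a \<Rightarrow> 'a set"
  assumes extensionality: "elts x = elts y \<Longrightarrow> x = y"
    and foundation: "wf {(x, y). x \<in> elts y}"
    and separation: "\<exists>y. elts y = {z \<in> elts x. P z}"
    and union: "\<exists>y. elts y = (\<Union>z\<in>elts x. elts z)"
    and power_set: "\<exists>y. elts y = {z. elts z \<subseteq> elts x}"
    and replacement: "\<exists>y. elts y = f ` elts x"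
    and infinity: "\<exists>w. (\<exists>z\<in>elts w. elts z = {}) \<and>
                       (\<forall>x\<in>elts w. \<exists>y\<in>elts w. elts y = insert x (elts x))"

definition small :: "'v::set_universe set \<Rightarrow> bool" where
  "small A \<longleftrightarrow> A \<in> range elts"

definition transitive_set :: "'v::set_universe \<Rightarrow> bool" where
  "transitive_set x \<longleftrightarrow> (\<forall>y\<in>elts x. elts y \<subseteq> elts x)"

definition ON :: "'v::set_universe set" where
  "ON = {\<alpha>. transitive_set \<alpha> \<and> (\<forall>\<beta>\<in>elts \<alpha>. transitive_set \<beta>)}"

definition ord_less :: "'v::set_universe \<Rightarrow> 'v \<Rightarrow> bool" (infix "\<prec>" 50) where
  "\<alpha> \<prec> \<beta> \<longleftrightarrow> \<alpha> \<in> elts \<beta>"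

definition ord_le :: "'v::set_universe \<Rightarrow> 'v \<Rightarrow> bool" (infix "\<preceq>" 50) where
  "\<alpha> \<preceq> \<beta> \<longleftrightarrow> \<alpha> \<prec> \<beta> \<or> \<alpha> = \<beta>"


section \<open>Categories\<close>

text \<open>Hom-sets are indexed by pairs of objects and need not be disjoint, so composition takes
  the three objects involved: \<open>cmp X A B C g f\<close> is the composite \<open>A \<rightarrow> B \<rightarrow> C\<close> of \<open>f\<close>
  followed by \<open>g\<close>.\<close>

record ('o, 'm) precategory =
  Ob :: "'o set"
  Mor :: "'o \<Rightarrow> 'o \<Rightarrow> 'm set"
  idn :: "'o \<Rightarrow> 'm"
  cmp :: "'o \<Rightarrow> 'o \<Rightarrow> 'o \<Rightarrow> 'm \<Rightarrow> 'm \<Rightarrow> 'm"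

record ('o, 'm) ab_precategory = "('o, 'm) precategory" +
  add_mor :: "'o \<Rightarrow> 'o \<Rightarrow> 'm \<Rightarrow> 'm \<Rightarrow> 'm"
  zero_mor :: "'o \<Rightarrow> 'o \<Rightarrow> 'm"

locale category =
  fixes X :: "('o, 'm, 'z) precategory_scheme"
  assumes idn_in: "A \<in> Ob X \<Longrightarrow> idn X A \<in> Mor X A A"
    and cmp_in: "\<lbrakk>A \<in> Ob X; B \<in> Ob X; C \<in> Ob X; f \<in> Mor X A B; g \<in> Mor X B C\<rbrakk>
      \<Longrightarrow> cmp X A B C g f \<in> Mor X A C"
    and cmp_idn_right: "\<lbrakk>A \<in> Ob X; B \<in> Ob X; f \<in> Mor X A B\<rbrakk> \<Longrightarrow> cmp X A A B f (idn X A) = f"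
    and cmp_idn_left: "\<lbrakk>A \<in> Ob X; B \<in> Ob X; f \<in> Mor X A B\<rbrakk> \<Longrightarrow> cmp X A B B (idn X B) f = f"
    and cmp_assoc: "\<lbrakk>A \<in> Ob X; B \<in> Ob X; C \<in> Ob X; D \<in> Ob X;
        f \<in> Mor X A B; g \<in> Mor X B C; h \<in> Mor X C D\<rbrakk>
      \<Longrightarrow> cmp X A C D h (cmp X A B C g f) = cmp X A B D (cmp X B C D h g) f"

definition small_category :: "('v::set_universe, 'v, 'z) precategory_scheme \<Rightarrow> bool" where
  "small_category J \<longleftrightarrow> category J \<and> small (Ob J) \<and> (\<forall>i\<in>Ob J. \<forall>j\<in>Ob J. small (Mor J i j))"

definition full_subcategory ::
    "('o, 'm, 'z) precategory_scheme \<Rightarrow> ('o \<Rightarrow> bool) \<Rightarrow> ('o, 'm, 'z) precategory_scheme" where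
  "full_subcategory X P = X\<lparr>Ob := {A \<in> Ob X. P A}\<rparr>"

definition mono_mor :: "('o, 'm, 'z) precategory_scheme \<Rightarrow> 'o \<Rightarrow> 'o \<Rightarrow> 'm \<Rightarrow> bool" where
  "mono_mor X A B m \<longleftrightarrow> m \<in> Mor X A B \<and>
    (\<forall>C\<in>Ob X. \<forall>g\<in>Mor X C A. \<forall>h\<in>Mor X C A. cmp X C A B m g = cmp X C A B m h \<longrightarrow> g = h)"

definition epi_mor :: "('o, 'm, 'z) precategory_scheme \<Rightarrow> 'o \<Rightarrow> 'o \<Rightarrow> 'm \<Rightarrow> bool" where
  "epi_mor X A B e \<longleftrightarrow> e \<in> Mor X A B \<and>
    (\<forall>C\<in>Ob X. \<forall>g\<in>Mor X B C. \<forall>h\<in>Mor X B C. cmp X A B C g e = cmp X A B C h e \<longrightarrow> g = h)"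

definition injective_object :: "('o, 'm, 'z) precategory_scheme \<Rightarrow> 'o \<Rightarrow> bool" where
  "injective_object X I \<longleftrightarrow> I \<in> Ob X \<and>
    (\<forall>A\<in>Ob X. \<forall>B\<in>Ob X. \<forall>m. \<forall>f\<in>Mor X A I.
      mono_mor X A B m \<longrightarrow> (\<exists>g\<in>Mor X B I. cmp X A B I g m = f))"

definition projective_object :: "('o, 'm, 'z) precategory_scheme \<Rightarrow> 'o \<Rightarrow> bool" where
  "projective_object X P \<longleftrightarrow> P \<in> Ob X \<and>
    (\<forall>A\<in>Ob X. \<forall>B\<in>Ob X. \<forall>e. \<forall>f\<in>Mor X P B.
      epi_mor X A B e \<longrightarrow> (\<exists>g\<in>Mor X P A. cmp X P A B e g = f))"

definition zero_object :: "('o, 'm, 'z) precategory_scheme \<Rightarrow> 'o \<Rightarrow> bool" where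
  "zero_object X Z \<longleftrightarrow> Z \<in> Ob X \<and>
    (\<forall>A\<in>Ob X. (\<exists>!f. f \<in> Mor X Z A) \<and> (\<exists>!f. f \<in> Mor X A Z))"

definition is_product ::
    "('o, 'm, 'z) precategory_scheme \<Rightarrow> 'i set \<Rightarrow> ('i \<Rightarrow> 'o) \<Rightarrow> 'o \<Rightarrow> ('i \<Rightarrow> 'm) \<Rightarrow> bool" where
  "is_product X I A P \<pi> \<longleftrightarrow> P \<in> Ob X \<and> (\<forall>i\<in>I. \<pi> i \<in> Mor X P (A i)) \<and>
    (\<forall>Q\<in>Ob X. \<forall>f. (\<forall>i\<in>I. f i \<in> Mor X Q (A i)) \<longrightarrow>
      (\<exists>!h. h \<in> Mor X Q P \<and> (\<forall>i\<in>I. cmp X Q P (A i) (\<pi> i) h = f i)))"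

definition has_products :: "('o, 'm, 'z) precategory_scheme \<Rightarrow> 'i set \<Rightarrow> bool" where
  "has_products X I \<longleftrightarrow> (\<forall>A. (\<forall>i\<in>I. A i \<in> Ob X) \<longrightarrow> (\<exists>P \<pi>. is_product X I A P \<pi>))"


subsection \<open>Diagrams and colimits\<close>

record ('i, 'n, 'o, 'm) diagram =
  on_ob :: "'i \<Rightarrow> 'o"
  on_mor :: "'i \<Rightarrow> 'i \<Rightarrow> 'n \<Rightarrow> 'm"

definition is_functor :: "('i, 'n, 'y) precategory_scheme \<Rightarrow> ('o, 'm, 'z) precategory_scheme
    \<Rightarrow> ('i, 'n, 'o, 'm) diagram \<Rightarrow> bool" where
  "is_functor J X F \<longleftrightarrow>
    (\<forall>i\<in>Ob J. on_ob F i \<in> Ob X) \<and>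
    (\<forall>i\<in>Ob J. \<forall>j\<in>Ob J. \<forall>u\<in>Mor J i j. on_mor F i j u \<in> Mor X (on_ob F i) (on_ob F j)) \<and>
    (\<forall>i\<in>Ob J. on_mor F i i (idn J i) = idn X (on_ob F i)) \<and>
    (\<forall>i\<in>Ob J. \<forall>j\<in>Ob J. \<forall>l\<in>Ob J. \<forall>u\<in>Mor J i j. \<forall>v\<in>Mor J j l.
      on_mor F i l (cmp J i j l v u) =
      cmp X (on_ob F i) (on_ob F j) (on_ob F l) (on_mor F j l v) (on_mor F i j u))"

definition is_nat_trans :: "('i, 'n, 'y) precategory_scheme \<Rightarrow> ('o, 'm, 'z) precategory_scheme
    \<Rightarrow> ('i, 'n, 'o, 'm) diagram \<Rightarrow> ('i, 'n, 'o, 'm) diagram \<Rightarrow> ('i \<Rightarrow> 'm) \<Rightarrow> bool" where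
  "is_nat_trans J X F G \<eta> \<longleftrightarrow>
    (\<forall>i\<in>Ob J. \<eta> i \<in> Mor X (on_ob F i) (on_ob G i)) \<and>
    (\<forall>i\<in>Ob J. \<forall>j\<in>Ob J. \<forall>u\<in>Mor J i j.
      cmp X (on_ob F i) (on_ob F j) (on_ob G j) (\<eta> j) (on_mor F i j u) =
      cmp X (on_ob F i) (on_ob G i) (on_ob G j) (on_mor G i j u) (\<eta> i))"

definition is_cocone :: "('i, 'n, 'y) precategory_scheme \<Rightarrow> ('o, 'm, 'z) precategory_scheme
    \<Rightarrow> ('i, 'n, 'o, 'm) diagram \<Rightarrow> 'o \<Rightarrow> ('i \<Rightarrow> 'm) \<Rightarrow> bool" where
  "is_cocone J X F C \<iota> \<longleftrightarrow> C \<in> Ob X \<and>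
    (\<forall>i\<in>Ob J. \<iota> i \<in> Mor X (on_ob F i) C) \<and>
    (\<forall>i\<in>Ob J. \<forall>j\<in>Ob J. \<forall>u\<in>Mor J i j.
      cmp X (on_ob F i) (on_ob F j) C (\<iota> j) (on_mor F i j u) = \<iota> i)"

definition is_colimit :: "('i, 'n, 'y) precategory_scheme \<Rightarrow> ('o, 'm, 'z) precategory_scheme
    \<Rightarrow> ('i, 'n, 'o, 'm) diagram \<Rightarrow> 'o \<Rightarrow> ('i \<Rightarrow> 'm) \<Rightarrow> bool" where
  "is_colimit J X F C \<iota> \<longleftrightarrow> is_cocone J X F C \<iota> \<and>
    (\<forall>D \<mu>. is_cocone J X F D \<mu> \<longrightarrow>
      (\<exists>!h. h \<in> Mor X C D \<and> (\<forall>i\<in>Ob J. cmp X (on_ob F i) C D h (\<iota> i) = \<mu> i)))"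

text \<open>The type argument supplies the universe with respect to which smallness is understood.
  Every small category is isomorphic to one whose objects and morphisms are elements of the
  universe.\<close>

definition cocomplete ::
    "'v::set_universe itself \<Rightarrow> ('o, 'm, 'z) precategory_scheme \<Rightarrow> bool" where
  "cocomplete _ X \<longleftrightarrow>
    (\<forall>(J :: ('v, 'v) precategory) F. small_category J \<and> is_functor J X F \<longrightarrow>
      (\<exists>C \<iota>. is_colimit J X F C \<iota>))"

definition filtered :: "('i, 'n, 'y) precategory_scheme \<Rightarrow> bool" where
  "filtered J \<longleftrightarrow> Ob J \<noteq> {} \<and>
    (\<forall>i\<in>Ob J. \<forall>j\<in>Ob J. \<exists>l\<in>Ob J. Mor J i l \<noteq> {} \<and> Mor J j l \<noteq> {}) \<and>
    (\<forall>i\<in>Ob J. \<forall>j\<in>Ob J. \<forall>u\<in>Mor J i j. \<forall>v\<in>Mor J i j.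
      \<exists>l\<in>Ob J. \<exists>w\<in>Mor J j l. cmp J i j l w u = cmp J i j l w v)"


subsection \<open>Abelian and AB5 categories\<close>

definition hom_group :: "('o, 'm, 'z) ab_precategory_scheme \<Rightarrow> 'o \<Rightarrow> 'o \<Rightarrow> 'm monoid" where
  "hom_group X A B = \<lparr>carrier = Mor X A B, mult = add_mor X A B, one = zero_mor X A B\<rparr>"

locale preadditive = category X for X :: "('o, 'm, 'z) ab_precategory_scheme" +
  assumes hom_group: "\<lbrakk>A \<in> Ob X; B \<in> Ob X\<rbrakk> \<Longrightarrow> comm_group (hom_group X A B)"
    and cmp_add_right: "\<lbrakk>A \<in> Ob X; B \<in> Ob X; C \<in> Ob X;
        f \<in> Mor X A B; f' \<in> Mor X A B; g \<in> Mor X B C\<rbrakk>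
      \<Longrightarrow> cmp X A B C g (add_mor X A B f f') =
          add_mor X A C (cmp X A B C g f) (cmp X A B C g f')"
    and cmp_add_left: "\<lbrakk>A \<in> Ob X; B \<in> Ob X; C \<in> Ob X;
        f \<in> Mor X A B; g \<in> Mor X B C; g' \<in> Mor X B C\<rbrakk>
      \<Longrightarrow> cmp X A B C (add_mor X B C g g') f =
          add_mor X A C (cmp X A B C g f) (cmp X A B C g' f)"

definition is_biproduct :: "('o, 'm, 'z) ab_precategory_scheme \<Rightarrow> 'o \<Rightarrow> 'o \<Rightarrow> 'o
    \<Rightarrow> 'm \<Rightarrow> 'm \<Rightarrow> 'm \<Rightarrow> 'm \<Rightarrow> bool" where
  "is_biproduct X A B P p q i j \<longleftrightarrow> P \<in> Ob X \<and>
    p \<in> Mor X P A \<and> q \<in> Mor X P B \<and> i \<in> Mor X A P \<and> j \<in> Mor X B P \<and>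
    cmp X A P A p i = idn X A \<and> cmp X B P B q j = idn X B \<and>
    add_mor X P P (cmp X P A P i p) (cmp X P B P j q) = idn X P"

definition additive :: "('o, 'm, 'z) ab_precategory_scheme \<Rightarrow> bool" where
  "additive X \<longleftrightarrow> preadditive X \<and> (\<exists>Z. zero_object X Z) \<and>
    (\<forall>A\<in>Ob X. \<forall>B\<in>Ob X. \<exists>P p q i j. is_biproduct X A B P p q i j)"

definition is_kernel ::
    "('o, 'm, 'z) ab_precategory_scheme \<Rightarrow> 'o \<Rightarrow> 'o \<Rightarrow> 'o \<Rightarrow> 'm \<Rightarrow> 'm \<Rightarrow> bool" where
  "is_kernel X K A B k f \<longleftrightarrow> K \<in> Ob X \<and> k \<in> Mor X K A \<and> cmp X K A B f k = zero_mor X K B \<and>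
    (\<forall>T\<in>Ob X. \<forall>t\<in>Mor X T A. cmp X T A B f t = zero_mor X T B \<longrightarrow>
      (\<exists>!h. h \<in> Mor X T K \<and> cmp X T K A k h = t))"

definition is_cokernel ::
    "('o, 'm, 'z) ab_precategory_scheme \<Rightarrow> 'o \<Rightarrow> 'o \<Rightarrow> 'o \<Rightarrow> 'm \<Rightarrow> 'm \<Rightarrow> bool" where
  "is_cokernel X A B Q f q \<longleftrightarrow> Q \<in> Ob X \<and> q \<in> Mor X B Q \<and> cmp X A B Q q f = zero_mor X A Q \<and>
    (\<forall>T\<in>Ob X. \<forall>t\<in>Mor X B T. cmp X A B T t f = zero_mor X A T \<longrightarrow>
      (\<exists>!h. h \<in> Mor X Q T \<and> cmp X B Q T h q = t))"

definition abelian :: "('o, 'm, 'z) ab_precategory_scheme \<Rightarrow> bool" where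
  "abelian X \<longleftrightarrow> additive X \<and>
    (\<forall>A\<in>Ob X. \<forall>B\<in>Ob X. \<forall>f\<in>Mor X A B.
      (\<exists>K k. is_kernel X K A B k f) \<and> (\<exists>Q q. is_cokernel X A B Q f q)) \<and>
    (\<forall>A\<in>Ob X. \<forall>B\<in>Ob X. \<forall>m. mono_mor X A B m \<longrightarrow>
      (\<exists>C\<in>Ob X. \<exists>g\<in>Mor X B C. is_kernel X A B C m g)) \<and>
    (\<forall>A\<in>Ob X. \<forall>B\<in>Ob X. \<forall>e. epi_mor X A B e \<longrightarrow>
      (\<exists>C\<in>Ob X. \<exists>g\<in>Mor X C A. is_cokernel X C A B g e))"

definition short_exact ::
    "('o, 'm, 'z) ab_precategory_scheme \<Rightarrow> 'o \<Rightarrow> 'o \<Rightarrow> 'o \<Rightarrow> 'm \<Rightarrow> 'm \<Rightarrow> bool" where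
  "short_exact X A B C f g \<longleftrightarrow> A \<in> Ob X \<and> B \<in> Ob X \<and> C \<in> Ob X \<and>
    f \<in> Mor X A B \<and> g \<in> Mor X B C \<and> is_kernel X A B C f g \<and> is_cokernel X A B C f g"

text \<open>Exactness in a functor category is pointwise, so exactness of the colimit functor on
  \<open>J\<close>-shaped diagrams says that a pointwise short exact sequence of diagrams induces a short
  exact sequence \<open>u\<close>, \<open>v\<close> of colimits.\<close>

definition exact_filtered_colimits ::
    "'v::set_universe itself \<Rightarrow> ('o, 'm, 'z) ab_precategory_scheme \<Rightarrow> bool" where
  "exact_filtered_colimits _ X \<longleftrightarrow>
    (\<forall>(J :: ('v, 'v) precategory) F G H \<eta> \<theta> A B C \<iota>A \<iota>B \<iota>C u v.
      small_category J \<and> filtered J \<and>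
      is_functor J X F \<and> is_functor J X G \<and> is_functor J X H \<and>
      is_nat_trans J X F G \<eta> \<and> is_nat_trans J X G H \<theta> \<and>
      (\<forall>i\<in>Ob J. short_exact X (on_ob F i) (on_ob G i) (on_ob H i) (\<eta> i) (\<theta> i)) \<and>
      is_colimit J X F A \<iota>A \<and> is_colimit J X G B \<iota>B \<and> is_colimit J X H C \<iota>C \<and>
      u \<in> Mor X A B \<and> v \<in> Mor X B C \<and>
      (\<forall>i\<in>Ob J. cmp X (on_ob F i) A B u (\<iota>A i) = cmp X (on_ob F i) (on_ob G i) B (\<iota>B i) (\<eta> i)) \<and>
      (\<forall>i\<in>Ob J. cmp X (on_ob G i) B C v (\<iota>B i) = cmp X (on_ob G i) (on_ob H i) C (\<iota>C i) (\<theta> i))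
      \<longrightarrow> short_exact X A B C u v)"

definition AB5 :: "'v::set_universe itself \<Rightarrow> ('o, 'm, 'z) ab_precategory_scheme \<Rightarrow> bool" where
  "AB5 U X \<longleftrightarrow> abelian X \<and> cocomplete U X \<and> exact_filtered_colimits U X"


section \<open>Linear maps and spans\<close>

definition linear_maps ::
    "('a, 'r) ring_scheme \<Rightarrow> ('a, 'b, 'p) module_scheme \<Rightarrow> ('a, 'c, 'q) module_scheme
      \<Rightarrow> ('b \<Rightarrow> 'c) set" where
  "linear_maps R M N = {h \<in> carrier M \<rightarrow> carrier N.
    (\<forall>x\<in>carrier M. \<forall>y\<in>carrier M. h (x \<oplus>\<^bsub>M\<^esub> y) = h x \<oplus>\<^bsub>N\<^esub> h y) \<and>
    (\<forall>a\<in>carrier R. \<forall>x\<in>carrier M. h (a \<odot>\<^bsub>M\<^esub> x) = a \<odot>\<^bsub>N\<^esub> h x)}"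

definition restrict_scalars :: "('a \<Rightarrow> 'a) \<Rightarrow> ('a, 'b) module \<Rightarrow> ('a, 'b) module" where
  "restrict_scalars \<phi> M = M\<lparr>smult := \<lambda>a. smult M (\<phi> a)\<rparr>"

definition module_span ::
    "('a, 'r) ring_scheme \<Rightarrow> ('a, 'b) module \<Rightarrow> 'b set \<Rightarrow> 'b set" where
  "module_span R M A = \<Inter>{H. submodule H R M \<and> A \<subseteq> H}"


section \<open>Towers of fields and chains\<close>

text \<open>The transition maps \<open>\<iota> \<beta> \<alpha> : k \<alpha> \<rightarrow> k \<beta>\<close> (target index first, as for the maps
  \<open>\<nu>\<close> of a chain) are field homomorphisms, hence injective; the degree of \<open>k \<beta>\<close> over
  \<open>k \<alpha>\<close> is taken over the image of \<open>\<iota> \<beta> \<alpha>\<close>.\<close>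

locale field_tower =
  fixes k :: "'v::set_universe \<Rightarrow> 'v ring"
    and \<iota> :: "'v \<Rightarrow> 'v \<Rightarrow> 'v \<Rightarrow> 'v"
  assumes field: "\<alpha> \<in> ON \<Longrightarrow> field (k \<alpha>)"
    and small_field: "\<alpha> \<in> ON \<Longrightarrow> small (carrier (k \<alpha>))"
    and incl_hom: "\<lbrakk>\<alpha> \<in> ON; \<beta> \<in> ON; \<alpha> \<preceq> \<beta>\<rbrakk> \<Longrightarrow> \<iota> \<beta> \<alpha> \<in> ring_hom (k \<alpha>) (k \<beta>)"
    and incl_id: "\<lbrakk>\<alpha> \<in> ON; a \<in> carrier (k \<alpha>)\<rbrakk> \<Longrightarrow> \<iota> \<alpha> \<alpha> a = a"
    and incl_comp: "\<lbrakk>\<alpha> \<in> ON; \<beta> \<in> ON; \<gamma> \<in> ON; \<alpha> \<preceq> \<beta>; \<beta> \<preceq> \<gamma>; a \<in> carrier (k \<alpha>)\<rbrakk>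
      \<Longrightarrow> \<iota> \<gamma> \<beta> (\<iota> \<beta> \<alpha> a) = \<iota> \<gamma> \<alpha> a"
    and infinite_degree: "\<lbrakk>\<alpha> \<in> ON; \<beta> \<in> ON; \<alpha> \<prec> \<beta>\<rbrakk>
      \<Longrightarrow> ring.infinite_dimension (k \<beta>) (\<iota> \<beta> \<alpha> ` carrier (k \<alpha>)) (carrier (k \<beta>))"

record 'v chain =
  space :: "'v \<Rightarrow> ('v, 'v) module"
  trans_map :: "'v \<Rightarrow> 'v \<Rightarrow> 'v \<Rightarrow> 'v"  (* trans_map V \<beta> \<alpha> : space V \<alpha> \<rightarrow> space V \<beta> *)

definition is_chain :: "('v::set_universe \<Rightarrow> 'v ring) \<Rightarrow> ('v \<Rightarrow> 'v \<Rightarrow> 'v \<Rightarrow> 'v) \<Rightarrow> 'v chain \<Rightarrow> bool"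
  where
  "is_chain k \<iota> V \<longleftrightarrow>
    (\<forall>\<alpha>\<in>ON. module (k \<alpha>) (space V \<alpha>) \<and> small (carrier (space V \<alpha>))) \<and>
    (\<forall>\<alpha>\<in>ON. \<forall>\<beta>\<in>ON. \<alpha> \<preceq> \<beta> \<longrightarrow>
      trans_map V \<beta> \<alpha> \<in>
        linear_maps (k \<alpha>) (space V \<alpha>) (restrict_scalars (\<iota> \<beta> \<alpha>) (space V \<beta>))) \<and>
    (\<forall>\<alpha>\<in>ON. \<forall>x\<in>carrier (space V \<alpha>). trans_map V \<alpha> \<alpha> x = x) \<and>
    (\<forall>\<alpha>\<in>ON. \<forall>\<beta>\<in>ON. \<forall>\<gamma>\<in>ON. \<alpha> \<preceq> \<beta> \<and> \<beta> \<preceq> \<gamma> \<longrightarrow>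
      (\<forall>x\<in>carrier (space V \<alpha>).
        trans_map V \<gamma> \<beta> (trans_map V \<beta> \<alpha> x) = trans_map V \<gamma> \<alpha> x))"

text \<open>Morphisms are families of extensional functions indexed extensionally by the ordinals, so
  that two morphisms are equal as soon as they agree at every element of every \<open>space V \<alpha>\<close>.\<close>

definition chain_mor ::
    "('v::set_universe \<Rightarrow> 'v ring) \<Rightarrow> 'v chain \<Rightarrow> 'v chain \<Rightarrow> ('v \<Rightarrow> 'v \<Rightarrow> 'v) set" where
  "chain_mor k V W = {\<phi> \<in> (\<Pi>\<^sub>E \<alpha>\<in>ON.
        linear_maps (k \<alpha>) (space V \<alpha>) (space W \<alpha>) \<inter> extensional (carrier (space V \<alpha>))).
    \<forall>\<alpha>\<in>ON. \<forall>\<beta>\<in>ON. \<alpha> \<preceq> \<beta> \<longrightarrow>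
      (\<forall>x\<in>carrier (space V \<alpha>). \<phi> \<beta> (trans_map V \<beta> \<alpha> x) = trans_map W \<beta> \<alpha> (\<phi> \<alpha> x))}"

definition chain_category :: "('v::set_universe \<Rightarrow> 'v ring) \<Rightarrow> ('v \<Rightarrow> 'v \<Rightarrow> 'v \<Rightarrow> 'v)
    \<Rightarrow> ('v chain, 'v \<Rightarrow> 'v \<Rightarrow> 'v) ab_precategory" where
  "chain_category k \<iota> =
    \<lparr>Ob = {V. is_chain k \<iota> V},
     Mor = chain_mor k,
     idn = (\<lambda>V. \<lambda>\<alpha>\<in>ON. \<lambda>x\<in>carrier (space V \<alpha>). x),
     cmp = (\<lambda>U V W \<psi> \<phi>. \<lambda>\<alpha>\<in>ON. compose (carrier (space U \<alpha>)) (\<psi> \<alpha>) (\<phi> \<alpha>)),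
     add_mor = (\<lambda>V W \<phi> \<psi>. \<lambda>\<alpha>\<in>ON. \<lambda>x\<in>carrier (space V \<alpha>). \<phi> \<alpha> x \<oplus>\<^bsub>space W \<alpha>\<^esub> \<psi> \<alpha> x),
     zero_mor = (\<lambda>V W. \<lambda>\<alpha>\<in>ON. \<lambda>x\<in>carrier (space V \<alpha>). \<zero>\<^bsub>space W \<alpha>\<^esub>)\<rparr>"

definition grounded_at :: "('v::set_universe \<Rightarrow> 'v ring) \<Rightarrow> 'v chain \<Rightarrow> 'v \<Rightarrow> bool" where
  "grounded_at k V \<alpha> \<longleftrightarrow>
    (\<forall>\<beta>\<in>ON. \<alpha> \<prec> \<beta> \<longrightarrow>
      module_span (k \<beta>) (space V \<beta>) (trans_map V \<beta> \<alpha> ` carrier (space V \<alpha>)) =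
      carrier (space V \<beta>))"

definition grounded :: "('v::set_universe \<Rightarrow> 'v ring) \<Rightarrow> 'v chain \<Rightarrow> bool" where
  "grounded k V \<longleftrightarrow> (\<exists>\<alpha>\<in>ON. grounded_at k V \<alpha>)"

definition grounded_chains :: "('v::set_universe \<Rightarrow> 'v ring) \<Rightarrow> ('v \<Rightarrow> 'v \<Rightarrow> 'v \<Rightarrow> 'v)
    \<Rightarrow> ('v chain, 'v \<Rightarrow> 'v \<Rightarrow> 'v) ab_precategory" where
  "grounded_chains k \<iota> = full_subcategory (chain_category k \<iota>) (grounded k)"


section \<open>Set decoration\<close>

type_synonym ('o, 'v, 'm) decorated = "'o \<times> 'v set \<times> ('v \<Rightarrow> 'm)"

definition underlying :: "('o, 'v, 'm) decorated \<Rightarrow> 'o" where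
  "underlying D = fst D"

definition labels :: "('o, 'v, 'm) decorated \<Rightarrow> 'v set" where
  "labels D = fst (snd D)"

text \<open>The endomorphism attached to \<open>s\<close>, with the convention that it vanishes off the label set.\<close>

definition action ::
    "('o, 'm, 'z) ab_precategory_scheme \<Rightarrow> ('o, 'v, 'm) decorated \<Rightarrow> 'v \<Rightarrow> 'm" where
  "action X D s =
    (if s \<in> labels D then snd (snd D) s else zero_mor X (underlying D) (underlying D))"

text \<open>The type argument is the universe from which label sets are taken.\<close>

definition set_decoration :: "'v::set_universe itself \<Rightarrow> ('o, 'm, 'z) ab_precategory_scheme
    \<Rightarrow> (('o, 'v, 'm) decorated, 'm) ab_precategory" where
  "set_decoration _ X =
    \<lparr>Ob = {(c, S, f). c \<in> Ob X \<and> small S \<and> f \<in> S \<rightarrow>\<^sub>E Mor X c c},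
     Mor = (\<lambda>D E. {\<psi> \<in> Mor X (underlying D) (underlying E).
       \<forall>s\<in>labels D \<union> labels E.
         cmp X (underlying D) (underlying D) (underlying E) \<psi> (action X D s) =
         cmp X (underlying D) (underlying E) (underlying E) (action X E s) \<psi>}),
     idn = (\<lambda>D. idn X (underlying D)),
     cmp = (\<lambda>D E F. cmp X (underlying D) (underlying E) (underlying F)),
     add_mor = (\<lambda>D E. add_mor X (underlying D) (underlying E)),
     zero_mor = (\<lambda>D E. zero_mor X (underlying D) (underlying E))\<rparr>"

end

theory Submission
  imports Defs
begin

text \<open>A decorated grounded chain is a family of abelian groups with additive operators (scalars,
  transition maps, labels) subject to equations, so kernels and colimits may be formed level by level;
  the point is that the results stay grounded. For colimits this holds because set-many ordinals are
  bounded. For a subchain \<open>U\<close> of a grounded chain it holds because, by replacement, the linear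
  dependences modulo \<open>U\<close> between the generators stop changing at some ordinal. Hence the category is
  AB5 with pointwise monomorphisms and epimorphisms.

  Letting a new label act on \<open>P \<oplus> P\<close> by \<open>(x, y) \<mapsto> (0, x)\<close> gives an epimorphism onto \<open>P\<close> and a
  monomorphism from \<open>P\<close>, neither of which splits unless \<open>P = 0\<close>. Finally, if a countable power \<open>P\<close> of
  the constant chain \<open>(k \<alpha>)\<close> were grounded at \<open>\<alpha>\<close>, then for \<open>\<gamma> > \<alpha>\<close> every sequence in \<open>k \<gamma>\<close>, being the
  coordinates of an element of \<open>P \<gamma>\<close>, would lie in a finite-dimensional \<open>k \<alpha>\<close>-subspace.\<close>

section \<open>Small sets and ordinals\<close>

text \<open>Grounding is not inherited formally by limits, and this shapes the proof. A kernel is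
  controlled by dependences among the vectors of one level; these form a set although the fields
  \<open>k \<beta>\<close> run through a proper class, so one ordinal serves them all. A countable
  product has no such bound: a vector above the grounding level uses finitely many coefficients,
  shared by all its coordinates, and infinite degree supplies a sequence that no finite list of
  coefficients can produce. The doubled object exists for every \<open>P\<close> because a set of
  labels never exhausts the universe. A label absent from \<open>P\<close> acts on \<open>P\<close>
  by zero, and a splitting commutes with it, so the nilpotent operator on the double would have to
  vanish too. All groups live over the one type \<open>'v\<close>. Colimits and quotients are
  therefore carried by codes or chosen representatives, and words are identified by testing them in
  cocones rather than by generating a congruence.\<close>

lemma small_elts [simp, intro]: "small (elts x)"
  by (simp add: small_def)

lemma smallE:
  assumes "small A"
  obtains x where "A = elts x"
  using assms by (auto simp: small_def)

definition set_of :: "'v::set_universe set \<Rightarrow> 'v" where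
  "set_of A = (SOME x. elts x = A)"

lemma elts_set_of [simp]: "small A \<Longrightarrow> elts (set_of A) = A"
  unfolding set_of_def by (rule someI_ex) (auto simp: small_def)

lemma small_subset: "small A \<Longrightarrow> B \<subseteq> A \<Longrightarrow> small B"
proof (elim smallE)
  fix x assume "B \<subseteq> A" "A = elts x"
  then have "B = {z \<in> elts x. z \<in> B}" by auto
  with separation[of x "\<lambda>z. z \<in> B"] show "small B" by (auto simp: small_def)
qed

lemma small_image:
  fixes A :: "'v::set_universe set" and f :: "'v \<Rightarrow> 'v"
  assumes "small A" shows "small (f ` A)"
  using replacement[of f "set_of A"] assms by (auto simp: small_def)

lemma small_Pow: "small A \<Longrightarrow> small {z. elts z \<subseteq> A}"
  using power_set[of "set_of A"] by (auto simp: small_def)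

lemma small_empty [simp]: "small {}"
  using small_subset[OF small_elts] by blast

text \<open>Replacement speaks of functions into the universe, so the family of HOL sets
  \<open>B\<close> is first turned into elements by \<open>set_of\<close>.\<close>

lemma small_UN:
  fixes A :: "'v::set_universe set" and B :: "'v \<Rightarrow> 'v set"
  assumes "small A" "\<And>x. x \<in> A \<Longrightarrow> small (B x)"
  shows "small (\<Union>x\<in>A. B x)"
proof -
  obtain y where "elts y = (\<Union>z\<in>elts (set_of ((set_of \<circ> B) ` A)). elts z)" using union by blast
  then have "elts y = (\<Union>x\<in>A. B x)"
    using small_image[OF assms(1), of "set_of \<circ> B"] assms(2) by simp
  then show ?thesis by (metis small_elts)
qed

text \<open>Pairing is derived: the empty set and its singleton both lie in the power set of the
  power set of the empty set, and replacement carries this pair to any other. The two points also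
  index the two-object diagrams behind biproducts and cokernels.\<close>

lemma two_points:
  obtains p q :: "'v::set_universe" where "p \<noteq> q" "small {p, q}"
proof
  let ?e = "set_of {} :: 'v"
  have sing: "{z. elts z \<subseteq> ({} :: 'v set)} = {?e}"
    by (auto intro: extensionality)
  have s: "small {?e}" using small_Pow[of "{} :: 'v set"] unfolding sing by simp
  show "?e \<noteq> set_of {?e}"
  proof
    assume "?e = set_of {?e}"
    then have "elts ?e = elts (set_of {?e})" by (rule arg_cong)
    then show False using s by simp
  qed
  have "small {z. elts z \<subseteq> {?e}}" using s by (rule small_Pow)
  then show "small {?e, set_of {?e}}"
    by (rule small_subset) (use s in simp)
qed

lemma small_Un:
  fixes A B :: "'v::set_universe set"
  assumes "small A" "small B" shows "small (A \<union> B)"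
proof -
  obtain p q :: 'v where pq: "p \<noteq> q" "small {p, q}" by (rule two_points)
  have "small (\<Union>i\<in>{p, q}. if i = p then A else B)"
    using pq assms by (intro small_UN) auto
  then show ?thesis using pq by (simp add: Un_commute)
qed

lemma small_insert:
  fixes x :: "'v::set_universe"
  assumes "small A" shows "small (insert x A)"
proof -
  obtain p q :: 'v where "small {p, q}" by (rule two_points)
  then have "small {x}" using small_image[of "{p, q}" "\<lambda>_. x"] by simp
  then show ?thesis using small_Un[OF _ assms, of "{x}"] by simp
qed

lemma small_finite: "finite A \<Longrightarrow> small A"
  by (induction rule: finite_induct) (auto intro: small_insert)

lemma elts_not_self: "x \<notin> elts (x :: 'v::set_universe)"
  using wf_not_refl[OF foundation, of x] by simp

lemma elts_no_2cycle: "x \<in> elts y \<Longrightarrow> y \<notin> elts (x :: 'v::set_universe)"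
  using wf_not_sym[OF foundation, of x y] by simp

text \<open>By foundation the set \<open>A\<close> is not a member of itself. This is the source of
  fresh labels.\<close>

lemma ex_notin_small: "small (A :: 'v::set_universe set) \<Longrightarrow> \<exists>x. x \<notin> A"
  using elts_not_self[of "set_of A"] by auto

definition succ :: "'v::set_universe \<Rightarrow> 'v" where
  "succ x = set_of (insert x (elts x))"

lemma elts_succ [simp]: "elts (succ x) = insert x (elts x)"
  by (simp add: succ_def small_insert)

lemma succ_inject: "succ x = succ y \<Longrightarrow> x = (y :: 'v::set_universe)"
proof -
  assume "succ x = succ y"
  then have "elts (succ x) = elts (succ y)" by (rule arg_cong)
  then have e: "insert x (elts x) = insert y (elts y)" by simp
  have "x \<in> insert y (elts y)" unfolding e[symmetric] by (rule insertI1)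
  moreover have "y \<in> insert x (elts x)" unfolding e by (rule insertI1)
  ultimately show "x = y" using elts_no_2cycle[of x y] by auto
qed

text \<open>A set closed under successor, as given by infinity, contains all von Neumann numerals.
  They are pairwise distinct, so any HOL sequence factors through them and replacement makes its
  range small.\<close>

lemma small_range_nat:
  fixes g :: "nat \<Rightarrow> 'v::set_universe"
  shows "small (range g)"
proof -
  define num :: "nat \<Rightarrow> 'v" where "num n = (succ ^^ n) (set_of {})" for n
  have num_0: "elts (num 0) = {}" and num_Suc: "num (Suc n) = succ (num n)" for n
    by (simp_all add: num_def)
  have ne: "num (Suc n) \<noteq> num 0" for n
  proof
    assume "num (Suc n) = num 0"
    then have "elts (succ (num n)) = {}" by (simp only: num_Suc num_0)
    then show False by simp
  qed
  have "num m = num n \<longrightarrow> m = n" for m n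
  proof (induction m arbitrary: n)
    case 0 show ?case using ne[of "n - 1"] by (cases n) auto
  next
    case (Suc m) show ?case
    proof (cases n)
      case 0 then show ?thesis using ne[of m] by auto
    next
      case (Suc l)
      then have "num m = num l" if "num (Suc m) = num n"
        using that by - (rule succ_inject, simp only: num_Suc)
      then show ?thesis using Suc.IH[of l] Suc by blast
    qed
  qed
  then have inj: "inj num" by (auto intro: injI)
  obtain w :: 'v where w: "\<exists>z\<in>elts w. elts z = {}" "\<forall>x\<in>elts w. \<exists>y\<in>elts w. elts y = insert x (elts x)"
    using infinity by blast
  have "num n \<in> elts w" for n
  proof (induction n)
    case 0
    obtain z where "z \<in> elts w" "elts z = {}" using w(1) by blast
    then show ?case using extensionality[of z "num 0"] num_0 by simp
  next
    case (Suc n)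
    then obtain y where "y \<in> elts w" "elts y = elts (num (Suc n))" using w(2) by (auto simp: num_Suc)
    then show ?case using extensionality[of y "num (Suc n)"] by simp
  qed
  then have "small (range num)" by (blast intro: small_subset)
  then have "small ((g \<circ> inv_into UNIV num) ` range num)" by (rule small_image)
  then show ?thesis using inj by (simp add: image_comp comp_def)
qed

lemma small_UN_nat:
  fixes B :: "nat \<Rightarrow> 'v::set_universe set"
  assumes "\<And>n. small (B n)"
  shows "small (\<Union>n. B n)"
proof -
  have "small (\<Union>x\<in>range (\<lambda>n. set_of (B n)). elts x)"
    by (intro small_UN small_range_nat) auto
  then show ?thesis using assms by simp
qed

section \<open>Pairs and finite words as elements of the universe\<close>

definition pair :: "'v::set_universe \<Rightarrow> 'v \<Rightarrow> 'v" where
  "pair x y = set_of {set_of {x}, set_of {x, y}}"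

lemma pair_inject: "pair a b = pair c d \<longleftrightarrow> a = c \<and> b = (d :: 'v::set_universe)"
proof
  have [simp]: "set_of A = set_of B \<longleftrightarrow> A = B" if "finite A" "finite B" for A B :: "'v set"
    using that by (metis elts_set_of small_finite)
  assume "pair a b = pair c d"
  then show "a = c \<and> b = d" by (auto simp: pair_def doubleton_eq_iff)
qed auto

lemma elts_pair_nonempty: "elts (pair a b) \<noteq> ({} :: 'v::set_universe set)"
  by (simp add: pair_def small_finite)

text \<open>The empty word becomes the empty set, which no Kuratowski pair equals; this makes the
  coding injective.\<close>

fun code :: "('v::set_universe \<times> 'v) list \<Rightarrow> 'v" where
  "code [] = set_of {}"
| "code (p # w) = pair (pair (fst p) (snd p)) (code w)"

lemma code_Cons_neq_Nil: "code (p # w) \<noteq> code []"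
  using elts_pair_nonempty[of "pair (fst p) (snd p)" "code w"] by auto

lemma code_inject: "code v = code w \<Longrightarrow> v = w"
proof (induction v arbitrary: w)
  case Nil then show ?case using code_Cons_neq_Nil[symmetric] by (cases w) (simp, blast)
next
  case (Cons p v)
  show ?case
  proof (cases w)
    case Nil then show ?thesis using Cons.prems code_Cons_neq_Nil by metis
  next
    case (Cons q u) then show ?thesis using Cons.prems Cons.IH[of u] by (simp add: pair_inject prod_eq_iff)
  qed
qed

text \<open>By induction on the length: a code of length \<open>n + 1\<close> is a pair of a coded
  letter and a code of length \<open>n\<close>, and the countable union over all lengths is again
  small.\<close>

lemma small_code_lists:
  fixes I :: "'v::set_universe set"
  assumes I: "small I" and B: "\<And>i. i \<in> I \<Longrightarrow> small (B i)"
  shows "small (code ` lists (Sigma I B))"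
proof -
  define P where "P = (\<Union>i\<in>I. pair i ` B i)"
  have P: "small P" unfolding P_def by (intro small_UN small_image I B)
  let ?L = "\<lambda>n. code ` {w \<in> lists (Sigma I B). length w = n}"
  have "small (?L n)" for n
  proof (induction n)
    case 0
    have "?L 0 \<subseteq> {set_of {}}" by auto
    then show ?case by (rule small_subset[OF small_finite, rotated]) simp
  next
    case (Suc n)
    have "?L (Suc n) \<subseteq> (\<Union>p\<in>P. pair p ` ?L n)"
    proof clarsimp
      fix w assume "\<forall>p\<in>set w. p \<in> Sigma I B" "length w = Suc n"
      then show "\<exists>p\<in>P. code w \<in> pair p ` ?L n"
        by (cases w) (auto simp: P_def intro!: rev_image_eqI bexI)
    qed
    moreover have "small (\<Union>p\<in>P. pair p ` ?L n)" by (intro small_UN small_image P Suc)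
    ultimately show ?case by (rule small_subset[rotated])
  qed
  then have "small (\<Union>n. ?L n)" by (rule small_UN_nat)
  then show ?thesis by (rule small_subset) auto
qed

section \<open>Ordinals and strict upper bounds\<close>

lemma ord_le_refl [simp]: "\<alpha> \<preceq> \<alpha>"
  by (simp add: ord_le_def)

lemma ord_less_imp_le: "\<alpha> \<prec> \<beta> \<Longrightarrow> \<alpha> \<preceq> \<beta>"
  by (simp add: ord_le_def)

lemma ord_less_trans: "\<gamma> \<in> ON \<Longrightarrow> \<alpha> \<prec> \<beta> \<Longrightarrow> \<beta> \<prec> \<gamma> \<Longrightarrow> \<alpha> \<prec> \<gamma>"
  by (auto simp: ord_less_def ON_def transitive_set_def)

lemma ord_le_trans: "\<gamma> \<in> ON \<Longrightarrow> \<alpha> \<preceq> \<beta> \<Longrightarrow> \<beta> \<preceq> \<gamma> \<Longrightarrow> \<alpha> \<preceq> \<gamma>"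
  using ord_less_trans by (auto simp: ord_le_def)

lemma succ_in_ON: "\<alpha> \<in> ON \<Longrightarrow> succ \<alpha> \<in> ON"
  by (auto simp: ON_def transitive_set_def)

lemma ord_less_succ: "\<alpha> \<prec> succ \<alpha>"
  by (simp add: ord_less_def)

text \<open>The union is taken over the successors, not over the ordinals themselves, so that the
  bound is strict.\<close>

lemma ordinal_upper_bound:
  assumes "small A" "A \<subseteq> ON"
  obtains \<beta> :: "'v::set_universe" where "\<beta> \<in> ON" "\<And>\<alpha>. \<alpha> \<in> A \<Longrightarrow> \<alpha> \<prec> \<beta>"
proof
  let ?u = "set_of (\<Union>\<alpha>\<in>A. elts (succ \<alpha>))"
  have u: "elts ?u = (\<Union>\<alpha>\<in>A. elts (succ \<alpha>))"
    by (rule elts_set_of, rule small_UN[OF assms(1)], rule small_elts)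
  show "?u \<in> ON" unfolding ON_def transitive_set_def mem_Collect_eq u using assms(2)
    by (fastforce simp: ON_def transitive_set_def)
  show "\<alpha> \<prec> ?u" if "\<alpha> \<in> A" for \<alpha> using that u by (auto simp: ord_less_def)
qed

section \<open>Colimits of abelian groups inside the universe\<close>

text \<open>Only addition is respected: scalar multiplications are treated as operators on the same
  footing as transition maps and labels.\<close>

definition additive_maps :: "('a, 'm) ring_scheme \<Rightarrow> ('b, 'n) ring_scheme \<Rightarrow> ('a \<Rightarrow> 'b) set" where
  "additive_maps G H = {f \<in> carrier G \<rightarrow> carrier H.
    \<forall>x\<in>carrier G. \<forall>y\<in>carrier G. f (x \<oplus>\<^bsub>G\<^esub> y) = f x \<oplus>\<^bsub>H\<^esub> f y}"

lemma additive_mapsI: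
  assumes "\<And>x. x \<in> carrier G \<Longrightarrow> f x \<in> carrier H"
    and "\<And>x y. x \<in> carrier G \<Longrightarrow> y \<in> carrier G \<Longrightarrow> f (x \<oplus>\<^bsub>G\<^esub> y) = f x \<oplus>\<^bsub>H\<^esub> f y"
  shows "f \<in> additive_maps G H"
  using assms by (auto simp: additive_maps_def)

lemma additive_maps_closed: "f \<in> additive_maps G H \<Longrightarrow> x \<in> carrier G \<Longrightarrow> f x \<in> carrier H"
  by (auto simp: additive_maps_def)

lemma additive_maps_add:
  "f \<in> additive_maps G H \<Longrightarrow> x \<in> carrier G \<Longrightarrow> y \<in> carrier G \<Longrightarrow> f (x \<oplus>\<^bsub>G\<^esub> y) = f x \<oplus>\<^bsub>H\<^esub> f y"
  by (auto simp: additive_maps_def)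

lemma additive_maps_comp:
  "f \<in> additive_maps G H \<Longrightarrow> g \<in> additive_maps H K \<Longrightarrow> (\<lambda>x. g (f x)) \<in> additive_maps G K"
  by (auto simp: additive_maps_def Pi_iff)

lemma additive_maps_zero:
  assumes "f \<in> additive_maps G H" "abelian_group G" "abelian_group H"
  shows "f \<zero>\<^bsub>G\<^esub> = \<zero>\<^bsub>H\<^esub>"
proof -
  interpret G: abelian_group G by fact
  interpret H: abelian_group H by fact
  have "f \<zero>\<^bsub>G\<^esub> \<oplus>\<^bsub>H\<^esub> f \<zero>\<^bsub>G\<^esub> = f \<zero>\<^bsub>G\<^esub>"
    using additive_maps_add[OF assms(1), of "\<zero>\<^bsub>G\<^esub>" "\<zero>\<^bsub>G\<^esub>"] by simp
  then show ?thesis using additive_maps_closed[OF assms(1), of "\<zero>\<^bsub>G\<^esub>"] by simp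
qed

lemma additive_maps_minus:
  assumes "f \<in> additive_maps G H" "abelian_group G" "abelian_group H" "x \<in> carrier G"
  shows "f (\<ominus>\<^bsub>G\<^esub> x) = \<ominus>\<^bsub>H\<^esub> f x"
proof -
  interpret G: abelian_group G by fact
  interpret H: abelian_group H by fact
  have "f (\<ominus>\<^bsub>G\<^esub> x) \<oplus>\<^bsub>H\<^esub> f x = \<zero>\<^bsub>H\<^esub>"
    using additive_maps_add[OF assms(1), of "\<ominus>\<^bsub>G\<^esub> x" x] additive_maps_zero[OF assms(1-3)] assms(4)
    by (simp add: G.l_neg)
  then show ?thesis using assms by (simp add: H.minus_equality additive_maps_closed[OF assms(1)])
qed

lemma (in abelian_group) a_inv_zero: "\<ominus> \<zero> = \<zero>"
  by (rule minus_equality) simp_all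

lemma (in abelian_group) eq_if_minus_eq_zero:
  assumes "x \<in> carrier G" "y \<in> carrier G" "x \<ominus> y = \<zero>" shows "x = y"
  using minus_equality[of x "\<ominus> y"] assms by (simp add: a_minus_def)

lemma zero_additive_maps: "abelian_group H \<Longrightarrow> (\<lambda>_. \<zero>\<^bsub>H\<^esub>) \<in> additive_maps G H"
  by (auto intro!: additive_mapsI simp: abelian_groupE)

lemma add_additive_maps:
  assumes "abelian_group H" "f \<in> additive_maps G H" "g \<in> additive_maps G H"
  shows "(\<lambda>x. f x \<oplus>\<^bsub>H\<^esub> g x) \<in> additive_maps G H"
proof -
  interpret H: abelian_group H by fact
  show ?thesis
    using assms(2,3)
    by (auto intro!: additive_mapsI simp: additive_maps_closed additive_maps_add H.a_ac)
qed

text \<open>A word is a formal sum of letters \<open>(i, x)\<close>. Reading the first component as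
  an index gives elements of a colimit; reading it as a coefficient gives linear
  combinations.\<close>

fun eval_word :: "('b, 'm) ring_scheme \<Rightarrow> ('i \<Rightarrow> 'x \<Rightarrow> 'b) \<Rightarrow> ('i \<times> 'x) list \<Rightarrow> 'b" where
  "eval_word N t [] = \<zero>\<^bsub>N\<^esub>"
| "eval_word N t (p # w) = t (fst p) (snd p) \<oplus>\<^bsub>N\<^esub> eval_word N t w"

lemma eval_word_closed:
  assumes "abelian_group N" "\<And>i x. (i, x) \<in> set w \<Longrightarrow> t i x \<in> carrier N"
  shows "eval_word N t w \<in> carrier N"
  using assms(2) by (induction w) (auto simp: abelian_groupE[OF assms(1)])

lemma eval_word_append:
  assumes N: "abelian_group N"
    and "\<And>i x. (i, x) \<in> set v \<Longrightarrow> t i x \<in> carrier N" "\<And>i x. (i, x) \<in> set w \<Longrightarrow> t i x \<in> carrier N"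
  shows "eval_word N t (v @ w) = eval_word N t v \<oplus>\<^bsub>N\<^esub> eval_word N t w"
  using assms(2,3)
proof (induction v)
  case Nil
  then have "eval_word N t w \<in> carrier N" by (intro eval_word_closed[OF N])
  then show ?case using abelian_groupE(5)[OF N] by simp
next
  case (Cons p v)
  have "t (fst p) (snd p) \<in> carrier N" using Cons.prems(1) by (cases p) auto
  moreover have "eval_word N t v \<in> carrier N" "eval_word N t w \<in> carrier N"
    using Cons.prems by (auto intro!: eval_word_closed[OF N])
  ultimately show ?case using Cons.IH Cons.prems abelian_groupE(3)[OF N] by auto
qed

text \<open>A diagram is a graph of groups, with no closure under composition. Edgeless graphs,
  parallel pairs and the graph of a functor are all covered, giving coproducts, cokernels and
  general colimits by one construction.\<close>

locale group_diagram =
  fixes I :: "'v::set_universe set"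
    and M :: "'v \<Rightarrow> ('v, 'v) module"
    and E :: "('v \<times> 'v \<times> ('v \<Rightarrow> 'v)) set"
  assumes small_index: "small I"
    and group: "i \<in> I \<Longrightarrow> abelian_group (M i)"
    and small_group: "i \<in> I \<Longrightarrow> small (carrier (M i))"
begin

text \<open>The edge set is a parameter because a finite part of \<open>E\<close> has cocones of its
  own. The test group \<open>N\<close> need not have a small carrier.\<close>

definition cocone_on :: "('v \<times> 'v \<times> ('v \<Rightarrow> 'v)) set \<Rightarrow> ('v, 'v) module \<Rightarrow> ('v \<Rightarrow> 'v \<Rightarrow> 'v) \<Rightarrow> bool" where
  "cocone_on R N t \<longleftrightarrow> abelian_group N \<and> (\<forall>i\<in>I. t i \<in> additive_maps (M i) N) \<and>
    (\<forall>(i, j, f)\<in>R. \<forall>x\<in>carrier (M i). t j (f x) = t i x)"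

definition words :: "('v \<times> 'v) list set" where
  "words = lists (SIGMA i:I. carrier (M i))"

text \<open>Two words are identified when finitely many edges force their values to agree in every
  cocone. Recording the finite set of edges is what later makes filtered colimits computable.\<close>

definition word_eq :: "('v \<times> 'v) list \<Rightarrow> ('v \<times> 'v) list \<Rightarrow> bool" where
  "word_eq v w \<longleftrightarrow> (\<exists>R\<subseteq>E. finite R \<and>
    (\<forall>N t. cocone_on R N t \<longrightarrow> eval_word N t v = eval_word N t w))"

text \<open>An equivalence class of lists is not an element of \<open>'v\<close>, so it is replaced
  by the code of a chosen member.\<close>

definition cls :: "('v \<times> 'v) list \<Rightarrow> 'v" where
  "cls w = code (SOME v. v \<in> words \<and> word_eq v w)"

definition rep :: "'v \<Rightarrow> ('v \<times> 'v) list" where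
  "rep c = (SOME w. w \<in> words \<and> cls w = c)"

text \<open>Only the additive fields carry meaning. The multiplicative ones are fillers, and
  \<open>mk_decorated\<close> later installs the scalar multiplication.\<close>

definition colim :: "('v, 'v) module" where
  "colim = \<lparr>carrier = cls ` words, mult = (\<lambda>_ _. cls []), one = cls [], zero = cls [],
    add = (\<lambda>c d. cls (rep c @ rep d)), smult = (\<lambda>_ _. cls [])\<rparr>"

definition coproj :: "'v \<Rightarrow> 'v \<Rightarrow> 'v" where
  "coproj i x = cls [(i, x)]"

definition lift :: "('v, 'v) module \<Rightarrow> ('v \<Rightarrow> 'v \<Rightarrow> 'v) \<Rightarrow> 'v \<Rightarrow> 'v" where
  "lift N t c = eval_word N t (rep c)"

lemma cocone_on_closed: "cocone_on R N t \<Longrightarrow> w \<in> words \<Longrightarrow> (i, x) \<in> set w \<Longrightarrow> t i x \<in> carrier N"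
  by (auto simp: cocone_on_def words_def additive_maps_def)

lemma cocone_on_eval_append:
  "cocone_on R N t \<Longrightarrow> v \<in> words \<Longrightarrow> w \<in> words \<Longrightarrow>
    eval_word N t (v @ w) = eval_word N t v \<oplus>\<^bsub>N\<^esub> eval_word N t w"
  by (rule eval_word_append) (auto simp: cocone_on_def intro: cocone_on_closed)

lemma cocone_on_eval_closed:
  "cocone_on R N t \<Longrightarrow> w \<in> words \<Longrightarrow> eval_word N t w \<in> carrier N"
  by (rule eval_word_closed) (auto simp: cocone_on_def intro: cocone_on_closed)

lemma cocone_on_subset: "cocone_on R N t \<Longrightarrow> R' \<subseteq> R \<Longrightarrow> cocone_on R' N t"
  unfolding cocone_on_def by blast

lemma word_eqI:
  assumes "\<And>N t. cocone_on {} N t \<Longrightarrow> eval_word N t v = eval_word N t w"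
  shows "word_eq v w"
  using assms by (auto simp: word_eq_def)

lemma word_eq_refl: "word_eq w w"
  by (rule word_eqI) simp

lemma word_eq_sym: "word_eq v w \<Longrightarrow> word_eq w v"
  unfolding word_eq_def by metis

lemma word_eq_trans: "word_eq u v \<Longrightarrow> word_eq v w \<Longrightarrow> word_eq u w"
proof -
  assume "word_eq u v" "word_eq v w"
  then obtain R S where "R \<subseteq> E" "finite R" "S \<subseteq> E" "finite S"
    "\<And>N t. cocone_on R N t \<Longrightarrow> eval_word N t u = eval_word N t v"
    "\<And>N t. cocone_on S N t \<Longrightarrow> eval_word N t v = eval_word N t w"
    unfolding word_eq_def by metis
  then show ?thesis unfolding word_eq_def
    by (intro exI[of _ "R \<union> S"]) (metis cocone_on_subset finite_UnI sup_ge1 sup_ge2 Un_least)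
qed

lemma word_eq_append:
  assumes "word_eq v v'" "word_eq w w'" "v \<in> words" "v' \<in> words" "w \<in> words" "w' \<in> words"
  shows "word_eq (v @ w) (v' @ w')"
proof -
  obtain R S where RS: "R \<subseteq> E" "finite R" "S \<subseteq> E" "finite S"
    "\<And>N t. cocone_on R N t \<Longrightarrow> eval_word N t v = eval_word N t v'"
    "\<And>N t. cocone_on S N t \<Longrightarrow> eval_word N t w = eval_word N t w'"
    using assms(1,2) unfolding word_eq_def by metis
  have "eval_word N t (v @ w) = eval_word N t (v' @ w')" if "cocone_on (R \<union> S) N t" for N t
    using RS(5)[OF cocone_on_subset[OF that]] RS(6)[OF cocone_on_subset[OF that]]
    by (simp add: cocone_on_eval_append[OF that] assms)
  then show ?thesis unfolding word_eq_def using RS(1-4) by (intro exI[of _ "R \<union> S"]) auto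
qed

lemma Nil_in_words: "[] \<in> words"
  and append_in_words: "v \<in> words \<Longrightarrow> w \<in> words \<Longrightarrow> v @ w \<in> words"
  and letter_in_words: "i \<in> I \<Longrightarrow> x \<in> carrier (M i) \<Longrightarrow> [(i, x)] \<in> words"
  by (auto simp: words_def)

text \<open>Equivalent words satisfy the same predicate under the choice operator, hence receive the
  same representative; conversely \<open>code\<close> is injective, so equal codes come from one
  representative of both.\<close>

lemma cls_eq_iff: assumes "v \<in> words" "w \<in> words" shows "cls v = cls w \<longleftrightarrow> word_eq v w"
proof
  have *: "(SOME u. u \<in> words \<and> word_eq u w) \<in> words \<and> word_eq (SOME u. u \<in> words \<and> word_eq u w) w"
    if "w \<in> words" for w
    using that word_eq_refl by (intro someI_ex[of "\<lambda>u. u \<in> words \<and> word_eq u w"]) auto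
  {
    assume "cls v = cls w"
    then have e: "(SOME u. u \<in> words \<and> word_eq u v) = (SOME u. u \<in> words \<and> word_eq u w)"
      unfolding cls_def by (rule code_inject)
    show "word_eq v w"
      using *[OF assms(1), unfolded e] *[OF assms(2)] word_eq_sym word_eq_trans by blast
  next
    assume "word_eq v w"
    then have "(u \<in> words \<and> word_eq u v) = (u \<in> words \<and> word_eq u w)" for u
      by (metis word_eq_sym word_eq_trans)
    then show "cls v = cls w" by (simp add: cls_def)
  }
qed

lemma rep: assumes "w \<in> words" shows "rep (cls w) \<in> words" "word_eq (rep (cls w)) w"
proof -
  have "rep (cls w) \<in> words \<and> cls (rep (cls w)) = cls w"
    unfolding rep_def by (rule someI_ex[of "\<lambda>v. v \<in> words \<and> cls v = cls w"]) (use assms in auto)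
  then show "rep (cls w) \<in> words" "word_eq (rep (cls w)) w" using cls_eq_iff assms by auto
qed

lemma colim_sel:
  "carrier colim = cls ` words" "\<zero>\<^bsub>colim\<^esub> = cls []"
  by (simp_all add: colim_def)

lemma colim_add: "v \<in> words \<Longrightarrow> w \<in> words \<Longrightarrow> cls v \<oplus>\<^bsub>colim\<^esub> cls w = cls (v @ w)"
  using rep[of v] rep[of w] by (simp add: colim_def cls_eq_iff append_in_words word_eq_append)

text \<open>A law of words holds as soon as it holds after evaluation in every abelian group
  \<open>N\<close>, so the group axioms are inherited from the test groups. Concatenation serves as
  addition.\<close>

lemma abelian_group_colim: "abelian_group colim"
proof (rule abelian_groupI)
  fix c d e assume "c \<in> carrier colim" "d \<in> carrier colim" "e \<in> carrier colim"
  then show "c \<oplus>\<^bsub>colim\<^esub> d \<oplus>\<^bsub>colim\<^esub> e = c \<oplus>\<^bsub>colim\<^esub> (d \<oplus>\<^bsub>colim\<^esub> e)"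
    by (auto simp: colim_sel colim_add append_in_words)
next
  fix c d assume "c \<in> carrier colim" "d \<in> carrier colim"
  then obtain v w where vw: "c = cls v" "d = cls w" "v \<in> words" "w \<in> words" by (auto simp: colim_sel)
  then show "c \<oplus>\<^bsub>colim\<^esub> d \<in> carrier colim" by (auto simp: colim_sel colim_add append_in_words)
  have "eval_word N t (v @ w) = eval_word N t (w @ v)" if "cocone_on {} N t" for N t
  proof -
    interpret N: abelian_group N using that by (simp add: cocone_on_def)
    show ?thesis using that vw cocone_on_eval_closed[OF that]
      by (simp add: cocone_on_eval_append N.a_comm)
  qed
  then show "c \<oplus>\<^bsub>colim\<^esub> d = d \<oplus>\<^bsub>colim\<^esub> c"
    using vw by (simp add: colim_add cls_eq_iff append_in_words word_eqI)
next
  fix c assume "c \<in> carrier colim"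
  then obtain w where w: "c = cls w" "w \<in> words" by (auto simp: colim_sel)
  show "\<zero>\<^bsub>colim\<^esub> \<oplus>\<^bsub>colim\<^esub> c = c" using w by (simp add: colim_sel colim_add Nil_in_words)
  \<comment> \<open>The inverse negates every letter in its own group; since cocone maps are
    additive, its value is the negative of the value of \<open>w\<close>.\<close>
  define v where "v = map (\<lambda>p. (fst p, \<ominus>\<^bsub>M (fst p)\<^esub> snd p)) w"
  have v: "v \<in> words"
    using w(2) abelian_group.a_inv_closed[OF group] by (force simp: v_def words_def)
  have neg: "eval_word N t v = \<ominus>\<^bsub>N\<^esub> eval_word N t w" if t: "cocone_on {} N t" for N t
  proof -
    interpret N: abelian_group N using t by (simp add: cocone_on_def)
    show ?thesis using w(2) unfolding v_def
    proof (induction w)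
      case Nil then show ?case by (simp add: N.a_inv_zero)
    next
      case (Cons p w)
      obtain i x where p: "p = (i, x)" "i \<in> I" "x \<in> carrier (M i)" "w \<in> words"
        using Cons.prems by (cases p) (auto simp: words_def)
      then have "t i (\<ominus>\<^bsub>M i\<^esub> x) = \<ominus>\<^bsub>N\<^esub> t i x" "t i x \<in> carrier N"
        using t group by (auto simp: cocone_on_def additive_maps_minus additive_maps_closed)
      then show ?case using Cons.IH p cocone_on_eval_closed[OF t] by (simp add: N.minus_add)
    qed
  qed
  have "word_eq (v @ w) []"
  proof (rule word_eqI)
    fix N t assume t: "cocone_on {} N t"
    interpret N: abelian_group N using t by (simp add: cocone_on_def)
    show "eval_word N t (v @ w) = eval_word N t []"
      using v w(2) neg[OF t] cocone_on_eval_closed[OF t w(2)]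
      by (simp add: cocone_on_eval_append[OF t] N.l_neg)
  qed
  then show "\<exists>d\<in>carrier colim. d \<oplus>\<^bsub>colim\<^esub> c = \<zero>\<^bsub>colim\<^esub>"
    using v w by (intro bexI[of _ "cls v"])
      (simp_all add: colim_sel colim_add cls_eq_iff append_in_words Nil_in_words)
qed (use Nil_in_words in \<open>auto simp: colim_sel\<close>)

lemma small_colim: "small (carrier colim)"
proof (rule small_subset)
  show "small (code ` words)" unfolding words_def
    using small_index small_group by (rule small_code_lists)
  show "carrier colim \<subseteq> code ` words"
  proof
    fix c assume "c \<in> carrier colim"
    then obtain w where w: "c = cls w" "w \<in> words" by (auto simp: colim_sel)
    have "(SOME v. v \<in> words \<and> word_eq v w) \<in> words"
      using someI_ex[of "\<lambda>v. v \<in> words \<and> word_eq v w"] word_eq_refl w(2) by blast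
    then show "c \<in> code ` words" by (simp add: w(1) cls_def)
  qed
qed

lemma coproj_additive: assumes i: "i \<in> I" shows "coproj i \<in> additive_maps (M i) colim"
proof (rule additive_mapsI)
  interpret abelian_group "M i" using i by (rule group)
  fix x y assume "x \<in> carrier (M i)" "y \<in> carrier (M i)"
  moreover have "eval_word N t [(i, x \<oplus>\<^bsub>M i\<^esub> y)] = eval_word N t [(i, x), (i, y)]"
    if "cocone_on {} N t" "x \<in> carrier (M i)" "y \<in> carrier (M i)" for N t
  proof -
    interpret N: abelian_group N using that(1) by (simp add: cocone_on_def)
    have "t i \<in> additive_maps (M i) N" using that(1) i by (auto simp: cocone_on_def)
    then show ?thesis using that
      by (simp add: additive_maps_add N.a_assoc additive_maps_closed)
  qed
  ultimately show "coproj i (x \<oplus>\<^bsub>M i\<^esub> y) = coproj i x \<oplus>\<^bsub>colim\<^esub> coproj i y"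
    using i by (simp add: coproj_def colim_add letter_in_words cls_eq_iff append_in_words[of "[_]"
      "[_]", simplified] word_eqI)
qed (use i in \<open>auto simp: colim_sel coproj_def letter_in_words\<close>)

lemma coproj_edge:
  assumes "(i, j, f) \<in> E" "i \<in> I" "j \<in> I" "f \<in> additive_maps (M i) (M j)" "x \<in> carrier (M i)"
  shows "coproj j (f x) = coproj i x"
proof -
  have "eval_word N t [(j, f x)] = eval_word N t [(i, x)]" if "cocone_on {(i, j, f)} N t" for N t
    using that assms(5) by (auto simp: cocone_on_def)
  then have "word_eq [(j, f x)] [(i, x)]"
    unfolding word_eq_def using assms(1) by (intro exI[of _ "{(i, j, f)}"]) auto
  then show ?thesis
    using assms by (simp add: coproj_def cls_eq_iff letter_in_words additive_maps_closed)
qed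

lemma colim_induct:
  assumes "c \<in> carrier colim" "P \<zero>\<^bsub>colim\<^esub>"
    and step: "\<And>i x c. i \<in> I \<Longrightarrow> x \<in> carrier (M i) \<Longrightarrow> c \<in> carrier colim \<Longrightarrow> P c \<Longrightarrow> P (coproj i x \<oplus>\<^bsub>colim\<^esub> c)"
  shows "P c"
proof -
  have "P (cls w)" if "w \<in> words" for w
    using that
  proof (induction w)
    case Nil then show ?case using assms(2) by (simp add: colim_sel)
  next
    case (Cons p w)
    obtain i x where p: "p = (i, x)" "i \<in> I" "x \<in> carrier (M i)" "w \<in> words"
      using Cons.prems by (cases p) (auto simp: words_def)
    then have "cls (p # w) = coproj i x \<oplus>\<^bsub>colim\<^esub> cls w" by (simp add: coproj_def colim_add letter_in_words)
    then show ?case using step[of i x "cls w"] p Cons.IH by (auto simp: colim_sel)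
  qed
  then show ?thesis using assms(1) by (auto simp: colim_sel)
qed

lemma colim_maps_eqI:
  assumes "f \<in> additive_maps colim N" "g \<in> additive_maps colim N" "abelian_group N"
    and "\<And>i x. i \<in> I \<Longrightarrow> x \<in> carrier (M i) \<Longrightarrow> f (coproj i x) = g (coproj i x)"
    and "c \<in> carrier colim"
  shows "f c = g c"
  using assms(5)
proof (rule colim_induct)
  show "f \<zero>\<^bsub>colim\<^esub> = g \<zero>\<^bsub>colim\<^esub>"
    using assms(1-3) by (simp add: additive_maps_zero abelian_group_colim)
next
  fix i x c assume "i \<in> I" "x \<in> carrier (M i)" "c \<in> carrier colim" "f c = g c"
  then show "f (coproj i x \<oplus>\<^bsub>colim\<^esub> c) = g (coproj i x \<oplus>\<^bsub>colim\<^esub> c)"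
    using assms(1,2,4) by (simp add: additive_maps_add additive_maps_closed[OF coproj_additive])
qed

lemma lift_cls:
  assumes "cocone_on E N t" "w \<in> words" shows "lift N t (cls w) = eval_word N t w"
  using rep[OF assms(2)] cocone_on_subset[OF assms(1)] unfolding lift_def word_eq_def by blast

lemma lift_additive: assumes "cocone_on E N t" shows "lift N t \<in> additive_maps colim N"
proof (rule additive_mapsI)
  fix c d assume "c \<in> carrier colim" "d \<in> carrier colim"
  then obtain v w where vw: "c = cls v" "d = cls w" "v \<in> words" "w \<in> words" by (auto simp: colim_sel)
  then show "lift N t (c \<oplus>\<^bsub>colim\<^esub> d) = lift N t c \<oplus>\<^bsub>N\<^esub> lift N t d"
    by (simp add: colim_add lift_cls[OF assms] append_in_words cocone_on_eval_append[OF assms])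
qed (use cocone_on_eval_closed[OF assms] lift_cls[OF assms] in \<open>auto simp: colim_sel\<close>)

lemma lift_coproj:
  assumes t: "cocone_on E N t" and ix: "i \<in> I" "x \<in> carrier (M i)" shows "lift N t (coproj i x) = t i x"
proof -
  interpret N: abelian_group N using t by (simp add: cocone_on_def)
  show ?thesis unfolding coproj_def using ix cocone_on_closed[OF t letter_in_words[OF ix], of i x]
    by (simp add: lift_cls[OF t] letter_in_words)
qed

text \<open>Unpacks the finiteness built into \<open>word_eq\<close>: an element dies in the colimit
  because of finitely many edges, and hence dies in every cocone over those edges alone.\<close>

lemma coproj_eq_zeroD:
  assumes "i \<in> I" "x \<in> carrier (M i)" "coproj i x = \<zero>\<^bsub>colim\<^esub>"
  obtains R where "R \<subseteq> E" "finite R" "\<And>N t. cocone_on R N t \<Longrightarrow> t i x = \<zero>\<^bsub>N\<^esub>"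
proof -
  have w: "[(i, x)] \<in> words" using assms by (simp add: letter_in_words)
  then have "word_eq [(i, x)] []"
    using assms by (simp add: coproj_def colim_sel cls_eq_iff letter_in_words Nil_in_words)
  then obtain R where R: "R \<subseteq> E" "finite R"
    "\<And>N t. cocone_on R N t \<Longrightarrow> eval_word N t [(i, x)] = eval_word N t []"
    unfolding word_eq_def by metis
  show thesis
  proof (rule that[OF R(1,2)])
    fix N t assume t: "cocone_on R N t"
    interpret N: abelian_group N using t by (simp add: cocone_on_def)
    show "t i x = \<zero>\<^bsub>N\<^esub>" using R(3)[OF t] cocone_on_closed[OF t w, of i x] by simp
  qed
qed

end

text \<open>The quotient is carried by one chosen element of each coset, which keeps it over the
  type \<open>'v\<close>; it can thus serve as a test group for \<open>word_eq\<close>.\<close>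

lemma quotient_group:
  fixes G :: "('v, 'v) module"
  assumes "abelian_group G" "H \<subseteq> carrier G" "\<zero>\<^bsub>G\<^esub> \<in> H"
    and add: "\<And>x y. x \<in> H \<Longrightarrow> y \<in> H \<Longrightarrow> x \<oplus>\<^bsub>G\<^esub> y \<in> H"
    and minus: "\<And>x. x \<in> H \<Longrightarrow> \<ominus>\<^bsub>G\<^esub> x \<in> H"
  obtains N :: "('v, 'v) module" and p where "abelian_group N" "p \<in> additive_maps G N"
    "\<And>x. x \<in> carrier G \<Longrightarrow> p x = \<zero>\<^bsub>N\<^esub> \<longleftrightarrow> x \<in> H"
proof -
  interpret abelian_group G by fact
  define p where "p x = (SOME y. y \<in> carrier G \<and> y \<ominus>\<^bsub>G\<^esub> x \<in> H)" for x
  have p: "p x \<in> carrier G" "p x \<ominus>\<^bsub>G\<^esub> x \<in> H" if "x \<in> carrier G" for x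
  proof -
    have "x \<in> carrier G \<and> x \<ominus>\<^bsub>G\<^esub> x \<in> H" using that assms(3) by (simp add: r_neg a_minus_def)
    then have "p x \<in> carrier G \<and> p x \<ominus>\<^bsub>G\<^esub> x \<in> H" unfolding p_def
      by (rule someI[of "\<lambda>y. y \<in> carrier G \<and> y \<ominus>\<^bsub>G\<^esub> x \<in> H"])
    then show "p x \<in> carrier G" "p x \<ominus>\<^bsub>G\<^esub> x \<in> H" by auto
  qed
  have sym: "y \<ominus>\<^bsub>G\<^esub> x \<in> H" if "x \<ominus>\<^bsub>G\<^esub> y \<in> H" "x \<in> carrier G" "y \<in> carrier G" for x y
    using minus[OF that(1)] that(2,3) by (simp add: a_minus_def minus_add a_comm)
  have trans: "x \<ominus>\<^bsub>G\<^esub> z \<in> H" if "x \<ominus>\<^bsub>G\<^esub> y \<in> H" "y \<ominus>\<^bsub>G\<^esub> z \<in> H" "x \<in> carrier G" "y \<in> carrier G"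
    "z \<in> carrier G" for x y z
    using add[OF that(1,2)] that(3-) by (simp add: a_minus_def a_assoc r_neg1)
  have p_eq: "p x = p y \<longleftrightarrow> x \<ominus>\<^bsub>G\<^esub> y \<in> H" if xy: "x \<in> carrier G" "y \<in> carrier G" for x y
  proof
    assume "p x = p y" then show "x \<ominus>\<^bsub>G\<^esub> y \<in> H"
      using trans[of x "p x" y] sym[of "p x" x] p[OF xy(1)] p[OF xy(2)] xy by simp
  next
    assume d: "x \<ominus>\<^bsub>G\<^esub> y \<in> H"
    have "(z \<in> carrier G \<and> z \<ominus>\<^bsub>G\<^esub> x \<in> H) = (z \<in> carrier G \<and> z \<ominus>\<^bsub>G\<^esub> y \<in> H)" for z
      using trans[of z x y] trans[of z y x] d sym[OF d xy] xy by blast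
    then show "p x = p y" by (simp add: p_def)
  qed
  define N :: "('v, 'v) module" where "N = \<lparr>carrier = p ` carrier G, mult = (\<lambda>_ _. p \<zero>\<^bsub>G\<^esub>), one = p \<zero>\<^bsub>G\<^esub>,
    zero = p \<zero>\<^bsub>G\<^esub>, add = (\<lambda>x y. p (x \<oplus>\<^bsub>G\<^esub> y)), smult = (\<lambda>_ _. p \<zero>\<^bsub>G\<^esub>)\<rparr>"
  have sel: "carrier N = p ` carrier G" "\<zero>\<^bsub>N\<^esub> = p \<zero>\<^bsub>G\<^esub>" by (simp_all add: N_def)
  have addN: "p x \<oplus>\<^bsub>N\<^esub> p y = p (x \<oplus>\<^bsub>G\<^esub> y)" if xy: "x \<in> carrier G" "y \<in> carrier G" for x y
  proof -
    have "(p x \<oplus>\<^bsub>G\<^esub> p y) \<ominus>\<^bsub>G\<^esub> (x \<oplus>\<^bsub>G\<^esub> y) = (p x \<ominus>\<^bsub>G\<^esub> x) \<oplus>\<^bsub>G\<^esub> (p y \<ominus>\<^bsub>G\<^esub> y)"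
      using xy p(1) by (simp add: a_minus_def minus_add a_ac)
    then show ?thesis using p add xy by (simp add: N_def p_eq)
  qed
  have "abelian_group N"
  proof (rule abelian_groupI)
    fix c assume "c \<in> carrier N"
    then obtain x where "c = p x" "x \<in> carrier G" by (auto simp: sel)
    then show "\<exists>d\<in>carrier N. d \<oplus>\<^bsub>N\<^esub> c = \<zero>\<^bsub>N\<^esub>"
      by (intro bexI[of _ "p (\<ominus>\<^bsub>G\<^esub> x)"]) (auto simp: sel addN l_neg)
  qed (auto simp: sel addN a_ac)
  moreover have "p \<in> additive_maps G N" by (rule additive_mapsI) (auto simp: sel addN)
  moreover have "p x = \<zero>\<^bsub>N\<^esub> \<longleftrightarrow> x \<in> H" if "x \<in> carrier G" for x
    using that by (simp add: sel p_eq a_minus_def a_inv_zero)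
  ultimately show thesis by (rule that)
qed

section \<open>Decorated grounded chains as families of groups with operators\<close>

lemma abelian_group_smult_update [simp]: "abelian_group (G\<lparr>smult := f\<rparr>) \<longleftrightarrow> abelian_group G"
  by (simp add: abelian_group_def abelian_group_axioms_def abelian_monoid_def)

lemma additive_maps_smult_update [simp]:
  "additive_maps (G\<lparr>smult := f\<rparr>) H = additive_maps G H"
  "additive_maps G' (H'\<lparr>smult := f'\<rparr>) = additive_maps G' H'"
  by (simp_all add: additive_maps_def)

lemma eval_word_smult_update [simp]: "eval_word (G\<lparr>smult := f\<rparr>) t w = eval_word G t w"
  by (induction w) auto

section \<open>Spans as sets of finite linear combinations\<close>

lemma in_lists_TimesD: "w \<in> lists (A \<times> B) \<Longrightarrow> (a, b) \<in> set w \<Longrightarrow> a \<in> A \<and> b \<in> B"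
  by auto

lemma map_in_lists: "w \<in> lists A \<Longrightarrow> (\<And>p. p \<in> A \<Longrightarrow> f p \<in> B) \<Longrightarrow> map f w \<in> lists B"
  by auto

text \<open>The values of words form a submodule: concatenation gives sums, and scaling by minus one
  gives negatives. Groundedness can then be computed with words instead of intersections of
  submodules.\<close>

lemma module_span_eq_eval_word:
  fixes M :: "('a, 'b) module"
  assumes "module R M" "A \<subseteq> carrier M"
  shows "module_span R M A = eval_word M (smult M) ` lists (carrier R \<times> A)"
proof
  interpret module R M by fact
  let ?e = "eval_word M (smult M)"
  have mem: "a \<odot>\<^bsub>M\<^esub> x \<in> carrier M" if "w \<in> lists (carrier R \<times> A)" "(a, x) \<in> set w" for w a x
    using in_lists_TimesD[OF that] assms(2) by auto
  have closed: "?e w \<in> carrier M" if "w \<in> lists (carrier R \<times> A)" for w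
    using mem[OF that] by (rule eval_word_closed[OF M.abelian_group_axioms])
  have scale: "a \<odot>\<^bsub>M\<^esub> ?e w = ?e (map (\<lambda>p. (a \<otimes>\<^bsub>R\<^esub> fst p, snd p)) w)"
    if "w \<in> lists (carrier R \<times> A)" "a \<in> carrier R" for w a
    using that
  proof (induction w)
    case (Cons p w)
    obtain b x where p: "p = (b, x)" "b \<in> carrier R" "x \<in> carrier M" using Cons assms(2) by (cases p) auto
    then show ?case using Cons closed[of w] by (simp add: smult_r_distr smult_assoc1)
  qed simp
  have scale_in: "map (\<lambda>p. (a \<otimes>\<^bsub>R\<^esub> fst p, snd p)) w \<in> lists (carrier R \<times> A)"
    if "w \<in> lists (carrier R \<times> A)" "a \<in> carrier R" for w a
    using that by (intro map_in_lists[of w "carrier R \<times> A"]) auto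
  have "submodule (?e ` lists (carrier R \<times> A)) R M"
  proof (rule submoduleI)
    show "?e ` lists (carrier R \<times> A) \<subseteq> carrier M" using closed by auto
    show "\<zero>\<^bsub>M\<^esub> \<in> ?e ` lists (carrier R \<times> A)" by (rule image_eqI[of _ _ "[]"]) auto
  next
    fix y assume "y \<in> ?e ` lists (carrier R \<times> A)"
    then obtain w where w: "y = ?e w" "w \<in> lists (carrier R \<times> A)" by auto
    have "\<ominus>\<^bsub>M\<^esub> y = (\<ominus>\<^bsub>R\<^esub> \<one>\<^bsub>R\<^esub>) \<odot>\<^bsub>M\<^esub> y" using closed[OF w(2)] by (simp add: smult_l_minus w(1))
    then show "\<ominus>\<^bsub>M\<^esub> y \<in> ?e ` lists (carrier R \<times> A)"
      using scale[OF w(2)] scale_in[OF w(2)] w(1) by (auto intro!: image_eqI)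
  next
    fix y z assume "y \<in> ?e ` lists (carrier R \<times> A)" "z \<in> ?e ` lists (carrier R \<times> A)"
    then obtain v w where vw: "y = ?e v" "z = ?e w" "v \<in> lists (carrier R \<times> A)"
      "w \<in> lists (carrier R \<times> A)" by auto
    have "y \<oplus>\<^bsub>M\<^esub> z = ?e (v @ w)"
      using mem[OF vw(3)] mem[OF vw(4)] by (simp add: vw eval_word_append[OF M.abelian_group_axioms])
    then show "y \<oplus>\<^bsub>M\<^esub> z \<in> ?e ` lists (carrier R \<times> A)" using vw by (auto intro!: image_eqI)
  next
    fix a y assume "a \<in> carrier R" "y \<in> ?e ` lists (carrier R \<times> A)"
    then show "a \<odot>\<^bsub>M\<^esub> y \<in> ?e ` lists (carrier R \<times> A)" using scale scale_in by blast
  qed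
  moreover have "A \<subseteq> ?e ` lists (carrier R \<times> A)"
  proof
    fix x assume "x \<in> A"
    then show "x \<in> ?e ` lists (carrier R \<times> A)" using assms(2)
      by (intro image_eqI[of _ _ "[(\<one>\<^bsub>R\<^esub>, x)]"]) auto
  qed
  ultimately show "module_span R M A \<subseteq> ?e ` lists (carrier R \<times> A)" by (auto simp: module_span_def)
  have "?e w \<in> H" if "submodule H R M" "A \<subseteq> H" "w \<in> lists (carrier R \<times> A)" for H w
    using that(3)
  proof (induction w)
    case Nil then show ?case using subgroup.one_closed[OF submodule.axioms(1)[OF that(1)]] by simp
  next
    case (Cons p w)
    then show ?case using that(2) submoduleE(4,5)[OF that(1)] by (cases p) auto
  qed
  then show "?e ` lists (carrier R \<times> A) \<subseteq> module_span R M A" by (auto simp: module_span_def)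
qed

section \<open>Scalars, transition maps and labels as one family of operators\<close>

datatype 'v operator = Scalar 'v 'v | Transition 'v 'v | Label 'v 'v

primrec source :: "'v operator \<Rightarrow> 'v" where
  "source (Scalar \<alpha> a) = \<alpha>"
| "source (Transition \<beta> \<alpha>) = \<alpha>"
| "source (Label s \<alpha>) = \<alpha>"

primrec target :: "'v operator \<Rightarrow> 'v" where
  "target (Scalar \<alpha> a) = \<alpha>"
| "target (Transition \<beta> \<alpha>) = \<beta>"
| "target (Label s \<alpha>) = \<alpha>"

abbreviation level :: "('v chain, 'v, 'm) decorated \<Rightarrow> 'v \<Rightarrow> ('v, 'v) module" where
  "level D \<equiv> space (underlying D)"

primrec opr :: "('v chain, 'v, 'v \<Rightarrow> 'v \<Rightarrow> 'v) decorated \<Rightarrow> 'v operator \<Rightarrow> 'v \<Rightarrow> 'v" where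
  "opr D (Scalar \<alpha> a) = smult (level D \<alpha>) a"
| "opr D (Transition \<beta> \<alpha>) = trans_map (underlying D) \<beta> \<alpha>"
| "opr D (Label s \<alpha>) = (\<lambda>x. if s \<in> labels D then snd (snd D) s \<alpha> x else \<zero>\<^bsub>level D \<alpha>\<^esub>)"

text \<open>The scalar multiplication of \<open>G \<alpha>\<close> is overwritten by the operators,
  so any record with the right additive part will do. Labels are cut down to extensional functions
  because hom sets consist of such.\<close>

definition mk_decorated :: "('v \<Rightarrow> ('v, 'v) module) \<Rightarrow> ('v::set_universe operator \<Rightarrow> 'v \<Rightarrow> 'v) \<Rightarrow> 'v set
    \<Rightarrow> ('v chain, 'v, 'v \<Rightarrow> 'v \<Rightarrow> 'v) decorated" where
  "mk_decorated G act S =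
    (\<lparr>space = (\<lambda>\<alpha>. (G \<alpha>)\<lparr>smult := \<lambda>a. act (Scalar \<alpha> a)\<rparr>),
      trans_map = (\<lambda>\<beta> \<alpha>. act (Transition \<beta> \<alpha>))\<rparr>,
     S, \<lambda>s\<in>S. \<lambda>\<alpha>\<in>ON. \<lambda>x\<in>carrier (G \<alpha>). act (Label s \<alpha>) x)"

lemma mk_decorated_sel [simp]:
  "level (mk_decorated G act S) \<alpha> = (G \<alpha>)\<lparr>smult := \<lambda>a. act (Scalar \<alpha> a)\<rparr>"
  "labels (mk_decorated G act S) = S"
  by (simp_all add: mk_decorated_def underlying_def labels_def)

text \<open>Coefficients belong to the level \<open>\<beta>\<close>, vectors to the base level
  \<open>\<alpha>\<close>. Keeping the two apart in the word is what permits elimination of vectors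
  for subobjects and counting of coefficients for products.\<close>

definition lincomb :: "('v \<Rightarrow> ('v, 'v) module) \<Rightarrow> ('v operator \<Rightarrow> 'v \<Rightarrow> 'v) \<Rightarrow> 'v \<Rightarrow> 'v \<Rightarrow> ('v \<times> 'v) list \<Rightarrow> 'v" where
  "lincomb G act \<beta> \<alpha> = eval_word (G \<beta>) (\<lambda>a x. act (Scalar \<beta> a) (act (Transition \<beta> \<alpha>) x))"

context field_tower
begin

abbreviation chains :: "('v chain, 'v \<Rightarrow> 'v \<Rightarrow> 'v) ab_precategory" where
  "chains \<equiv> grounded_chains k \<iota>"

abbreviation decorations :: "(('v chain, 'v, 'v \<Rightarrow> 'v \<Rightarrow> 'v) decorated, 'v \<Rightarrow> 'v \<Rightarrow> 'v) ab_precategory" where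
  "decorations \<equiv> set_decoration TYPE('v) chains"

definition operators :: "'v operator set" where
  "operators = {Scalar \<alpha> a | \<alpha> a. \<alpha> \<in> ON \<and> a \<in> carrier (k \<alpha>)} \<union>
    {Transition \<beta> \<alpha> | \<alpha> \<beta>. \<alpha> \<in> ON \<and> \<beta> \<in> ON \<and> \<alpha> \<preceq> \<beta>} \<union> {Label s \<alpha> | s \<alpha>. \<alpha> \<in> ON}"

lemma operators_iff [simp]:
  "Scalar \<alpha> a \<in> operators \<longleftrightarrow> \<alpha> \<in> ON \<and> a \<in> carrier (k \<alpha>)"
  "Transition \<beta> \<alpha> \<in> operators \<longleftrightarrow> \<alpha> \<in> ON \<and> \<beta> \<in> ON \<and> \<alpha> \<preceq> \<beta>"
  "Label s \<alpha> \<in> operators \<longleftrightarrow> \<alpha> \<in> ON"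
  by (auto simp: operators_def)

lemma cring_level: "\<alpha> \<in> ON \<Longrightarrow> cring (k \<alpha>)"
  using field by (rule domain.axioms(1)[OF field.axioms(1)])

lemma operators_levels: "x \<in> operators \<Longrightarrow> source x \<in> ON \<and> target x \<in> ON"
  by (cases x) simp_all

end

text \<open>An equational presentation of an object. Apart from smallness and groundedness, the
  axioms assert additivity of operators and identities between additive maps, which on a colimit
  need checking only on the images of the diagram.\<close>

locale operator_structure = field_tower k \<iota>
  for k :: "'v::set_universe \<Rightarrow> 'v ring" and \<iota> :: "'v \<Rightarrow> 'v \<Rightarrow> 'v \<Rightarrow> 'v" +
  fixes G :: "'v \<Rightarrow> ('v, 'v) module" and act :: "'v operator \<Rightarrow> 'v \<Rightarrow> 'v" and S :: "'v set"
  assumes group: "\<alpha> \<in> ON \<Longrightarrow> abelian_group (G \<alpha>)"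
    and small_group: "\<alpha> \<in> ON \<Longrightarrow> small (carrier (G \<alpha>))"
    and small_labels: "small S"
    and act_additive: "q \<in> operators \<Longrightarrow> act q \<in> additive_maps (G (source q)) (G (target q))"
    and scalar_add: "\<lbrakk>\<alpha> \<in> ON; a \<in> carrier (k \<alpha>); b \<in> carrier (k \<alpha>); x \<in> carrier (G \<alpha>)\<rbrakk> \<Longrightarrow>
      act (Scalar \<alpha> (a \<oplus>\<^bsub>k \<alpha>\<^esub> b)) x = act (Scalar \<alpha> a) x \<oplus>\<^bsub>G \<alpha>\<^esub> act (Scalar \<alpha> b) x"
    and scalar_mult: "\<lbrakk>\<alpha> \<in> ON; a \<in> carrier (k \<alpha>); b \<in> carrier (k \<alpha>); x \<in> carrier (G \<alpha>)\<rbrakk> \<Longrightarrow>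
      act (Scalar \<alpha> (a \<otimes>\<^bsub>k \<alpha>\<^esub> b)) x = act (Scalar \<alpha> a) (act (Scalar \<alpha> b) x)"
    and scalar_one: "\<lbrakk>\<alpha> \<in> ON; x \<in> carrier (G \<alpha>)\<rbrakk> \<Longrightarrow> act (Scalar \<alpha> \<one>\<^bsub>k \<alpha>\<^esub>) x = x"
    and transition_id: "\<lbrakk>\<alpha> \<in> ON; x \<in> carrier (G \<alpha>)\<rbrakk> \<Longrightarrow> act (Transition \<alpha> \<alpha>) x = x"
    and transition_comp: "\<lbrakk>\<alpha> \<in> ON; \<beta> \<in> ON; \<gamma> \<in> ON; \<alpha> \<preceq> \<beta>; \<beta> \<preceq> \<gamma>; x \<in> carrier (G \<alpha>)\<rbrakk> \<Longrightarrow>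
      act (Transition \<gamma> \<beta>) (act (Transition \<beta> \<alpha>) x) = act (Transition \<gamma> \<alpha>) x"
    and transition_scalar: "\<lbrakk>\<alpha> \<in> ON; \<beta> \<in> ON; \<alpha> \<preceq> \<beta>; a \<in> carrier (k \<alpha>); x \<in> carrier (G \<alpha>)\<rbrakk> \<Longrightarrow>
      act (Transition \<beta> \<alpha>) (act (Scalar \<alpha> a) x) = act (Scalar \<beta> (\<iota> \<beta> \<alpha> a)) (act (Transition \<beta> \<alpha>) x)"
    and label_scalar: "\<lbrakk>\<alpha> \<in> ON; a \<in> carrier (k \<alpha>); x \<in> carrier (G \<alpha>)\<rbrakk> \<Longrightarrow>
      act (Label s \<alpha>) (act (Scalar \<alpha> a) x) = act (Scalar \<alpha> a) (act (Label s \<alpha>) x)"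
    and label_transition: "\<lbrakk>\<alpha> \<in> ON; \<beta> \<in> ON; \<alpha> \<preceq> \<beta>; x \<in> carrier (G \<alpha>)\<rbrakk> \<Longrightarrow>
      act (Label s \<beta>) (act (Transition \<beta> \<alpha>) x) = act (Transition \<beta> \<alpha>) (act (Label s \<alpha>) x)"
    and label_zero: "\<lbrakk>\<alpha> \<in> ON; s \<notin> S; x \<in> carrier (G \<alpha>)\<rbrakk> \<Longrightarrow> act (Label s \<alpha>) x = \<zero>\<^bsub>G \<alpha>\<^esub>"
    and grounded: "\<exists>\<alpha>\<in>ON. \<forall>\<beta>\<in>ON. \<alpha> \<prec> \<beta> \<longrightarrow>
      carrier (G \<beta>) \<subseteq> lincomb G act \<beta> \<alpha> ` lists (carrier (k \<beta>) \<times> carrier (G \<alpha>))"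
begin

lemma act_closed: "q \<in> operators \<Longrightarrow> x \<in> carrier (G (source q)) \<Longrightarrow> act q x \<in> carrier (G (target q))"
  by (rule additive_maps_closed[OF act_additive])

lemma scalar_closed: "\<alpha> \<in> ON \<Longrightarrow> a \<in> carrier (k \<alpha>) \<Longrightarrow> x \<in> carrier (G \<alpha>) \<Longrightarrow> act (Scalar \<alpha> a) x \<in> carrier (G \<alpha>)"
  using act_closed[of "Scalar \<alpha> a" x] by simp

lemma transition_closed:
  "\<alpha> \<in> ON \<Longrightarrow> \<beta> \<in> ON \<Longrightarrow> \<alpha> \<preceq> \<beta> \<Longrightarrow> x \<in> carrier (G \<alpha>) \<Longrightarrow> act (Transition \<beta> \<alpha>) x \<in> carrier (G \<beta>)"
  using act_closed[of "Transition \<beta> \<alpha>" x] by simp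

lemma label_closed: "\<alpha> \<in> ON \<Longrightarrow> x \<in> carrier (G \<alpha>) \<Longrightarrow> act (Label s \<alpha>) x \<in> carrier (G \<alpha>)"
  using act_closed[of "Label s \<alpha>" x] by simp

lemma module_level:
  assumes "\<alpha> \<in> ON" shows "module (k \<alpha>) ((G \<alpha>)\<lparr>smult := \<lambda>a. act (Scalar \<alpha> a)\<rparr>)"
proof (rule moduleI)
  show "cring (k \<alpha>)" using assms by (rule cring_level)
qed (use assms group act_additive[of "Scalar \<alpha> _"] in
  \<open>auto simp: scalar_closed scalar_add scalar_mult scalar_one additive_maps_add\<close>)

lemma mk_decorated_in_Ob: "mk_decorated G act S \<in> Ob decorations"
proof -
  let ?D = "mk_decorated G act S"
  let ?V = "underlying ?D"
  have trans: "trans_map ?V \<beta> \<alpha> = act (Transition \<beta> \<alpha>)" for \<beta> \<alpha>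
    by (simp add: mk_decorated_def underlying_def)
  have chain: "is_chain k \<iota> ?V"
    unfolding is_chain_def trans mk_decorated_sel
  proof (intro conjI ballI impI)
    fix \<alpha> \<beta> :: 'v assume *: "\<alpha> \<in> ON" "\<beta> \<in> ON" "\<alpha> \<preceq> \<beta>"
    then show "act (Transition \<beta> \<alpha>) \<in> linear_maps (k \<alpha>) ((G \<alpha>)\<lparr>smult := \<lambda>a. act (Scalar \<alpha> a)\<rparr>)
      (restrict_scalars (\<iota> \<beta> \<alpha>) ((G \<beta>)\<lparr>smult := \<lambda>a. act (Scalar \<beta> a)\<rparr>))"
      using act_additive[of "Transition \<beta> \<alpha>"]
      by (auto simp: linear_maps_def restrict_scalars_def additive_maps_def transition_scalar)
  qed (use small_group in \<open>auto simp: module_level transition_id transition_comp\<close>)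
  obtain \<alpha> where \<alpha>: "\<alpha> \<in> ON" "\<And>\<beta>. \<beta> \<in> ON \<Longrightarrow> \<alpha> \<prec> \<beta> \<Longrightarrow>
      carrier (G \<beta>) \<subseteq> lincomb G act \<beta> \<alpha> ` lists (carrier (k \<beta>) \<times> carrier (G \<alpha>))"
    using grounded by blast
  have "grounded_at k ?V \<alpha>" unfolding grounded_at_def trans
  proof (intro ballI impI)
    fix \<beta> :: 'v assume \<beta>: "\<beta> \<in> ON" "\<alpha> \<prec> \<beta>"
    let ?M = "level ?D \<beta>"
    let ?A = "act (Transition \<beta> \<alpha>) ` carrier (level ?D \<alpha>)"
    have A: "?A \<subseteq> carrier ?M"
      using \<alpha>(1) \<beta> by (auto simp: transition_closed ord_less_imp_le)
    have m: "module (k \<beta>) ?M" using module_level[OF \<beta>(1)] by simp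
    have "carrier ?M \<subseteq> module_span (k \<beta>) ?M ?A"
    proof
      fix x assume "x \<in> carrier ?M"
      then obtain w where w: "x = lincomb G act \<beta> \<alpha> w" "w \<in> lists (carrier (k \<beta>) \<times> carrier (G \<alpha>))"
        using \<alpha>(2)[OF \<beta>] by auto
      \<comment> \<open>Moving the vectors to level \<open>\<beta>\<close> beforehand turns
        \<open>lincomb\<close> into an ordinary combination of elements of
        \<open>?A\<close>.\<close>
      let ?w = "map (\<lambda>p. (fst p, act (Transition \<beta> \<alpha>) (snd p))) w"
      have "x = eval_word ?M (smult ?M) ?w"
        unfolding w(1) lincomb_def by (induction w) auto
      moreover have "?w \<in> lists (carrier (k \<beta>) \<times> ?A)" by (rule map_in_lists[OF w(2)]) auto
      ultimately show "x \<in> module_span (k \<beta>) ?M ?A"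
        unfolding module_span_eq_eval_word[OF m A] by (rule image_eqI)
    qed
    moreover have "module_span (k \<beta>) ?M ?A \<subseteq> carrier ?M"
      unfolding module_span_eq_eval_word[OF m A]
    proof (rule image_subsetI)
      fix w assume w: "w \<in> lists (carrier (k \<beta>) \<times> ?A)"
      show "eval_word ?M (smult ?M) w \<in> carrier ?M"
        by (rule eval_word_closed[OF module.axioms(2)[OF m]], rule module.smult_closed[OF m])
          (use in_lists_TimesD[OF w] A in blast)+
    qed
    ultimately show "module_span (k \<beta>) ?M ?A = carrier ?M" by simp
  qed
  then have "grounded k ?V" using \<alpha>(1) by (auto simp: grounded_def)
  moreover have "(\<lambda>\<alpha>\<in>ON. \<lambda>x\<in>carrier (G \<alpha>). act (Label s \<alpha>) x) \<in> chain_mor k ?V ?V" for s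
    using act_additive[of "Label s _"]
    by (auto simp: chain_mor_def linear_maps_def trans additive_maps_def label_scalar label_transition
        group abelian_groupE(1) scalar_closed transition_closed label_closed)
  ultimately show ?thesis using chain small_labels
    by (auto simp: set_decoration_def grounded_chains_def full_subcategory_def chain_category_def
        mk_decorated_def underlying_def)
qed

lemma opr_mk_decorated:
  "q \<in> operators \<Longrightarrow> x \<in> carrier (G (source q)) \<Longrightarrow> opr (mk_decorated G act S) q x = act q x"
  by (cases q) (auto simp: mk_decorated_def underlying_def labels_def label_zero)

end

context field_tower
begin

text \<open>Converse of \<open>mk_decorated_in_Ob\<close>: every object is an operator structure, so
  objects can be handled through the axioms of the locale.\<close>

lemma operator_structure_opr:
  assumes "D \<in> Ob decorations"
  shows "operator_structure k \<iota> (level D) (opr D) (labels D)"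
proof -
  obtain V S f where D: "D = (V, S, f)" by (cases D)
  have V: "is_chain k \<iota> V" "Defs.grounded k V" "small S" "f \<in> S \<rightarrow>\<^sub>E chain_mor k V V"
    using assms by (auto simp: D set_decoration_def grounded_chains_def full_subcategory_def
      chain_category_def)
  have [simp]: "underlying D = V" "labels D = S" "snd (snd D) = f" by (auto simp: D underlying_def labels_def)
  have mod: "module (k \<alpha>) (space V \<alpha>)" "small (carrier (space V \<alpha>))" if "\<alpha> \<in> ON" for \<alpha>
    using V(1) that by (auto simp: is_chain_def)
  have tr: "trans_map V \<beta> \<alpha> \<in> linear_maps (k \<alpha>) (space V \<alpha>) (restrict_scalars (\<iota> \<beta> \<alpha>) (space V \<beta>))"
    if "\<alpha> \<in> ON" "\<beta> \<in> ON" "\<alpha> \<preceq> \<beta>" for \<alpha> \<beta>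
    using V(1) that by (auto simp: is_chain_def)
  have f: "f s \<alpha> x \<in> carrier (space V \<alpha>)"
      "y \<in> carrier (space V \<alpha>) \<Longrightarrow> f s \<alpha> (x \<oplus>\<^bsub>space V \<alpha>\<^esub> y) = f s \<alpha> x \<oplus>\<^bsub>space V \<alpha>\<^esub> f s \<alpha> y"
      "a \<in> carrier (k \<alpha>) \<Longrightarrow> f s \<alpha> (a \<odot>\<^bsub>space V \<alpha>\<^esub> x) = a \<odot>\<^bsub>space V \<alpha>\<^esub> f s \<alpha> x"
      "\<beta> \<in> ON \<Longrightarrow> \<alpha> \<preceq> \<beta> \<Longrightarrow> f s \<beta> (trans_map V \<beta> \<alpha> x) = trans_map V \<beta> \<alpha> (f s \<alpha> x)"
    if "s \<in> S" "\<alpha> \<in> ON" "x \<in> carrier (space V \<alpha>)" for s \<alpha> \<beta> a x y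
  proof -
    have "f s \<in> chain_mor k V V" using V(4) that by auto
    then have *: "f s \<alpha> \<in> linear_maps (k \<alpha>) (space V \<alpha>) (space V \<alpha>)"
      "\<beta> \<in> ON \<Longrightarrow> \<alpha> \<preceq> \<beta> \<Longrightarrow> f s \<beta> (trans_map V \<beta> \<alpha> x) = trans_map V \<beta> \<alpha> (f s \<alpha> x)"
      using that by (auto simp: chain_mor_def PiE_iff)
    show "f s \<alpha> x \<in> carrier (space V \<alpha>)"
      "y \<in> carrier (space V \<alpha>) \<Longrightarrow> f s \<alpha> (x \<oplus>\<^bsub>space V \<alpha>\<^esub> y) = f s \<alpha> x \<oplus>\<^bsub>space V \<alpha>\<^esub> f s \<alpha> y"
      "a \<in> carrier (k \<alpha>) \<Longrightarrow> f s \<alpha> (a \<odot>\<^bsub>space V \<alpha>\<^esub> x) = a \<odot>\<^bsub>space V \<alpha>\<^esub> f s \<alpha> x"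
      using *(1) that(3) by (auto simp: linear_maps_def)
    show "\<beta> \<in> ON \<Longrightarrow> \<alpha> \<preceq> \<beta> \<Longrightarrow> f s \<beta> (trans_map V \<beta> \<alpha> x) = trans_map V \<beta> \<alpha> (f s \<alpha> x)"
      by (rule *(2))
  qed
  have grp: "abelian_group (space V \<alpha>)" if "\<alpha> \<in> ON" for \<alpha> using mod(1)[OF that] by (rule module.axioms(2))
  show ?thesis
  \<comment> \<open>Goals are numbered as in the locale: 1 the tower, 2 to 4 groups and smallness, 5
    additivity, 6 to 11 scalars and transitions, 12 to 14 labels, 15 groundedness.\<close>
  proof (intro operator_structure.intro operator_structure_axioms.intro, goal_cases)
    case 1 show ?case by (rule field_tower_axioms)
  next
    case (5 q)
    show ?case
    proof (cases q)
      case (Scalar \<alpha> a)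
      then show ?thesis using 5 mod(1)[of \<alpha>]
        by (auto intro!: additive_mapsI simp: module.smult_closed module.smult_r_distr)
    next
      case (Transition \<beta> \<alpha>)
      then show ?thesis using 5 tr[of \<alpha> \<beta>]
        by (auto intro!: additive_mapsI simp: linear_maps_def restrict_scalars_def)
    next
      case (Label s \<alpha>)
      then show ?thesis using 5 f(1,2)[of s \<alpha>] abelian_groupE(2,5)[OF grp[of \<alpha>]]
        by (auto intro!: additive_mapsI)
    qed
  next
    case (6 \<alpha> a b x) then show ?case using mod(1)[of \<alpha>] by (simp add: module.smult_l_distr)
  next
    case (7 \<alpha> a b x) then show ?case using mod(1)[of \<alpha>] by (simp add: module.smult_assoc1)
  next
    case (8 \<alpha> x) then show ?case using mod(1)[of \<alpha>] by (simp add: module.smult_one)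
  next
    case (11 \<alpha> \<beta> a x) then show ?case using tr[of \<alpha> \<beta>]
      by (auto simp: linear_maps_def restrict_scalars_def)
  next
    case (12 \<alpha> a x s)
    then show ?case using f(3)[of s \<alpha> x a] module.smult_r_null[OF mod(1)[of \<alpha>]] by auto
  next
    \<comment> \<open>For an absent label both sides are zero, provided that the transition map
      preserves zero.\<close>
    case (13 \<alpha> \<beta> x s)
    then have "trans_map V \<beta> \<alpha> \<in> additive_maps (space V \<alpha>) (space V \<beta>)"
      using tr[of \<alpha> \<beta>] by (auto simp: linear_maps_def restrict_scalars_def additive_maps_def)
    then have "trans_map V \<beta> \<alpha> \<zero>\<^bsub>space V \<alpha>\<^esub> = \<zero>\<^bsub>space V \<beta>\<^esub>"
      using 13 by (intro additive_maps_zero grp)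
    then show ?case using 13 f(4)[of s \<alpha> x \<beta>] by simp
  next
    case 15
    obtain \<alpha> where \<alpha>: "\<alpha> \<in> ON" "grounded_at k V \<alpha>" using V(2) by (auto simp: grounded_def)
    have "carrier (space V \<beta>) \<subseteq> lincomb (space V) (opr D) \<beta> \<alpha> ` lists (carrier (k \<beta>) \<times> carrier (space V \<alpha>))"
      if \<beta>: "\<beta> \<in> ON" "\<alpha> \<prec> \<beta>" for \<beta>
    proof
      fix x assume "x \<in> carrier (space V \<beta>)"
      let ?A = "trans_map V \<beta> \<alpha> ` carrier (space V \<alpha>)"
      have A: "?A \<subseteq> carrier (space V \<beta>)"
        using tr[OF \<alpha>(1) \<beta>(1) ord_less_imp_le[OF \<beta>(2)]] by (auto simp: linear_maps_def restrict_scalars_def)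
      have "x \<in> eval_word (space V \<beta>) (smult (space V \<beta>)) ` lists (carrier (k \<beta>) \<times> ?A)"
        using \<open>x \<in> _\<close> \<alpha>(2) \<beta> module_span_eq_eval_word[OF mod(1)[OF \<beta>(1)] A] by (auto simp: grounded_at_def)
      then obtain w where w: "x = eval_word (space V \<beta>) (smult (space V \<beta>)) w"
        "w \<in> lists (carrier (k \<beta>) \<times> ?A)" by blast
      have "\<exists>v\<in>lists (carrier (k \<beta>) \<times> carrier (space V \<alpha>)).
        eval_word (space V \<beta>) (smult (space V \<beta>)) w = lincomb (space V) (opr D) \<beta> \<alpha> v"
        using w(2)
      proof (induction w)
        case Nil show ?case by (rule bexI[of _ "[]"]) (auto simp: lincomb_def)
      next
        case (Cons p w)
        then obtain a y v where "p = (a, trans_map V \<beta> \<alpha> y)" "a \<in> carrier (k \<beta>)" "y \<in> carrier (space V \<alpha>)"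
          "v \<in> lists (carrier (k \<beta>) \<times> carrier (space V \<alpha>))"
          "eval_word (space V \<beta>) (smult (space V \<beta>)) w = lincomb (space V) (opr D) \<beta> \<alpha> v" by auto
        then show ?case by (intro bexI[of _ "(a, y) # v"]) (auto simp: lincomb_def)
      qed
      then show "x \<in> lincomb (space V) (opr D) \<beta> \<alpha> ` lists (carrier (k \<beta>) \<times> carrier (space V \<alpha>))"
        using w(1) by blast
    qed
    then show ?case using \<alpha>(1) by auto
  qed (use V mod grp in \<open>auto simp: is_chain_def\<close>)
qed

end

section \<open>The category of decorated grounded chains\<close>

context field_tower
begin

section \<open>Morphisms as equivariant families of additive maps\<close>

abbreviation lev :: "('v chain, 'v, 'v \<Rightarrow> 'v \<Rightarrow> 'v) decorated \<Rightarrow> 'v \<Rightarrow> 'v set" where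
  "lev D \<alpha> \<equiv> carrier (level D \<alpha>)"

lemma level_group: "D \<in> Ob decorations \<Longrightarrow> \<alpha> \<in> ON \<Longrightarrow> abelian_group (level D \<alpha>)"
  by (rule operator_structure.group[OF operator_structure_opr])

lemma opr_additive:
  "D \<in> Ob decorations \<Longrightarrow> q \<in> operators \<Longrightarrow> opr D q \<in> additive_maps (level D (source q)) (level D (target q))"
  by (rule operator_structure.act_additive[OF operator_structure_opr])

lemma opr_closed:
  "D \<in> Ob decorations \<Longrightarrow> q \<in> operators \<Longrightarrow> x \<in> lev D (source q) \<Longrightarrow> opr D q x \<in> lev D (target q)"
  by (rule operator_structure.act_closed[OF operator_structure_opr])

lemma cmp_apply:
  "\<alpha> \<in> ON \<Longrightarrow> x \<in> lev D \<alpha> \<Longrightarrow> cmp decorations D E F g f \<alpha> x = g \<alpha> (f \<alpha> x)"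
  by (simp add: set_decoration_def grounded_chains_def full_subcategory_def chain_category_def compose_def)

lemma idn_apply: "\<alpha> \<in> ON \<Longrightarrow> x \<in> lev D \<alpha> \<Longrightarrow> idn decorations D \<alpha> x = x"
  by (simp add: set_decoration_def grounded_chains_def full_subcategory_def chain_category_def)

lemma zero_apply: "\<alpha> \<in> ON \<Longrightarrow> x \<in> lev D \<alpha> \<Longrightarrow> zero_mor decorations D E \<alpha> x = \<zero>\<^bsub>level E \<alpha>\<^esub>"
  by (simp add: set_decoration_def grounded_chains_def full_subcategory_def chain_category_def)

lemma add_apply:
  "\<alpha> \<in> ON \<Longrightarrow> x \<in> lev D \<alpha> \<Longrightarrow> add_mor decorations D E f g \<alpha> x = f \<alpha> x \<oplus>\<^bsub>level E \<alpha>\<^esub> g \<alpha> x"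
  by (simp add: set_decoration_def grounded_chains_def full_subcategory_def chain_category_def)

text \<open>A label outside both label sets acts by zero on both sides, so equivariance may be
  demanded for every label. Linearity, naturality and compatibility with labels then become one
  equation ranging over \<open>operators\<close>.\<close>

lemma Mor_decorations:
  assumes D: "D \<in> Ob decorations" and E: "E \<in> Ob decorations"
  shows "\<phi> \<in> Mor decorations D E \<longleftrightarrow> \<phi> \<in> extensional ON \<and>
    (\<forall>\<alpha>\<in>ON. \<phi> \<alpha> \<in> extensional (lev D \<alpha>) \<and> \<phi> \<alpha> \<in> additive_maps (level D \<alpha>) (level E \<alpha>)) \<and>
    (\<forall>q\<in>operators. \<forall>x\<in>lev D (source q). \<phi> (target q) (opr D q x) = opr E q (\<phi> (source q) x))"
    (is "?L \<longleftrightarrow> ?ext \<and> ?add \<and> ?op")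
proof -
  let ?V = "underlying D" and ?W = "underlying E"
  have act: "action chains D s \<alpha> x = opr D (Label s \<alpha>) x" if "\<alpha> \<in> ON" "x \<in> lev D \<alpha>" for s \<alpha> x
    using that by (simp add: action_def grounded_chains_def full_subcategory_def chain_category_def)
  have act': "action chains E s \<alpha> x = opr E (Label s \<alpha>) x" if "\<alpha> \<in> ON" "x \<in> lev E \<alpha>" for s \<alpha> x
    using that by (simp add: action_def grounded_chains_def full_subcategory_def chain_category_def)
  have chain: "\<phi> \<in> chain_mor k ?V ?W \<longleftrightarrow> ?ext \<and> ?add \<and>
    (\<forall>\<alpha>\<in>ON. \<forall>a\<in>carrier (k \<alpha>). \<forall>x\<in>lev D \<alpha>. \<phi> \<alpha> (opr D (Scalar \<alpha> a) x) = opr E (Scalar \<alpha> a) (\<phi> \<alpha> x)) \<and>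
    (\<forall>\<alpha>\<in>ON. \<forall>\<beta>\<in>ON. \<alpha> \<preceq> \<beta> \<longrightarrow> (\<forall>x\<in>lev D \<alpha>. \<phi> \<beta> (opr D (Transition \<beta> \<alpha>) x) = opr E (Transition \<beta> \<alpha>) (\<phi> \<alpha> x)))"
    by (auto simp: chain_mor_def PiE_iff linear_maps_def additive_maps_def)
  have L: "?L \<longleftrightarrow> \<phi> \<in> chain_mor k ?V ?W \<and> (\<forall>s\<in>labels D \<union> labels E.
      cmp chains ?V ?V ?W \<phi> (action chains D s) = cmp chains ?V ?W ?W (action chains E s) \<phi>)"
    by (simp add: set_decoration_def grounded_chains_def full_subcategory_def chain_category_def)
  have lab: "cmp chains ?V ?V ?W \<phi> (action chains D s) = cmp chains ?V ?W ?W (action chains E s) \<phi> \<longleftrightarrow>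
    (\<forall>\<alpha>\<in>ON. \<forall>x\<in>lev D \<alpha>. \<phi> \<alpha> (opr D (Label s \<alpha>) x) = opr E (Label s \<alpha>) (\<phi> \<alpha> x))" (is "?C = ?R")
    if add: ?add for s
  proof -
    have clo: "\<phi> \<alpha> x \<in> lev E \<alpha>" if "\<alpha> \<in> ON" "x \<in> lev D \<alpha>" for \<alpha> x
      using add that by (blast intro: additive_maps_closed)
    have cmp1: "cmp chains ?V ?V ?W \<phi> (action chains D s) \<alpha> x = \<phi> \<alpha> (opr D (Label s \<alpha>) x)"
      and cmp2: "cmp chains ?V ?W ?W (action chains E s) \<phi> \<alpha> x = opr E (Label s \<alpha>) (\<phi> \<alpha> x)"
      if "\<alpha> \<in> ON" "x \<in> lev D \<alpha>" for \<alpha> x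
      using act[of \<alpha> x s] act'[of \<alpha> "\<phi> \<alpha> x" s] that clo[OF that]
      by (simp_all add: grounded_chains_def full_subcategory_def chain_category_def compose_def)
    show ?thesis
    proof
      assume ?C then show ?R using cmp1 cmp2 by metis
    next
      assume R: ?R
      show ?C
      proof
        fix \<alpha> show "cmp chains ?V ?V ?W \<phi> (action chains D s) \<alpha> = cmp chains ?V ?W ?W (action chains E s) \<phi> \<alpha>"
        proof (cases "\<alpha> \<in> ON")
          case False then show ?thesis
            by (simp add: grounded_chains_def full_subcategory_def chain_category_def)
        next
          case True
          show ?thesis
          proof
            fix x show "cmp chains ?V ?V ?W \<phi> (action chains D s) \<alpha> x = cmp chains ?V ?W ?W (action
              chains E s) \<phi> \<alpha> x"
            proof (cases "x \<in> lev D \<alpha>")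
              case False then show ?thesis
                by (simp add: grounded_chains_def full_subcategory_def chain_category_def compose_def)
            qed (use True R cmp1 cmp2 in simp)
          qed
        qed
      qed
    qed
  qed
  have triv: "\<phi> \<alpha> (opr D (Label s \<alpha>) x) = opr E (Label s \<alpha>) (\<phi> \<alpha> x)"
    if "s \<notin> labels D" "s \<notin> labels E" ?add "\<alpha> \<in> ON" "x \<in> lev D \<alpha>" for s \<alpha> x
    using that additive_maps_zero[of "\<phi> \<alpha>" "level D \<alpha>" "level E \<alpha>"] level_group D E by auto
  show ?thesis
  proof
    assume l: ?L
    then have a: ?ext ?add using L chain by blast+
    have "\<phi> (target q) (opr D q x) = opr E q (\<phi> (source q) x)" if "q \<in> operators" "x \<in> lev D (source q)"
      for q x
    proof (cases q)
      case (Label s \<alpha>)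
      show ?thesis
      proof (cases "s \<in> labels D \<union> labels E")
        case True then show ?thesis using lab[OF a(2), of s] l L that Label by auto
      next
        case False
        then show ?thesis using triv[OF _ _ a(2), of s \<alpha> x] that Label by auto
      qed
    qed (use l L chain that in auto)
    then show "?ext \<and> ?add \<and> ?op" using a by blast
  next
    assume a: "?ext \<and> ?add \<and> ?op"
    then have add: ?add and op: ?op by blast+
    have "\<phi> \<in> chain_mor k ?V ?W"
      unfolding chain using a op[rule_format, of "Scalar _ _"] op[rule_format, of "Transition _ _"] by auto
    moreover have "\<forall>\<alpha>\<in>ON. \<forall>x\<in>lev D \<alpha>. \<phi> \<alpha> (opr D (Label s \<alpha>) x) = opr E (Label s \<alpha>) (\<phi> \<alpha> x)" for s
      using op[rule_format, of "Label s _"] by auto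
    ultimately show ?L unfolding L using lab[OF add] by blast
  qed
qed

text \<open>Hom sets are extensional in the ordinal and in the vector, so a levelwise formula must
  be restricted before it can be a morphism.\<close>

definition mk_mor :: "('v chain, 'v, 'v \<Rightarrow> 'v \<Rightarrow> 'v) decorated \<Rightarrow> ('v \<Rightarrow> 'v \<Rightarrow> 'v) \<Rightarrow> 'v \<Rightarrow> 'v \<Rightarrow> 'v" where
  "mk_mor D f = (\<lambda>\<alpha>\<in>ON. \<lambda>x\<in>lev D \<alpha>. f \<alpha> x)"

lemma mk_mor_apply: "\<alpha> \<in> ON \<Longrightarrow> x \<in> lev D \<alpha> \<Longrightarrow> mk_mor D f \<alpha> x = f \<alpha> x"
  by (simp add: mk_mor_def)

lemma mk_mor_in_Mor:
  assumes D: "D \<in> Ob decorations" and E: "E \<in> Ob decorations"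
    and add: "\<And>\<alpha>. \<alpha> \<in> ON \<Longrightarrow> f \<alpha> \<in> additive_maps (level D \<alpha>) (level E \<alpha>)"
    and op: "\<And>q x. q \<in> operators \<Longrightarrow> x \<in> lev D (source q) \<Longrightarrow> f (target q) (opr D q x) = opr E q (f (source q) x)"
  shows "mk_mor D f \<in> Mor decorations D E"
proof -
  have "mk_mor D f \<alpha> \<in> additive_maps (level D \<alpha>) (level E \<alpha>)" if \<alpha>: "\<alpha> \<in> ON" for \<alpha>
    using add[OF \<alpha>] abelian_groupE(1)[OF level_group[OF D \<alpha>]] \<alpha>
    by (auto intro!: additive_mapsI simp: mk_mor_apply additive_maps_closed additive_maps_add)
  moreover have "mk_mor D f (target q) (opr D q x) = opr E q (mk_mor D f (source q) x)"
    if "q \<in> operators" "x \<in> lev D (source q)" for q x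
    using that op operators_levels[OF that(1)] by (simp add: mk_mor_apply opr_closed[OF D])
  ultimately show ?thesis unfolding Mor_decorations[OF D E] by (auto simp: mk_mor_def)
qed

context
  fixes D E \<phi> assumes D: "D \<in> Ob decorations" and E: "E \<in> Ob decorations" and \<phi>: "\<phi> \<in> Mor decorations D E"
begin

lemma Mor_additive: "\<alpha> \<in> ON \<Longrightarrow> \<phi> \<alpha> \<in> additive_maps (level D \<alpha>) (level E \<alpha>)"
  using \<phi> by (simp add: Mor_decorations[OF D E])

lemma Mor_opr: "q \<in> operators \<Longrightarrow> x \<in> lev D (source q) \<Longrightarrow> \<phi> (target q) (opr D q x) = opr E q (\<phi> (source q) x)"
  using \<phi> by (simp add: Mor_decorations[OF D E])

lemma Mor_closed: "\<alpha> \<in> ON \<Longrightarrow> x \<in> lev D \<alpha> \<Longrightarrow> \<phi> \<alpha> x \<in> lev E \<alpha>"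
  by (rule additive_maps_closed[OF Mor_additive])

lemma Mor_add: "\<alpha> \<in> ON \<Longrightarrow> x \<in> lev D \<alpha> \<Longrightarrow> y \<in> lev D \<alpha> \<Longrightarrow>
    \<phi> \<alpha> (x \<oplus>\<^bsub>level D \<alpha>\<^esub> y) = \<phi> \<alpha> x \<oplus>\<^bsub>level E \<alpha>\<^esub> \<phi> \<alpha> y"
  by (rule additive_maps_add[OF Mor_additive])

lemma Mor_zero: "\<alpha> \<in> ON \<Longrightarrow> \<phi> \<alpha> \<zero>\<^bsub>level D \<alpha>\<^esub> = \<zero>\<^bsub>level E \<alpha>\<^esub>"
  by (rule additive_maps_zero[OF Mor_additive level_group[OF D] level_group[OF E]])

lemma Mor_minus: "\<alpha> \<in> ON \<Longrightarrow> x \<in> lev D \<alpha> \<Longrightarrow> \<phi> \<alpha> (\<ominus>\<^bsub>level D \<alpha>\<^esub> x) = \<ominus>\<^bsub>level E \<alpha>\<^esub> \<phi> \<alpha> x"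
  by (rule additive_maps_minus[OF Mor_additive level_group[OF D] level_group[OF E]])

lemma mk_mor_Mor [simp]: "mk_mor D \<phi> = \<phi>"
  using \<phi> unfolding Mor_decorations[OF D E] mk_mor_def
  by (auto simp: fun_eq_iff restrict_def extensional_def)

end

lemma Mor_eqI:
  assumes "D \<in> Ob decorations" "E \<in> Ob decorations" "\<phi> \<in> Mor decorations D E" "\<psi> \<in> Mor decorations D E"
    and "\<And>\<alpha> x. \<alpha> \<in> ON \<Longrightarrow> x \<in> lev D \<alpha> \<Longrightarrow> \<phi> \<alpha> x = \<psi> \<alpha> x"
  shows "\<phi> = \<psi>"
proof -
  have "mk_mor D \<phi> = mk_mor D \<psi>" unfolding mk_mor_def by (intro restrict_ext assms(5))
  then show ?thesis using mk_mor_Mor[OF assms(1,2)] assms(3,4) by metis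
qed

lemma cmp_eq_mk_mor: "cmp decorations D E F g f = mk_mor D (\<lambda>\<alpha> x. g \<alpha> (f \<alpha> x))"
  by (auto simp: mk_mor_def compose_def set_decoration_def grounded_chains_def full_subcategory_def
    chain_category_def)

lemma idn_eq_mk_mor: "idn decorations D = mk_mor D (\<lambda>\<alpha> x. x)"
  by (auto simp: mk_mor_def compose_def set_decoration_def grounded_chains_def full_subcategory_def
    chain_category_def)

lemma zero_eq_mk_mor: "zero_mor decorations D E = mk_mor D (\<lambda>\<alpha> x. \<zero>\<^bsub>level E \<alpha>\<^esub>)"
  by (auto simp: mk_mor_def compose_def set_decoration_def grounded_chains_def full_subcategory_def
    chain_category_def)

lemma add_eq_mk_mor: "add_mor decorations D E f g = mk_mor D (\<lambda>\<alpha> x. f \<alpha> x \<oplus>\<^bsub>level E \<alpha>\<^esub> g \<alpha> x)"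
  by (auto simp: mk_mor_def compose_def set_decoration_def grounded_chains_def full_subcategory_def
    chain_category_def)

lemma opr_zero: "E \<in> Ob decorations \<Longrightarrow> q \<in> operators \<Longrightarrow> opr E q \<zero>\<^bsub>level E (source q)\<^esub> = \<zero>\<^bsub>level E (target q)\<^esub>"
  using operators_levels by (intro additive_maps_zero[OF opr_additive] level_group) auto

section \<open>The category and its preadditive structure\<close>

lemma idn_Mor: "D \<in> Ob decorations \<Longrightarrow> idn decorations D \<in> Mor decorations D D"
  unfolding idn_eq_mk_mor by (rule mk_mor_in_Mor) (auto intro: additive_mapsI)

lemma cmp_Mor:
  "\<lbrakk>D \<in> Ob decorations; E \<in> Ob decorations; F \<in> Ob decorations; f \<in> Mor decorations D E;
    g \<in> Mor decorations E F\<rbrakk>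
  \<Longrightarrow> cmp decorations D E F g f \<in> Mor decorations D F"
  unfolding cmp_eq_mk_mor
  by (rule mk_mor_in_Mor) (auto intro: additive_maps_comp Mor_additive simp: Mor_opr[of D E] Mor_opr[of
    E F] Mor_closed operators_levels)

lemma zero_Mor:
  "D \<in> Ob decorations \<Longrightarrow> E \<in> Ob decorations \<Longrightarrow> zero_mor decorations D E \<in> Mor decorations D E"
  unfolding zero_eq_mk_mor by (rule mk_mor_in_Mor) (auto intro: zero_additive_maps level_group simp: opr_zero)

lemma add_Mor:
  "\<lbrakk>D \<in> Ob decorations; E \<in> Ob decorations; f \<in> Mor decorations D E; g \<in> Mor decorations D E\<rbrakk>
  \<Longrightarrow> add_mor decorations D E f g \<in> Mor decorations D E"
  unfolding add_eq_mk_mor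
  by (rule mk_mor_in_Mor) (auto intro: add_additive_maps Mor_additive level_group
     simp: Mor_opr[of D E] Mor_closed operators_levels additive_maps_add[OF opr_additive])

lemma category_decorations: "category decorations"
proof
  fix A B f assume *: "A \<in> Ob decorations" "B \<in> Ob decorations" "f \<in> Mor decorations A B"
  show "cmp decorations A A B f (idn decorations A) = f"
    by (rule Mor_eqI[of A B]) (use * in \<open>auto simp: cmp_apply idn_apply cmp_Mor idn_Mor\<close>)
  show "cmp decorations A B B (idn decorations B) f = f"
    by (rule Mor_eqI[of A B]) (use * in \<open>auto simp: cmp_apply idn_apply cmp_Mor idn_Mor Mor_closed[of A B]\<close>)
next
  fix A B C D f g h assume *: "A \<in> Ob decorations" "B \<in> Ob decorations" "C \<in> Ob decorations"
    "D \<in> Ob decorations"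
    "f \<in> Mor decorations A B" "g \<in> Mor decorations B C" "h \<in> Mor decorations C D"
  show "cmp decorations A C D h (cmp decorations A B C g f) = cmp decorations A B D (cmp decorations B C
    D h g) f"
    by (rule Mor_eqI[of A D]) (use * in \<open>auto simp: cmp_apply cmp_Mor[of A C D] cmp_Mor[of A B D]
      cmp_Mor[of A B C] cmp_Mor[of B C D] Mor_closed[of A B]\<close>)
qed (simp_all add: idn_Mor cmp_Mor)

lemma preadditive_decorations: "preadditive decorations"
proof (intro preadditive.intro preadditive_axioms.intro category_decorations)
  fix A B assume AB: "A \<in> Ob decorations" "B \<in> Ob decorations"
  note ap = add_apply zero_apply Mor_closed[OF AB]
  note gr = level_group[OF AB(2)]
  show "comm_group (hom_group decorations A B)"
  proof (rule comm_groupI; simp add: hom_group_def)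
    fix f g assume fg: "f \<in> Mor decorations A B" "g \<in> Mor decorations A B"
    show "add_mor decorations A B f g \<in> Mor decorations A B" by (rule add_Mor[OF AB fg])
    show "add_mor decorations A B f g = add_mor decorations A B g f"
      by (rule Mor_eqI[OF AB add_Mor[OF AB] add_Mor[OF AB]]) (use fg gr in \<open>auto simp: ap abelian_groupE(4)\<close>)
    fix h assume h: "h \<in> Mor decorations A B"
    show "add_mor decorations A B (add_mor decorations A B f g) h = add_mor decorations A B f (add_mor
      decorations A B g h)"
      by (rule Mor_eqI[OF AB add_Mor[OF AB] add_Mor[OF AB]]) (use fg gr h in \<open>auto simp: ap
        abelian_groupE(3) add_Mor[OF AB]\<close>)
  next
    fix f assume f: "f \<in> Mor decorations A B"
    show "add_mor decorations A B (zero_mor decorations A B) f = f"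
      by (rule Mor_eqI[OF AB add_Mor[OF AB]]) (use f gr in \<open>auto simp: ap abelian_groupE(5) zero_Mor[OF AB]\<close>)
    \<comment> \<open>The negative of \<open>f\<close> is written as \<open>f\<close> precomposed
      with negation on \<open>A\<close>.\<close>
    let ?n = "mk_mor A (\<lambda>\<alpha> x. f \<alpha> (\<ominus>\<^bsub>level A \<alpha>\<^esub> x))"
    have "?n \<in> Mor decorations A B"
    proof (rule mk_mor_in_Mor[OF AB])
      fix \<alpha> :: 'v assume \<alpha>: "\<alpha> \<in> ON"
      interpret abelian_group "level A \<alpha>" by (rule level_group[OF AB(1) \<alpha>])
      show "(\<lambda>x. f \<alpha> (\<ominus>\<^bsub>level A \<alpha>\<^esub> x)) \<in> additive_maps (level A \<alpha>) (level B \<alpha>)"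
        using \<alpha> by (auto intro!: additive_mapsI simp: minus_add Mor_add[OF AB f] Mor_closed[OF AB f])
    next
      fix q x assume q: "q \<in> operators" "x \<in> lev A (source q)"
      then have "\<ominus>\<^bsub>level A (target q)\<^esub> opr A q x = opr A q (\<ominus>\<^bsub>level A (source q)\<^esub> x)"
        using additive_maps_minus[OF opr_additive[OF AB(1)]] level_group[OF AB(1)] operators_levels by simp
      then show "f (target q) (\<ominus>\<^bsub>level A (target q)\<^esub> opr A q x) = opr B q (f (source q) (\<ominus>\<^bsub>level A
        (source q)\<^esub> x))"
        using q Mor_opr[OF AB f, of q "\<ominus>\<^bsub>level A (source q)\<^esub> x"] abelian_group.a_inv_closed[OF
          level_group[OF AB(1)]] operators_levels
        by simp
    qed
    moreover have "add_mor decorations A B ?n f = zero_mor decorations A B"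
      by (rule Mor_eqI[OF AB add_Mor[OF AB] zero_Mor[OF AB]])
        (use f gr calculation in \<open>auto simp: ap mk_mor_apply Mor_minus[OF AB] abelian_group.l_neg\<close>)
    ultimately show "\<exists>g\<in>Mor decorations A B. add_mor decorations A B g f = zero_mor decorations A B" by blast
  qed (rule zero_Mor[OF AB])
next
  fix A B C f f' g assume *: "A \<in> Ob decorations" "B \<in> Ob decorations" "C \<in> Ob decorations"
    "f \<in> Mor decorations A B" "f' \<in> Mor decorations A B" "g \<in> Mor decorations B C"
  show "cmp decorations A B C g (add_mor decorations A B f f') =
      add_mor decorations A C (cmp decorations A B C g f) (cmp decorations A B C g f')"
    by (rule Mor_eqI[OF *(1,3)])
      (use * in \<open>auto simp: cmp_Mor add_Mor cmp_apply add_apply Mor_closed[OF *(1,2)] Mor_add[OF *(2,3)]\<close>)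
next
  fix A B C f g g' assume *: "A \<in> Ob decorations" "B \<in> Ob decorations" "C \<in> Ob decorations"
    "f \<in> Mor decorations A B" "g \<in> Mor decorations B C" "g' \<in> Mor decorations B C"
  show "cmp decorations A B C (add_mor decorations B C g g') f =
      add_mor decorations A C (cmp decorations A B C g f) (cmp decorations A B C g' f)"
    by (rule Mor_eqI[OF *(1,3)])
      (use * in \<open>auto simp: cmp_Mor[OF *(1-3)] add_Mor cmp_apply add_apply Mor_closed[OF *(1,2)]\<close>)
qed

end

section \<open>Subobjects and kernels\<close>

context operator_structure
begin

section \<open>Calculus of linear combinations between two levels\<close>

lemma lincomb_Nil [simp]: "lincomb G act \<beta> \<alpha> [] = \<zero>\<^bsub>G \<beta>\<^esub>"
  by (simp add: lincomb_def)

lemma lincomb_Cons [simp]: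
  "lincomb G act \<beta> \<alpha> ((a, x) # w) = act (Scalar \<beta> a) (act (Transition \<beta> \<alpha>) x) \<oplus>\<^bsub>G \<beta>\<^esub> lincomb G act \<beta> \<alpha> w"
  by (simp add: lincomb_def)

lemma scalar_zero: "\<alpha> \<in> ON \<Longrightarrow> x \<in> carrier (G \<alpha>) \<Longrightarrow> act (Scalar \<alpha> \<zero>\<^bsub>k \<alpha>\<^esub>) x = \<zero>\<^bsub>G \<alpha>\<^esub>"
  using module.smult_l_null[OF module_level] by simp

lemma scalar_minus:
  "\<alpha> \<in> ON \<Longrightarrow> a \<in> carrier (k \<alpha>) \<Longrightarrow> x \<in> carrier (G \<alpha>) \<Longrightarrow>
    act (Scalar \<alpha> a) (\<ominus>\<^bsub>G \<alpha>\<^esub> x) = \<ominus>\<^bsub>G \<alpha>\<^esub> act (Scalar \<alpha> a) x"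
  using additive_maps_minus[OF act_additive[of "Scalar \<alpha> a"]] group by simp

lemma act_distrib:
  "q \<in> operators \<Longrightarrow> x \<in> carrier (G (source q)) \<Longrightarrow> y \<in> carrier (G (source q)) \<Longrightarrow>
    act q (x \<oplus>\<^bsub>G (source q)\<^esub> y) = act q x \<oplus>\<^bsub>G (target q)\<^esub> act q y"
  by (rule additive_maps_add[OF act_additive])

context
  fixes \<alpha> \<beta> :: 'v
  assumes \<alpha>: "\<alpha> \<in> ON" and \<beta>: "\<beta> \<in> ON" and le: "\<alpha> \<preceq> \<beta>"
begin

lemma lincomb_closed:
  assumes "w \<in> lists (carrier (k \<beta>) \<times> carrier (G \<alpha>))" shows "lincomb G act \<beta> \<alpha> w \<in> carrier (G \<beta>)"
  unfolding lincomb_def using in_lists_TimesD[OF assms] \<alpha> \<beta> le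
  by (intro eval_word_closed group) (auto simp: scalar_closed transition_closed)

lemma lincomb_append:
  assumes "v \<in> lists (carrier (k \<beta>) \<times> carrier (G \<alpha>))" "w \<in> lists (carrier (k \<beta>) \<times> carrier (G \<alpha>))"
  shows "lincomb G act \<beta> \<alpha> (v @ w) = lincomb G act \<beta> \<alpha> v \<oplus>\<^bsub>G \<beta>\<^esub> lincomb G act \<beta> \<alpha> w"
  unfolding lincomb_def using in_lists_TimesD[OF assms(1)] in_lists_TimesD[OF assms(2)] \<alpha> \<beta> le
  by (intro eval_word_append group) (auto simp: scalar_closed transition_closed)

lemma lincomb_scale:
  assumes "w \<in> lists (carrier (k \<beta>) \<times> carrier (G \<alpha>))" "c \<in> carrier (k \<beta>)"
  shows "act (Scalar \<beta> c) (lincomb G act \<beta> \<alpha> w) = lincomb G act \<beta> \<alpha> (map (\<lambda>p. (c \<otimes>\<^bsub>k \<beta>\<^esub> fst p, snd p)) w)"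
  using assms(1)
proof (induction w)
  case Nil then show ?case
    using additive_maps_zero[OF act_additive[of "Scalar \<beta> c"]] assms(2) \<beta> group by simp
next
  case (Cons p w)
  obtain a x where p: "p = (a, x)" "a \<in> carrier (k \<beta>)" "x \<in> carrier (G \<alpha>)" using Cons by (cases p) auto
  then show ?case
    using Cons act_distrib[of "Scalar \<beta> c"] \<alpha> \<beta> le assms(2) lincomb_closed[of w]
    by (simp add: scalar_closed transition_closed scalar_mult)
qed

lemma lincomb_transition:
  assumes "w \<in> lists (carrier (k \<beta>) \<times> carrier (G \<alpha>))" "\<gamma> \<in> ON" "\<beta> \<preceq> \<gamma>"
  shows "act (Transition \<gamma> \<beta>) (lincomb G act \<beta> \<alpha> w) = lincomb G act \<gamma> \<alpha> (map (\<lambda>p. (\<iota> \<gamma> \<beta> (fst p), snd p)) w)"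
  using assms(1)
proof (induction w)
  case Nil then show ?case
    using additive_maps_zero[OF act_additive[of "Transition \<gamma> \<beta>"]] assms(2,3) \<beta> group by simp
next
  case (Cons p w)
  obtain a x where p: "p = (a, x)" "a \<in> carrier (k \<beta>)" "x \<in> carrier (G \<alpha>)" using Cons by (cases p) auto
  then show ?case
    using Cons act_distrib[of "Transition \<gamma> \<beta>"] \<alpha> \<beta> le assms(2,3) lincomb_closed[of w]
    by (simp add: scalar_closed transition_closed transition_scalar transition_comp)
qed

text \<open>Gathers the occurrences of \<open>v\<close> into a single coefficient, which may turn
  out to be zero. This is the elimination step for groundedness of subobjects.\<close>

lemma lincomb_collect:
  assumes "w \<in> lists (carrier (k \<beta>) \<times> insert v T)" "v \<in> carrier (G \<alpha>)" "T \<subseteq> carrier (G \<alpha>)"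
  shows "\<exists>c\<in>carrier (k \<beta>). \<exists>w'\<in>lists (carrier (k \<beta>) \<times> T).
    lincomb G act \<beta> \<alpha> w = act (Scalar \<beta> c) (act (Transition \<beta> \<alpha>) v) \<oplus>\<^bsub>G \<beta>\<^esub> lincomb G act \<beta> \<alpha> w'"
  using assms(1)
proof (induction w)
  interpret K: cring "k \<beta>" using \<beta> by (rule cring_level)
  interpret A: abelian_group "G \<beta>" using \<beta> by (rule group)
  case Nil show ?case
    using scalar_zero[OF \<beta>] transition_closed[OF \<alpha> \<beta> le assms(2)]
    by (intro bexI[of _ "\<zero>\<^bsub>k \<beta>\<^esub>"] bexI[of _ "[]"]) auto
next
  interpret K: cring "k \<beta>" using \<beta> by (rule cring_level)
  interpret A: abelian_group "G \<beta>" using \<beta> by (rule group)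
  case (Cons p w)
  then obtain c w' where c: "c \<in> carrier (k \<beta>)" "w' \<in> lists (carrier (k \<beta>) \<times> T)"
    "lincomb G act \<beta> \<alpha> w = act (Scalar \<beta> c) (act (Transition \<beta> \<alpha>) v) \<oplus>\<^bsub>G \<beta>\<^esub> lincomb G act \<beta> \<alpha> w'" by auto
  obtain a x where p: "p = (a, x)" "a \<in> carrier (k \<beta>)" "x \<in> insert v T" using Cons by (cases p) auto
  have w'c: "lincomb G act \<beta> \<alpha> w' \<in> carrier (G \<beta>)"
    by (rule lincomb_closed) (use c(2) assms(3) in \<open>auto dest: in_lists_TimesD\<close>)
  have x: "x \<in> carrier (G \<alpha>)" using p assms by auto
  note cl = transition_closed[OF \<alpha> \<beta> le] scalar_closed[OF \<beta>]
  show ?case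
  proof (cases "x = v")
    case True
    then show ?thesis using c p cl w'c assms(2)
      by (intro bexI[of _ "a \<oplus>\<^bsub>k \<beta>\<^esub> c"] bexI[of _ w']) (auto simp: scalar_add[OF \<beta>] A.a_assoc)
  next
    case False
    then show ?thesis using c p cl w'c assms(2) x
      by (intro bexI[of _ c] bexI[of _ "(a, x) # w'"]) (auto simp: A.a_lcomm)
  qed
qed

end

text \<open>Modulo \<open>U\<close>, a linear dependence between vectors of level \<open>\<alpha>\<close> persists upwards. There is only
  a set of possible dependences, so by replacement all that ever occur are present at one level
  \<open>\<alpha>'\<close>. Above \<open>\<alpha>'\<close> an element of \<open>U\<close> can then be rewritten, one vector at a time, in terms of the
  elements of \<open>U\<close> at level \<open>\<alpha>'\<close>.\<close>

lemma subfamily_grounded: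
  assumes sub: "\<And>\<alpha>. \<alpha> \<in> ON \<Longrightarrow> U \<alpha> \<subseteq> carrier (G \<alpha>)"
    and zero: "\<And>\<alpha>. \<alpha> \<in> ON \<Longrightarrow> \<zero>\<^bsub>G \<alpha>\<^esub> \<in> U \<alpha>"
    and add: "\<And>\<alpha> x y. \<alpha> \<in> ON \<Longrightarrow> x \<in> U \<alpha> \<Longrightarrow> y \<in> U \<alpha> \<Longrightarrow> x \<oplus>\<^bsub>G \<alpha>\<^esub> y \<in> U \<alpha>"
    and minus: "\<And>\<alpha> x. \<alpha> \<in> ON \<Longrightarrow> x \<in> U \<alpha> \<Longrightarrow> \<ominus>\<^bsub>G \<alpha>\<^esub> x \<in> U \<alpha>"
    and closed: "\<And>q x. q \<in> operators \<Longrightarrow> x \<in> U (source q) \<Longrightarrow> act q x \<in> U (target q)"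
  shows "\<exists>\<alpha>\<in>ON. \<forall>\<beta>\<in>ON. \<alpha> \<prec> \<beta> \<longrightarrow> U \<beta> \<subseteq> lincomb G act \<beta> \<alpha> ` lists (carrier (k \<beta>) \<times> U \<alpha>)"
proof -
  obtain \<alpha> where \<alpha>: "\<alpha> \<in> ON" and gr: "\<And>\<beta>. \<beta> \<in> ON \<Longrightarrow> \<alpha> \<prec> \<beta> \<Longrightarrow>
      carrier (G \<beta>) \<subseteq> lincomb G act \<beta> \<alpha> ` lists (carrier (k \<beta>) \<times> carrier (G \<alpha>))"
    using grounded by blast
  \<comment> \<open>\<open>v\<close> is a combination of \<open>T\<close> modulo \<open>U\<close>,
    with coefficients at level \<open>\<beta>\<close>. Since \<open>T\<close> and \<open>v\<close>
    stay at the fixed level \<open>\<alpha>\<close>, the pairs to be considered form a set, however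
    large \<open>\<beta>\<close> becomes.\<close>
  define dep where "dep T v \<beta> \<longleftrightarrow> (\<exists>w\<in>lists (carrier (k \<beta>) \<times> T). \<exists>u\<in>U \<beta>.
    act (Transition \<beta> \<alpha>) v = lincomb G act \<beta> \<alpha> w \<oplus>\<^bsub>G \<beta>\<^esub> u)" for T v \<beta>
  have lists_mono: "w \<in> lists (A \<times> C)" if "w \<in> lists (A \<times> B)" "B \<subseteq> C" for w and A B C :: "'v set"
    using that by (auto dest: in_lists_TimesD)
  have dep_mono: "dep T v \<gamma>" if dep: "dep T v \<beta>" and that: "T \<subseteq> carrier (G \<alpha>)" "v \<in> carrier (G \<alpha>)"
    "\<alpha> \<preceq> \<beta>" "\<beta> \<preceq> \<gamma>" "\<beta> \<in> ON" "\<gamma> \<in> ON" for T v \<beta> \<gamma>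
  proof -
    obtain w u where w: "w \<in> lists (carrier (k \<beta>) \<times> T)" "u \<in> U \<beta>"
      "act (Transition \<beta> \<alpha>) v = lincomb G act \<beta> \<alpha> w \<oplus>\<^bsub>G \<beta>\<^esub> u" using dep unfolding dep_def by blast
    note w' = lists_mono[OF w(1) that(1)]
    let ?w = "map (\<lambda>p. (\<iota> \<gamma> \<beta> (fst p), snd p)) w"
    have "act (Transition \<gamma> \<alpha>) v = act (Transition \<gamma> \<beta>) (act (Transition \<beta> \<alpha>) v)"
      using that \<alpha> by (simp add: transition_comp)
    also have "\<dots> = lincomb G act \<gamma> \<alpha> ?w \<oplus>\<^bsub>G \<gamma>\<^esub> act (Transition \<gamma> \<beta>) u"
      using act_distrib[of "Transition \<gamma> \<beta>" "lincomb G act \<beta> \<alpha> w" u] w(2,3) sub \<alpha> that(3-)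
        lincomb_closed[OF \<alpha> _ _ w'] lincomb_transition[OF \<alpha> _ _ w', of \<gamma>] by auto
    finally have "act (Transition \<gamma> \<alpha>) v = lincomb G act \<gamma> \<alpha> ?w \<oplus>\<^bsub>G \<gamma>\<^esub> act (Transition \<gamma> \<beta>) u" .
    moreover have "?w \<in> lists (carrier (k \<gamma>) \<times> T)"
      by (rule map_in_lists[OF w(1)]) (use ring_hom_closed[OF incl_hom[OF that(5,6,4)]] in auto)
    moreover have "act (Transition \<gamma> \<beta>) u \<in> U \<gamma>" using closed[of "Transition \<gamma> \<beta>" u] w(2) that by simp
    ultimately show ?thesis unfolding dep_def by blast
  qed
  obtain \<alpha>' where \<alpha>': "\<alpha>' \<in> ON" "\<alpha> \<prec> \<alpha>'" and stab: "\<And>T v \<beta>. T \<subseteq> carrier (G \<alpha>) \<Longrightarrow> v \<in> carrier (G \<alpha>) \<Longrightarrow>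
      \<beta> \<in> ON \<Longrightarrow> \<alpha> \<preceq> \<beta> \<Longrightarrow> dep T v \<beta> \<Longrightarrow> dep T v \<alpha>'"
  proof -
    \<comment> \<open>One level at which \<open>v\<close> depends on \<open>T\<close>, if there is
      any, and an arbitrary level from \<open>\<alpha>\<close> upwards otherwise. The subset
      \<open>T\<close> is represented by the element \<open>t\<close> of the power set, so that
      replacement applies to the chosen levels.\<close>
    define b where "b t v = (SOME \<beta>. \<beta> \<in> ON \<and> \<alpha> \<preceq> \<beta> \<and> ((\<exists>\<beta>\<in>ON. \<alpha> \<preceq> \<beta> \<and> dep (elts t) v \<beta>) \<longrightarrow>
      dep (elts t) v \<beta>))" for t v
    have b: "b t v \<in> ON \<and> \<alpha> \<preceq> b t v \<and> ((\<exists>\<beta>\<in>ON. \<alpha> \<preceq> \<beta> \<and> dep (elts t) v \<beta>) \<longrightarrow> dep (elts t) v (b t v))" for t v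
      unfolding b_def by (rule someI_ex[of "\<lambda>\<beta>. \<beta> \<in> ON \<and> \<alpha> \<preceq> \<beta> \<and> ((\<exists>\<beta>\<in>ON. \<alpha> \<preceq> \<beta> \<and> dep (elts t) v \<beta>) \<longrightarrow>
        dep (elts t) v \<beta>)"])
        (use \<alpha> ord_le_refl in blast)
    let ?A = "insert \<alpha> (\<Union>t\<in>{t. elts t \<subseteq> carrier (G \<alpha>)}. b t ` carrier (G \<alpha>))"
    have "small ?A" by (intro small_insert small_UN small_Pow small_image small_group[OF \<alpha>])
    moreover have "?A \<subseteq> ON" using b \<alpha> by auto
    ultimately obtain \<alpha>' where \<alpha>': "\<alpha>' \<in> ON" "\<And>\<beta>. \<beta> \<in> ?A \<Longrightarrow> \<beta> \<prec> \<alpha>'" using ordinal_upper_bound by blast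
    show thesis
    proof (rule that[OF \<alpha>'(1)])
      show "\<alpha> \<prec> \<alpha>'" using \<alpha>'(2) by simp
      fix T v \<beta> assume *: "T \<subseteq> carrier (G \<alpha>)" "v \<in> carrier (G \<alpha>)" "\<beta> \<in> ON" "\<alpha> \<preceq> \<beta>" "dep T v \<beta>"
      have T: "elts (set_of T) = T" using small_subset[OF small_group[OF \<alpha>] *(1)] by simp
      have "b (set_of T) v \<in> ?A" by (intro insertI2 UN_I[of "set_of T"] imageI) (use * T in simp_all)
      then have "b (set_of T) v \<preceq> \<alpha>'" using \<alpha>'(2) ord_less_imp_le by blast
      moreover have "dep T v (b (set_of T) v)" using b[of "set_of T" v] T * by auto
      ultimately show "dep T v \<alpha>'" using dep_mono *(1,2) b \<alpha>'(1) by blast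
    qed
  qed
  have "U \<beta> \<subseteq> lincomb G act \<beta> \<alpha>' ` lists (carrier (k \<beta>) \<times> U \<alpha>')" if \<beta>: "\<beta> \<in> ON" "\<alpha>' \<prec> \<beta>" for \<beta>
  proof -
    interpret K: field "k \<beta>" using \<beta>(1) by (rule field)
    interpret A: abelian_group "G \<beta>" using \<beta>(1) by (rule group)
    have \<alpha>\<beta>: "\<alpha> \<prec> \<beta>" "\<alpha> \<preceq> \<beta>" "\<alpha>' \<preceq> \<beta>" "\<alpha> \<preceq> \<alpha>'"
      using ord_less_trans[OF \<beta>(1) \<alpha>'(2) \<beta>(2)] \<beta>(2) \<alpha>'(2) ord_less_imp_le by auto
    note cl = transition_closed[OF \<alpha> \<beta>(1) \<alpha>\<beta>(2)] transition_closed[OF \<alpha>'(1) \<beta>(1) \<alpha>\<beta>(3)] scalar_closed[OF \<beta>(1)]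
    \<comment> \<open>Induction on the set of vectors of level \<open>\<alpha>\<close> involved,
      with the coefficients left arbitrary: each step eliminates one vector.\<close>
    have main: "lincomb G act \<beta> \<alpha> w \<in> lincomb G act \<beta> \<alpha>' ` lists (carrier (k \<beta>) \<times> U \<alpha>')"
      if "finite T" "T \<subseteq> carrier (G \<alpha>)" "w \<in> lists (carrier (k \<beta>) \<times> T)" "lincomb G act \<beta> \<alpha> w \<in> U \<beta>" for T w
      using that
    proof (induction T arbitrary: w rule: finite_induct)
      case empty
      then have "w = []" by (cases w) auto
      then show ?case by (auto intro!: image_eqI[of _ _ "[]"])
    next
      case (insert v T)
      let ?x = "lincomb G act \<beta> \<alpha> w" and ?y = "act (Transition \<beta> \<alpha>) v"
      have T: "T \<subseteq> carrier (G \<alpha>)" "v \<in> carrier (G \<alpha>)" using insert.prems(1) by auto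
      obtain c w' where c: "c \<in> carrier (k \<beta>)" "w' \<in> lists (carrier (k \<beta>) \<times> T)"
        "?x = act (Scalar \<beta> c) ?y \<oplus>\<^bsub>G \<beta>\<^esub> lincomb G act \<beta> \<alpha> w'"
        using lincomb_collect[OF \<alpha> \<beta>(1) \<alpha>\<beta>(2) insert.prems(2) T(2,1)] by blast
      note w' = lists_mono[OF c(2) T(1)]
      have w'c: "lincomb G act \<beta> \<alpha> w' \<in> carrier (G \<beta>)" by (rule lincomb_closed[OF \<alpha> \<beta>(1) \<alpha>\<beta>(2) w'])
      have xc: "?x \<in> carrier (G \<beta>)" using insert.prems(3) sub[OF \<beta>(1)] by auto
      show ?case
      proof (cases "c = \<zero>\<^bsub>k \<beta>\<^esub>")
        case True
        then have "?x = lincomb G act \<beta> \<alpha> w'" using c(3) scalar_zero[OF \<beta>(1)] cl T(2) w'c by simp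
        then show ?thesis using insert.IH[OF T(1) c(2)] insert.prems(3) by simp
      next
        case False
        \<comment> \<open>Solving for \<open>v\<close> by division by \<open>c\<close> displays it
          as dependent on \<open>T\<close> modulo \<open>U\<close> at level \<open>\<beta>\<close>,
          because the multiple of \<open>?x\<close> by \<open>d\<close> lies in
          \<open>U \<beta>\<close>.\<close>
        define d where "d = inv\<^bsub>k \<beta>\<^esub> c"
        have d: "d \<in> carrier (k \<beta>)" "d \<otimes>\<^bsub>k \<beta>\<^esub> c = \<one>\<^bsub>k \<beta>\<^esub>"
          using K.field_Units c(1) False by (auto simp: d_def)
        have e: "\<ominus>\<^bsub>k \<beta>\<^esub> d \<in> carrier (k \<beta>)" using d by simp
        let ?w' = "map (\<lambda>p. (\<ominus>\<^bsub>k \<beta>\<^esub> d \<otimes>\<^bsub>k \<beta>\<^esub> fst p, snd p)) w'"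
        have "act (Scalar \<beta> c) ?y = \<ominus>\<^bsub>G \<beta>\<^esub> lincomb G act \<beta> \<alpha> w' \<oplus>\<^bsub>G \<beta>\<^esub> ?x"
          using A.r_neg1[OF w'c, of "act (Scalar \<beta> c) ?y"] c(1,3) cl T w'c
          by (simp add: A.a_comm[of "act (Scalar \<beta> c) ?y"])
        then have "act (Scalar \<beta> d) (act (Scalar \<beta> c) ?y) =
            act (Scalar \<beta> (\<ominus>\<^bsub>k \<beta>\<^esub> d)) (lincomb G act \<beta> \<alpha> w') \<oplus>\<^bsub>G \<beta>\<^esub> act (Scalar \<beta> d) ?x"
          using act_distrib[of "Scalar \<beta> d" "\<ominus>\<^bsub>G \<beta>\<^esub> lincomb G act \<beta> \<alpha> w'" ?x] d w'c xc \<beta>(1)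
            module.smult_l_minus[OF module_level[OF \<beta>(1)], of d] scalar_minus[OF \<beta>(1)]
          by (simp add: a_inv_def)
        moreover have "act (Scalar \<beta> d) (act (Scalar \<beta> c) ?y) = ?y"
          using scalar_mult[OF \<beta>(1) d(1) c(1), of ?y] scalar_one[OF \<beta>(1)] cl T d(2) by simp
        ultimately have "?y = lincomb G act \<beta> \<alpha> ?w' \<oplus>\<^bsub>G \<beta>\<^esub> act (Scalar \<beta> d) ?x"
          using lincomb_scale[OF \<alpha> \<beta>(1) \<alpha>\<beta>(2) w' e] by simp
        moreover have "?w' \<in> lists (carrier (k \<beta>) \<times> T)" by (rule map_in_lists[OF c(2)]) (use e in auto)
        moreover have "act (Scalar \<beta> d) ?x \<in> U \<beta>"
          using closed[of "Scalar \<beta> d" ?x] d \<beta>(1) insert.prems(3) by simp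
        ultimately have "dep T v \<beta>" unfolding dep_def by blast
        then have "dep T v \<alpha>'" by (rule stab[OF T \<beta>(1) \<alpha>\<beta>(2)])
        then have "\<exists>m\<in>lists (carrier (k \<alpha>') \<times> T). \<exists>u\<in>U \<alpha>'.
            act (Transition \<alpha>' \<alpha>) v = lincomb G act \<alpha>' \<alpha> m \<oplus>\<^bsub>G \<alpha>'\<^esub> u" by (simp only: dep_def)
        then obtain m u where m: "m \<in> lists (carrier (k \<alpha>') \<times> T)" "u \<in> U \<alpha>'"
          "act (Transition \<alpha>' \<alpha>) v = lincomb G act \<alpha>' \<alpha> m \<oplus>\<^bsub>G \<alpha>'\<^esub> u" by blast
        note mc = lists_mono[OF m(1) T(1)]
        have u: "u \<in> carrier (G \<alpha>')" using m(2) sub[OF \<alpha>'(1)] by auto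
        \<comment> \<open>The dependence available at \<open>\<alpha>'\<close> is pushed up to
          \<open>\<beta>\<close> and multiplied by \<open>c\<close>. It replaces the term of
          \<open>?x\<close> in \<open>v\<close>; its part in \<open>U \<alpha>'\<close> survives as
          the letter \<open>(c, u)\<close>.\<close>
        let ?m = "map (\<lambda>p. (c \<otimes>\<^bsub>k \<beta>\<^esub> fst p, snd p)) (map (\<lambda>p. (\<iota> \<beta> \<alpha>' (fst p), snd p)) m)"
        have m1: "map (\<lambda>p. (\<iota> \<beta> \<alpha>' (fst p), snd p)) m \<in> lists (carrier (k \<beta>) \<times> T)"
          by (rule map_in_lists[OF m(1)]) (use ring_hom_closed[OF incl_hom[OF \<alpha>'(1) \<beta>(1) \<alpha>\<beta>(3)]] in auto)
        have m2: "?m \<in> lists (carrier (k \<beta>) \<times> T)" by (rule map_in_lists[OF m1]) (use c in auto)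
        have "?y = act (Transition \<beta> \<alpha>') (act (Transition \<alpha>' \<alpha>) v)"
          using transition_comp[OF \<alpha> \<alpha>'(1) \<beta>(1) \<alpha>\<beta>(4) \<alpha>\<beta>(3)] T by simp
        also have "\<dots> = lincomb G act \<beta> \<alpha> (map (\<lambda>p. (\<iota> \<beta> \<alpha>' (fst p), snd p)) m) \<oplus>\<^bsub>G \<beta>\<^esub> act (Transition \<beta> \<alpha>') u"
          using act_distrib[of "Transition \<beta> \<alpha>'" "lincomb G act \<alpha>' \<alpha> m" u] m(3) u \<alpha>' \<beta> \<alpha>\<beta>
            lincomb_closed[OF \<alpha> \<alpha>'(1) \<alpha>\<beta>(4) mc] lincomb_transition[OF \<alpha> \<alpha>'(1) \<alpha>\<beta>(4) mc \<beta>(1) \<alpha>\<beta>(3)] by simp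
        finally have "act (Scalar \<beta> c) ?y = lincomb G act \<beta> \<alpha> ?m \<oplus>\<^bsub>G \<beta>\<^esub> act (Scalar \<beta> c) (act
          (Transition \<beta> \<alpha>') u)"
          using act_distrib[of "Scalar \<beta> c"] c \<beta>(1) cl u lincomb_closed[OF \<alpha> \<beta>(1) \<alpha>\<beta>(2) lists_mono[OF m1
            T(1)]]
            lincomb_scale[OF \<alpha> \<beta>(1) \<alpha>\<beta>(2) lists_mono[OF m1 T(1)] c(1)] by simp
        moreover have cu: "act (Scalar \<beta> c) (act (Transition \<beta> \<alpha>') u) \<in> U \<beta>"
          using closed[of "Transition \<beta> \<alpha>'" u] closed[of "Scalar \<beta> c"] m(2) \<alpha>' \<beta> \<alpha>\<beta> c(1) by simp
        ultimately have x: "?x = act (Scalar \<beta> c) (act (Transition \<beta> \<alpha>') u) \<oplus>\<^bsub>G \<beta>\<^esub> lincomb G act \<beta> \<alpha> (?m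
          @ w')"
          using c(3) lincomb_append[OF \<alpha> \<beta>(1) \<alpha>\<beta>(2) lists_mono[OF m2 T(1)] w'] w'c cl c(1) u
            lincomb_closed[OF \<alpha> \<beta>(1) \<alpha>\<beta>(2) lists_mono[OF m2 T(1)]] by (simp add: A.a_ac)
        have mw: "?m @ w' \<in> lists (carrier (k \<beta>) \<times> T)" using m2 c(2) by simp
        \<comment> \<open>What remains involves only \<open>T\<close> and is a difference of two
          elements of \<open>U \<beta>\<close>, so the induction hypothesis applies to it.\<close>
        have "lincomb G act \<beta> \<alpha> (?m @ w') = \<ominus>\<^bsub>G \<beta>\<^esub> act (Scalar \<beta> c) (act (Transition \<beta> \<alpha>') u) \<oplus>\<^bsub>G \<beta>\<^esub> ?x"
          unfolding x using cl c(1) u lincomb_closed[OF \<alpha> \<beta>(1) \<alpha>\<beta>(2) lists_mono[OF mw T(1)]]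
          by (simp add: A.r_neg1)
        then have "lincomb G act \<beta> \<alpha> (?m @ w') \<in> U \<beta>" using add minus cu insert.prems(3) \<beta>(1) by simp
        then obtain w'' where w'': "lincomb G act \<beta> \<alpha> (?m @ w') = lincomb G act \<beta> \<alpha>' w''"
          "w'' \<in> lists (carrier (k \<beta>) \<times> U \<alpha>')"
          using insert.IH[OF T(1) mw] by auto
        have "?x = lincomb G act \<beta> \<alpha>' ((c, u) # w'')" using x w''(1) by simp
        moreover have "(c, u) # w'' \<in> lists (carrier (k \<beta>) \<times> U \<alpha>')" using c(1) m(2) w''(2) by simp
        ultimately show ?thesis by (rule image_eqI)
      qed
    qed
    show ?thesis
    proof
      fix x assume x: "x \<in> U \<beta>"
      then obtain w where w: "x = lincomb G act \<beta> \<alpha> w" "w \<in> lists (carrier (k \<beta>) \<times> carrier (G \<alpha>))"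
        using gr[OF \<beta>(1) \<alpha>\<beta>(1)] sub[OF \<beta>(1)] by blast
      \<comment> \<open>The finite set handed to the induction consists of the vectors occurring in
        \<open>w\<close>.\<close>
      have "w \<in> lists (carrier (k \<beta>) \<times> snd ` set w)" "snd ` set w \<subseteq> carrier (G \<alpha>)"
        using in_lists_TimesD[OF w(2)] by force+
      then show "x \<in> lincomb G act \<beta> \<alpha>' ` lists (carrier (k \<beta>) \<times> U \<alpha>')"
        using main[of "snd ` set w" w] x w(1) by simp
    qed
  qed
  then show ?thesis using \<alpha>'(1) by blast
qed

end

context field_tower
begin

section \<open>Subobjects given by families of subgroups closed under operators\<close>

definition subobject :: "('v chain, 'v, 'v \<Rightarrow> 'v \<Rightarrow> 'v) decorated \<Rightarrow> ('v \<Rightarrow> 'v set) \<Rightarrow> ('v chain, 'v, 'v \<Rightarrow> 'v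
  \<Rightarrow> 'v) decorated" where
  "subobject D U = mk_decorated (\<lambda>\<alpha>. (level D \<alpha>)\<lparr>carrier := U \<alpha>\<rparr>) (opr D) (labels D)"

context
  fixes D U
  assumes D: "D \<in> Ob decorations"
    and sub: "\<And>\<alpha>. \<alpha> \<in> ON \<Longrightarrow> U \<alpha> \<subseteq> lev D \<alpha>"
    and zero: "\<And>\<alpha>. \<alpha> \<in> ON \<Longrightarrow> \<zero>\<^bsub>level D \<alpha>\<^esub> \<in> U \<alpha>"
    and add: "\<And>\<alpha> x y. \<alpha> \<in> ON \<Longrightarrow> x \<in> U \<alpha> \<Longrightarrow> y \<in> U \<alpha> \<Longrightarrow> x \<oplus>\<^bsub>level D \<alpha>\<^esub> y \<in> U \<alpha>"
    and minus: "\<And>\<alpha> x. \<alpha> \<in> ON \<Longrightarrow> x \<in> U \<alpha> \<Longrightarrow> \<ominus>\<^bsub>level D \<alpha>\<^esub> x \<in> U \<alpha>"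
    and closed: "\<And>q x. q \<in> operators \<Longrightarrow> x \<in> U (source q) \<Longrightarrow> opr D q x \<in> U (target q)"
begin

text \<open>All equations restrict to a subfamily. Groundedness is the only axiom that does not
  restrict formally; it comes from \<open>subfamily_grounded\<close>.\<close>

lemma operator_structure_sub: "operator_structure k \<iota> (\<lambda>\<alpha>. (level D \<alpha>)\<lparr>carrier := U \<alpha>\<rparr>) (opr D) (labels D)"
proof -
  interpret O: operator_structure k \<iota> "level D" "opr D" "labels D" by (rule operator_structure_opr[OF D])
  have s: "x \<in> lev D \<alpha>" if "\<alpha> \<in> ON" "x \<in> U \<alpha>" for \<alpha> x using sub that by blast
  have lin: "lincomb (\<lambda>\<alpha>. (level D \<alpha>)\<lparr>carrier := U \<alpha>\<rparr>) act \<beta> \<alpha> w = lincomb (level D) act \<beta> \<alpha> w" for act \<alpha> \<beta> w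
    unfolding lincomb_def by (induction w) auto
  show ?thesis
  proof (intro operator_structure.intro operator_structure_axioms.intro, goal_cases)
    case 1 show ?case by (rule field_tower_axioms)
  next
    case (2 \<alpha>)
    interpret abelian_group "level D \<alpha>" using 2 by (rule O.group)
    show ?case
    proof (rule abelian_groupI; simp)
      fix x assume "x \<in> U \<alpha>"
      then show "\<exists>y\<in>U \<alpha>. y \<oplus>\<^bsub>level D \<alpha>\<^esub> x = \<zero>\<^bsub>level D \<alpha>\<^esub>"
        using minus[OF 2] s[OF 2] by (intro bexI[of _ "\<ominus>\<^bsub>level D \<alpha>\<^esub> x"]) (auto simp: l_neg)
    qed (use 2 s[OF 2] in \<open>auto simp: zero add a_ac\<close>)
  next
    case (3 \<alpha>) then show ?case using small_subset[OF O.small_group sub] by simp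
  next
    case (5 q) then show ?case
      using closed O.act_distrib[OF 5] s operators_levels[OF 5] by (intro additive_mapsI) auto
  next
    case 15
    show ?case unfolding lin using O.subfamily_grounded[OF sub zero add minus closed] by simp
  qed (use s in \<open>auto simp del: opr.simps simp: O.small_labels O.scalar_add O.scalar_mult O.scalar_one
    O.transition_id
     O.transition_comp O.transition_scalar O.label_scalar O.label_transition O.label_zero\<close>)
qed

lemma subobject_in_Ob: "subobject D U \<in> Ob decorations"
  unfolding subobject_def by (rule operator_structure.mk_decorated_in_Ob[OF operator_structure_sub])

lemma opr_subobject: "q \<in> operators \<Longrightarrow> x \<in> U (source q) \<Longrightarrow> opr (subobject D U) q x = opr D q x"
  unfolding subobject_def using operator_structure.opr_mk_decorated[OF operator_structure_sub, of q x] by simp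

end

lemma level_subobject [simp]:
  "carrier (level (subobject D U) \<alpha>) = U \<alpha>" "\<zero>\<^bsub>level (subobject D U) \<alpha>\<^esub> = \<zero>\<^bsub>level D \<alpha>\<^esub>"
  "add (level (subobject D U) \<alpha>) = add (level D \<alpha>)"
  by (simp_all add: subobject_def)

section \<open>Kernels, and monomorphisms and epimorphisms level by level\<close>

definition kernel_object where
  "kernel_object A B f = subobject A (\<lambda>\<alpha>. {x \<in> lev A \<alpha>. f \<alpha> x = \<zero>\<^bsub>level B \<alpha>\<^esub>})"

definition kernel_incl where
  "kernel_incl A B f = mk_mor (kernel_object A B f) (\<lambda>\<alpha> x. x)"

lemma level_kernel [simp]:
  "lev (kernel_object A B f) \<alpha> = {x \<in> lev A \<alpha>. f \<alpha> x = \<zero>\<^bsub>level B \<alpha>\<^esub>}"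
  "\<zero>\<^bsub>level (kernel_object A B f) \<alpha>\<^esub> = \<zero>\<^bsub>level A \<alpha>\<^esub>" "add (level (kernel_object A B f) \<alpha>) = add (level A \<alpha>)"
  by (simp_all add: kernel_object_def)

context
  fixes A B f assumes A: "A \<in> Ob decorations" and B: "B \<in> Ob decorations" and f: "f \<in> Mor decorations A B"
begin

lemma kernel_closed:
  assumes "\<alpha> \<in> ON"
  shows "\<zero>\<^bsub>level A \<alpha>\<^esub> \<in> lev (kernel_object A B f) \<alpha>"
    and "x \<in> lev (kernel_object A B f) \<alpha> \<Longrightarrow> y \<in> lev (kernel_object A B f) \<alpha> \<Longrightarrow>
      x \<oplus>\<^bsub>level A \<alpha>\<^esub> y \<in> lev (kernel_object A B f) \<alpha>"
    and "x \<in> lev (kernel_object A B f) \<alpha> \<Longrightarrow> \<ominus>\<^bsub>level A \<alpha>\<^esub> x \<in> lev (kernel_object A B f) \<alpha>"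
proof -
  interpret A: abelian_group "level A \<alpha>" by (rule level_group[OF A assms])
  interpret B: abelian_group "level B \<alpha>" by (rule level_group[OF B assms])
  show "\<zero>\<^bsub>level A \<alpha>\<^esub> \<in> lev (kernel_object A B f) \<alpha>"
    and "x \<in> lev (kernel_object A B f) \<alpha> \<Longrightarrow> y \<in> lev (kernel_object A B f) \<alpha> \<Longrightarrow>
      x \<oplus>\<^bsub>level A \<alpha>\<^esub> y \<in> lev (kernel_object A B f) \<alpha>"
    and "x \<in> lev (kernel_object A B f) \<alpha> \<Longrightarrow> \<ominus>\<^bsub>level A \<alpha>\<^esub> x \<in> lev (kernel_object A B f) \<alpha>"
    using assms by (auto simp: Mor_zero[OF A B f] Mor_add[OF A B f] Mor_minus[OF A B f] B.a_inv_zero)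
qed

lemma kernel_opr_closed:
  "q \<in> operators \<Longrightarrow> x \<in> lev (kernel_object A B f) (source q) \<Longrightarrow> opr A q x \<in> lev (kernel_object A B f)
    (target q)"
  by (simp add: opr_closed[OF A] Mor_opr[OF A B f] opr_zero[OF B])

lemma kernel_Ob: "kernel_object A B f \<in> Ob decorations"
  unfolding kernel_object_def
  by (rule subobject_in_Ob[OF A]) (use kernel_closed kernel_opr_closed in auto)

lemma opr_kernel: "q \<in> operators \<Longrightarrow> x \<in> lev (kernel_object A B f) (source q) \<Longrightarrow> opr (kernel_object A B f)
  q x = opr A q x"
  unfolding kernel_object_def
  by (rule opr_subobject[OF A]) (use kernel_closed kernel_opr_closed in auto)

lemma kernel_incl_Mor: "kernel_incl A B f \<in> Mor decorations (kernel_object A B f) A"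
  unfolding kernel_incl_def
  by (rule mk_mor_in_Mor[OF kernel_Ob A]) (auto intro: additive_mapsI simp: opr_kernel)

lemma kernel_incl_apply: "\<alpha> \<in> ON \<Longrightarrow> x \<in> lev (kernel_object A B f) \<alpha> \<Longrightarrow> kernel_incl A B f \<alpha> x = x"
  unfolding kernel_incl_def by (rule mk_mor_apply)

lemma is_kernel_kernel: "is_kernel decorations (kernel_object A B f) A B (kernel_incl A B f) f"
  unfolding is_kernel_def
proof (intro conjI ballI impI kernel_Ob kernel_incl_Mor)
  show "cmp decorations (kernel_object A B f) A B f (kernel_incl A B f) = zero_mor decorations
    (kernel_object A B f) B"
    by (rule Mor_eqI[OF kernel_Ob B cmp_Mor[OF kernel_Ob A B kernel_incl_Mor f] zero_Mor[OF kernel_Ob B]])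
      (simp add: cmp_apply zero_apply kernel_incl_apply)
  fix T t assume T: "T \<in> Ob decorations" and t: "t \<in> Mor decorations T A"
    and "cmp decorations T A B f t = zero_mor decorations T B"
  then have ft: "f \<alpha> (t \<alpha> x) = \<zero>\<^bsub>level B \<alpha>\<^esub>" if "\<alpha> \<in> ON" "x \<in> lev T \<alpha>" for \<alpha> x
    using that by (metis cmp_apply zero_apply)
  have tK: "t \<in> Mor decorations T (kernel_object A B f)"
  proof -
    have "mk_mor T t \<in> Mor decorations T (kernel_object A B f)"
      by (rule mk_mor_in_Mor[OF T kernel_Ob]) (use ft operators_levels in \<open>auto intro!: additive_mapsI
        simp: Mor_closed[OF T A t] Mor_add[OF T A t] Mor_opr[OF T A t] opr_kernel\<close>)
    then show ?thesis by (simp only: mk_mor_Mor[OF T A t])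
  qed
  show "\<exists>!h. h \<in> Mor decorations T (kernel_object A B f) \<and> cmp decorations T (kernel_object A B f) A
    (kernel_incl A B f) h = t"
  proof (rule ex1I[of _ t], intro conjI tK)
    show "cmp decorations T (kernel_object A B f) A (kernel_incl A B f) t = t"
      by (rule Mor_eqI[OF T A cmp_Mor[OF T kernel_Ob A tK kernel_incl_Mor] t])
        (use Mor_closed[OF T kernel_Ob tK] kernel_incl_apply in \<open>simp add: cmp_apply\<close>)
    fix h assume h: "h \<in> Mor decorations T (kernel_object A B f) \<and> cmp decorations T (kernel_object A B
      f) A (kernel_incl A B f) h = t"
    show "h = t"
    proof (rule Mor_eqI[OF T kernel_Ob _ tK])
      fix \<alpha> x assume ax: "\<alpha> \<in> ON" "x \<in> lev T \<alpha>"
      then have "t \<alpha> x = kernel_incl A B f \<alpha> (h \<alpha> x)" using h cmp_apply by metis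
      then show "h \<alpha> x = t \<alpha> x" using kernel_incl_apply Mor_closed[OF T kernel_Ob _ ax] h ax by metis
    qed (use h in simp)
  qed
qed

end

text \<open>The vectors killed by \<open>m\<close> form an object. Its inclusion and the zero map
  agree after composition with \<open>m\<close>, so the inclusion is zero.\<close>

lemma mono_injective:
  assumes A: "A \<in> Ob decorations" and B: "B \<in> Ob decorations" and m: "mono_mor decorations A B m"
    and x: "\<alpha> \<in> ON" "x \<in> lev A \<alpha>" "m \<alpha> x = \<zero>\<^bsub>level B \<alpha>\<^esub>"
  shows "x = \<zero>\<^bsub>level A \<alpha>\<^esub>"
proof -
  have mM: "m \<in> Mor decorations A B" using m by (simp add: mono_mor_def)
  note K = kernel_Ob[OF A B mM]
  have "cmp decorations (kernel_object A B m) A B m (kernel_incl A B m) =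
      cmp decorations (kernel_object A B m) A B m (zero_mor decorations (kernel_object A B m) A)"
    by (rule Mor_eqI[OF K B cmp_Mor[OF K A B kernel_incl_Mor[OF A B mM] mM] cmp_Mor[OF K A B zero_Mor[OF
      K A] mM]])
      (simp add: cmp_apply zero_apply kernel_incl_apply[OF A B mM] Mor_zero[OF A B mM])
  then have "kernel_incl A B m = zero_mor decorations (kernel_object A B m) A"
    using m K kernel_incl_Mor[OF A B mM] zero_Mor[OF K A] by (auto simp: mono_mor_def)
  moreover have "x \<in> lev (kernel_object A B m) \<alpha>" using x by simp
  ultimately show ?thesis
    using kernel_incl_apply[OF A B mM x(1)] zero_apply[OF x(1), of x "kernel_object A B m" A] by metis
qed

lemma injective_mono:
  assumes A: "A \<in> Ob decorations" and B: "B \<in> Ob decorations" and m: "m \<in> Mor decorations A B"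
    and inj: "\<And>\<alpha> x. \<alpha> \<in> ON \<Longrightarrow> x \<in> lev A \<alpha> \<Longrightarrow> m \<alpha> x = \<zero>\<^bsub>level B \<alpha>\<^esub> \<Longrightarrow> x = \<zero>\<^bsub>level A \<alpha>\<^esub>"
  shows "mono_mor decorations A B m"
  unfolding mono_mor_def
proof (intro conjI ballI impI m)
  fix C g h assume C: "C \<in> Ob decorations" and g: "g \<in> Mor decorations C A" and h: "h \<in> Mor decorations C A"
    and eq: "cmp decorations C A B m g = cmp decorations C A B m h"
  show "g = h"
  proof (rule Mor_eqI[OF C A g h])
    fix \<alpha> x assume x: "\<alpha> \<in> ON" "x \<in> lev C \<alpha>"
    interpret A: abelian_group "level A \<alpha>" by (rule level_group[OF A x(1)])
    interpret B: abelian_group "level B \<alpha>" by (rule level_group[OF B x(1)])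
    note gh = Mor_closed[OF C A g x] Mor_closed[OF C A h x]
    have "m \<alpha> (g \<alpha> x) = m \<alpha> (h \<alpha> x)" using eq cmp_apply[OF x] by metis
    then have "m \<alpha> (g \<alpha> x \<ominus>\<^bsub>level A \<alpha>\<^esub> h \<alpha> x) = \<zero>\<^bsub>level B \<alpha>\<^esub>"
      using gh x(1) Mor_closed[OF A B m x(1)]
      by (simp add: A.minus_eq Mor_add[OF A B m] Mor_minus[OF A B m] B.r_neg)
    then have "g \<alpha> x \<ominus>\<^bsub>level A \<alpha>\<^esub> h \<alpha> x = \<zero>\<^bsub>level A \<alpha>\<^esub>" using inj[OF x(1)] gh by simp
    then show "g \<alpha> x = h \<alpha> x" using gh by - (rule A.eq_if_minus_eq_zero; simp)
  qed
qed

lemma surjective_epi: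
  assumes A: "A \<in> Ob decorations" and B: "B \<in> Ob decorations" and e: "e \<in> Mor decorations A B"
    and surj: "\<And>\<alpha> y. \<alpha> \<in> ON \<Longrightarrow> y \<in> lev B \<alpha> \<Longrightarrow> \<exists>x\<in>lev A \<alpha>. e \<alpha> x = y"
  shows "epi_mor decorations A B e"
  unfolding epi_mor_def
proof (intro conjI ballI impI e)
  fix C g h assume C: "C \<in> Ob decorations" and g: "g \<in> Mor decorations B C" and h: "h \<in> Mor decorations B C"
    and eq: "cmp decorations A B C g e = cmp decorations A B C h e"
  show "g = h"
  proof (rule Mor_eqI[OF B C g h])
    fix \<alpha> y assume y: "\<alpha> \<in> ON" "y \<in> lev B \<alpha>"
    then obtain x where "x \<in> lev A \<alpha>" "e \<alpha> x = y" using surj by blast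
    then show "g \<alpha> y = h \<alpha> y" using eq cmp_apply[OF y(1)] by metis
  qed
qed

end

section \<open>Colimits of decorated grounded chains\<close>

text \<open>A base level can be raised by transporting the vectors first, without touching the
  coefficients. This brings the objects of a diagram to a common base level.\<close>

lemma (in operator_structure) grounded_mono:
  assumes \<alpha>: "\<alpha> \<in> ON" and \<alpha>': "\<alpha>' \<in> ON" "\<alpha> \<preceq> \<alpha>'" and \<beta>: "\<beta> \<in> ON" "\<alpha>' \<prec> \<beta>"
  shows "lincomb G act \<beta> \<alpha> ` lists (carrier (k \<beta>) \<times> carrier (G \<alpha>)) \<subseteq>
    lincomb G act \<beta> \<alpha>' ` lists (carrier (k \<beta>) \<times> carrier (G \<alpha>'))"
proof (rule image_subsetI)
  fix w assume w: "w \<in> lists (carrier (k \<beta>) \<times> carrier (G \<alpha>))"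
  let ?w = "map (\<lambda>p. (fst p, act (Transition \<alpha>' \<alpha>) (snd p))) w"
  have "lincomb G act \<beta> \<alpha> w = lincomb G act \<beta> \<alpha>' ?w"
    using w
  proof (induction w)
    case (Cons p w)
    then show ?case using transition_comp[OF \<alpha> \<alpha>'(1) \<beta>(1) \<alpha>'(2) ord_less_imp_le[OF \<beta>(2)]]
      by (cases p) auto
  qed simp
  moreover have "?w \<in> lists (carrier (k \<beta>) \<times> carrier (G \<alpha>'))"
    by (rule map_in_lists[OF w]) (use transition_closed[OF \<alpha> \<alpha>'] in auto)
  ultimately show "lincomb G act \<beta> \<alpha> w \<in> lincomb G act \<beta> \<alpha>' ` lists (carrier (k \<beta>) \<times> carrier (G \<alpha>'))"
    by (rule image_eqI)
qed

locale decorated_diagram = field_tower k \<iota>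
  for k :: "'v::set_universe \<Rightarrow> 'v ring" and \<iota> :: "'v \<Rightarrow> 'v \<Rightarrow> 'v \<Rightarrow> 'v" +
  fixes I :: "'v set" and D :: "'v \<Rightarrow> ('v chain, 'v, 'v \<Rightarrow> 'v \<Rightarrow> 'v) decorated"
    and E :: "('v \<times> 'v \<times> ('v \<Rightarrow> 'v \<Rightarrow> 'v)) set"
  assumes small_index: "small I"
    and Ob: "i \<in> I \<Longrightarrow> D i \<in> Ob decorations"
    and edge: "(i, j, \<phi>) \<in> E \<Longrightarrow> i \<in> I \<and> j \<in> I \<and> \<phi> \<in> Mor decorations (D i) (D j)"
begin

section \<open>Levelwise colimits with their induced operators\<close>

definition edges_at :: "'v \<Rightarrow> ('v \<times> 'v \<times> ('v \<Rightarrow> 'v)) set" where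
  "edges_at \<alpha> = (\<lambda>(i, j, \<phi>). (i, j, \<phi> \<alpha>)) ` E"

definition clev :: "'v \<Rightarrow> ('v, 'v) module" where
  "clev \<alpha> = group_diagram.colim I (\<lambda>i. level (D i) \<alpha>) (edges_at \<alpha>)"

definition cproj :: "'v \<Rightarrow> 'v \<Rightarrow> 'v \<Rightarrow> 'v" where
  "cproj i \<alpha> = group_diagram.coproj I (\<lambda>i. level (D i) \<alpha>) (edges_at \<alpha>) i"

definition clift :: "'v \<Rightarrow> ('v, 'v) module \<Rightarrow> ('v \<Rightarrow> 'v \<Rightarrow> 'v) \<Rightarrow> 'v \<Rightarrow> 'v" where
  "clift \<alpha> = group_diagram.lift I (\<lambda>i. level (D i) \<alpha>) (edges_at \<alpha>)"

text \<open>Induced by the universal property at the source level; for a transition this is a map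
  between colimits formed at two different levels.\<close>

definition cact :: "'v operator \<Rightarrow> 'v \<Rightarrow> 'v" where
  "cact q = clift (source q) (clev (target q)) (\<lambda>i x. cproj i (target q) (opr (D i) q x))"

lemma group_diagram_at: "\<alpha> \<in> ON \<Longrightarrow> group_diagram I (\<lambda>i. level (D i) \<alpha>)"
  using Ob operator_structure.small_group[OF operator_structure_opr]
  by (intro group_diagram.intro small_index) (auto intro: level_group)

lemma clev_group: "\<alpha> \<in> ON \<Longrightarrow> abelian_group (clev \<alpha>)"
  unfolding clev_def by (rule group_diagram.abelian_group_colim[OF group_diagram_at])

lemma cproj_additive: "\<alpha> \<in> ON \<Longrightarrow> i \<in> I \<Longrightarrow> cproj i \<alpha> \<in> additive_maps (level (D i) \<alpha>) (clev \<alpha>)"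
  unfolding clev_def cproj_def by (rule group_diagram.coproj_additive[OF group_diagram_at])

lemma cproj_closed: "\<alpha> \<in> ON \<Longrightarrow> i \<in> I \<Longrightarrow> x \<in> lev (D i) \<alpha> \<Longrightarrow> cproj i \<alpha> x \<in> carrier (clev \<alpha>)"
  by (rule additive_maps_closed[OF cproj_additive])

lemma cproj_edge:
  "\<alpha> \<in> ON \<Longrightarrow> (i, j, \<phi>) \<in> E \<Longrightarrow> x \<in> lev (D i) \<alpha> \<Longrightarrow> cproj j \<alpha> (\<phi> \<alpha> x) = cproj i \<alpha> x"
  unfolding cproj_def
  by (rule group_diagram.coproj_edge[OF group_diagram_at])
    (use edge[of i j \<phi>] Ob in \<open>force simp: edges_at_def intro: Mor_additive\<close>)+

lemma cocone_at:
  assumes "\<alpha> \<in> ON" "abelian_group N" "\<And>i. i \<in> I \<Longrightarrow> t i \<in> additive_maps (level (D i) \<alpha>) N"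
    and "\<And>i j \<phi> x. (i, j, \<phi>) \<in> E \<Longrightarrow> x \<in> lev (D i) \<alpha> \<Longrightarrow> t j (\<phi> \<alpha> x) = t i x"
  shows "group_diagram.cocone_on I (\<lambda>i. level (D i) \<alpha>) (edges_at \<alpha>) N t"
  unfolding group_diagram.cocone_on_def[OF group_diagram_at[OF assms(1)]] edges_at_def
  using assms by auto

lemma clift:
  assumes "\<alpha> \<in> ON" "abelian_group N" "\<And>i. i \<in> I \<Longrightarrow> t i \<in> additive_maps (level (D i) \<alpha>) N"
    and "\<And>i j \<phi> x. (i, j, \<phi>) \<in> E \<Longrightarrow> x \<in> lev (D i) \<alpha> \<Longrightarrow> t j (\<phi> \<alpha> x) = t i x"
  shows clift_additive: "clift \<alpha> N t \<in> additive_maps (clev \<alpha>) N"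
    and clift_cproj: "i \<in> I \<Longrightarrow> x \<in> lev (D i) \<alpha> \<Longrightarrow> clift \<alpha> N t (cproj i \<alpha> x) = t i x"
  unfolding clift_def clev_def cproj_def
  using group_diagram.lift_additive[OF group_diagram_at cocone_at]
    group_diagram.lift_coproj[OF group_diagram_at cocone_at] assms by blast+

lemma clev_eqI:
  assumes "\<alpha> \<in> ON" "f \<in> additive_maps (clev \<alpha>) N" "g \<in> additive_maps (clev \<alpha>) N" "abelian_group N"
    and "\<And>i x. i \<in> I \<Longrightarrow> x \<in> lev (D i) \<alpha> \<Longrightarrow> f (cproj i \<alpha> x) = g (cproj i \<alpha> x)"
    and "c \<in> carrier (clev \<alpha>)"
  shows "f c = g c"
  using group_diagram.colim_maps_eqI[OF group_diagram_at[OF assms(1)], of f "edges_at \<alpha>" N g c] assms(2-)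
  unfolding clev_def cproj_def by blast

text \<open>Edges are morphisms, hence commute with operators; therefore an operator followed by
  \<open>cproj\<close> is again compatible with the edges.\<close>

lemma cact_cocone:
  assumes q: "q \<in> operators"
  shows "i \<in> I \<Longrightarrow> (\<lambda>x. cproj i (target q) (opr (D i) q x)) \<in> additive_maps (level (D i) (source q)) (clev
    (target q))"
    and "(i, j, \<phi>) \<in> E \<Longrightarrow> x \<in> lev (D i) (source q) \<Longrightarrow>
      cproj j (target q) (opr (D j) q (\<phi> (source q) x)) = cproj i (target q) (opr (D i) q x)"
proof -
  have l: "source q \<in> ON" "target q \<in> ON" using operators_levels[OF q] by auto
  show "(\<lambda>x. cproj i (target q) (opr (D i) q x)) \<in> additive_maps (level (D i) (source q)) (clev (target
    q))" if "i \<in> I"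
    using additive_maps_comp[OF opr_additive[OF Ob[OF that] q] cproj_additive[OF l(2) that]] .
  assume e: "(i, j, \<phi>) \<in> E" and x: "x \<in> lev (D i) (source q)"
  then have ij: "i \<in> I" "j \<in> I" "\<phi> \<in> Mor decorations (D i) (D j)" using edge by auto
  show "cproj j (target q) (opr (D j) q (\<phi> (source q) x)) = cproj i (target q) (opr (D i) q x)"
    using Mor_opr[OF Ob[OF ij(1)] Ob[OF ij(2)] ij(3) q x] cproj_edge[OF l(2) e opr_closed[OF Ob[OF
      ij(1)] q x]] by simp
qed

lemma cact_additive: "q \<in> operators \<Longrightarrow> cact q \<in> additive_maps (clev (source q)) (clev (target q))"
  unfolding cact_def using operators_levels
  by (intro clift_additive clev_group cact_cocone) auto

lemma cact_cproj:
  "q \<in> operators \<Longrightarrow> i \<in> I \<Longrightarrow> x \<in> lev (D i) (source q) \<Longrightarrow>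
    cact q (cproj i (source q) x) = cproj i (target q) (opr (D i) q x)"
  unfolding cact_def using operators_levels
  by (intro clift_cproj clev_group cact_cocone) auto

lemma structure_at: "i \<in> I \<Longrightarrow> operator_structure k \<iota> (level (D i)) (opr (D i)) (labels (D i))"
  by (rule operator_structure_opr[OF Ob])

lemma cact_cproj':
  assumes "i \<in> I"
  shows "\<alpha> \<in> ON \<Longrightarrow> a \<in> carrier (k \<alpha>) \<Longrightarrow> x \<in> lev (D i) \<alpha> \<Longrightarrow>
      cact (Scalar \<alpha> a) (cproj i \<alpha> x) = cproj i \<alpha> (opr (D i) (Scalar \<alpha> a) x)"
    and "\<alpha> \<in> ON \<Longrightarrow> \<beta> \<in> ON \<Longrightarrow> \<alpha> \<preceq> \<beta> \<Longrightarrow> x \<in> lev (D i) \<alpha> \<Longrightarrow>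
      cact (Transition \<beta> \<alpha>) (cproj i \<alpha> x) = cproj i \<beta> (opr (D i) (Transition \<beta> \<alpha>) x)"
    and "\<alpha> \<in> ON \<Longrightarrow> x \<in> lev (D i) \<alpha> \<Longrightarrow>
      cact (Label s \<alpha>) (cproj i \<alpha> x) = cproj i \<alpha> (opr (D i) (Label s \<alpha>) x)"
  using cact_cproj[of "Scalar \<alpha> a" i x] cact_cproj[of "Transition \<beta> \<alpha>" i x] cact_cproj[of "Label s \<alpha>" i
    x] assms
  by (simp_all del: opr.simps)

text \<open>Elements of the colimit are finite sums of \<open>cproj i \<beta> x\<close>. Over a
  common base level, a combination expressing \<open>x\<close> in \<open>D i\<close> maps to one
  with the same coefficients in the colimit, and sums of combinations are concatenations.\<close>

lemma clev_grounded:
  "\<exists>\<alpha>\<in>ON. \<forall>\<beta>\<in>ON. \<alpha> \<prec> \<beta> \<longrightarrow>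
    carrier (clev \<beta>) \<subseteq> lincomb clev cact \<beta> \<alpha> ` lists (carrier (k \<beta>) \<times> carrier (clev \<alpha>))"
proof -
  define P where "P i \<alpha> \<longleftrightarrow> \<alpha> \<in> ON \<and> (\<forall>\<beta>\<in>ON. \<alpha> \<prec> \<beta> \<longrightarrow>
    lev (D i) \<beta> \<subseteq> lincomb (level (D i)) (opr (D i)) \<beta> \<alpha> ` lists (carrier (k \<beta>) \<times> lev (D i) \<alpha>))" for i \<alpha>
  have "\<forall>i\<in>I. \<exists>\<alpha>. P i \<alpha>"
    using operator_structure.grounded[OF structure_at] unfolding P_def by blast
  then obtain g where g: "\<And>i. i \<in> I \<Longrightarrow> P i (g i)" by metis
  have "g ` I \<subseteq> ON" using g by (auto simp: P_def)
  then obtain \<alpha> where \<alpha>: "\<alpha> \<in> ON" "\<And>i. i \<in> I \<Longrightarrow> g i \<prec> \<alpha>"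
    using ordinal_upper_bound[OF small_image[OF small_index]] by (metis imageI)
  have "carrier (clev \<beta>) \<subseteq> lincomb clev cact \<beta> \<alpha> ` lists (carrier (k \<beta>) \<times> carrier (clev \<alpha>))"
    if \<beta>: "\<beta> \<in> ON" "\<alpha> \<prec> \<beta>" for \<beta>
  proof
    fix c assume "c \<in> carrier (clev \<beta>)"
    let ?L = "lists (carrier (k \<beta>) \<times> carrier (clev \<alpha>))"
    have le: "\<alpha> \<preceq> \<beta>" using \<beta>(2) by (rule ord_less_imp_le)
    have closed: "cact (Scalar \<beta> a) (cact (Transition \<beta> \<alpha>) x) \<in> carrier (clev \<beta>)"
      if "a \<in> carrier (k \<beta>)" "x \<in> carrier (clev \<alpha>)" for a x
      using additive_maps_closed[OF cact_additive[of "Scalar \<beta> a"]]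
        additive_maps_closed[OF cact_additive[of "Transition \<beta> \<alpha>"]] that \<alpha> \<beta> le by simp
    have append: "lincomb clev cact \<beta> \<alpha> (v @ w) = lincomb clev cact \<beta> \<alpha> v \<oplus>\<^bsub>clev \<beta>\<^esub> lincomb clev cact \<beta> \<alpha> w"
      if "v \<in> ?L" "w \<in> ?L" for v w
      unfolding lincomb_def using in_lists_TimesD[OF that(1)] in_lists_TimesD[OF that(2)]
      by (intro eval_word_append clev_group \<beta>(1)) (auto simp: closed)
    show "c \<in> lincomb clev cact \<beta> \<alpha> ` ?L"
    proof (rule group_diagram.colim_induct[OF group_diagram_at[OF \<beta>(1)], of c "edges_at \<beta>"],
        fold clev_def cproj_def)
      show "c \<in> carrier (clev \<beta>)" by fact
      show "\<zero>\<^bsub>clev \<beta>\<^esub> \<in> lincomb clev cact \<beta> \<alpha> ` ?L"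
        by (rule image_eqI[of _ _ "[]"]) (auto simp: lincomb_def)
      fix i x c assume i: "i \<in> I" and x: "x \<in> lev (D i) \<beta>" and c: "c \<in> lincomb clev cact \<beta> \<alpha> ` ?L"
      interpret O: operator_structure k \<iota> "level (D i)" "opr (D i)" "labels (D i)"
        by (rule structure_at[OF i])
      have gi: "g i \<in> ON" "g i \<prec> \<alpha>" using g[OF i] \<alpha>(2)[OF i] by (auto simp: P_def)
      have "x \<in> lincomb (level (D i)) (opr (D i)) \<beta> \<alpha> ` lists (carrier (k \<beta>) \<times> lev (D i) \<alpha>)"
        using g[OF i] x \<beta> ord_less_trans[OF \<beta>(1) gi(2) \<beta>(2)]
          O.grounded_mono[OF gi(1) \<alpha>(1) ord_less_imp_le[OF gi(2)] \<beta>] unfolding P_def by blast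
      then obtain w where w: "x = lincomb (level (D i)) (opr (D i)) \<beta> \<alpha> w"
        "w \<in> lists (carrier (k \<beta>) \<times> lev (D i) \<alpha>)"
        by blast
      let ?w = "map (\<lambda>p. (fst p, cproj i \<alpha> (snd p))) w"
      have w': "?w \<in> ?L" by (rule map_in_lists[OF w(2)]) (use \<alpha> i cproj_closed in auto)
      have "cproj i \<beta> (lincomb (level (D i)) (opr (D i)) \<beta> \<alpha> w) = lincomb clev cact \<beta> \<alpha> ?w"
        using w(2)
      proof (induction w)
        case Nil then show ?case
          using additive_maps_zero[OF cproj_additive[OF \<beta>(1) i]] level_group[OF Ob[OF i] \<beta>(1)]
            clev_group[OF \<beta>(1)]
          by (simp add: lincomb_def)
      next
        case (Cons p w)
        obtain a y where p: "p = (a, y)" "a \<in> carrier (k \<beta>)" "y \<in> lev (D i) \<alpha>" using Cons by (cases p) auto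
        note cl = O.transition_closed[OF \<alpha>(1) \<beta>(1) le p(3)]
        have "cproj i \<beta> (opr (D i) (Scalar \<beta> a) (opr (D i) (Transition \<beta> \<alpha>) y)) =
            cact (Scalar \<beta> a) (cact (Transition \<beta> \<alpha>) (cproj i \<alpha> y))"
          using cact_cproj'[OF i] \<alpha>(1) \<beta>(1) le p cl by (simp del: opr.simps)
        then show ?case
          using Cons p O.lincomb_closed[OF \<alpha>(1) \<beta>(1) le, of w] O.scalar_closed[OF \<beta>(1) p(2) cl]
            additive_maps_add[OF cproj_additive[OF \<beta>(1) i]]
          by (auto simp del: opr.simps simp: lincomb_def)
      qed
      moreover obtain v where v: "c = lincomb clev cact \<beta> \<alpha> v" "v \<in> ?L" using c by blast
      ultimately have "cproj i \<beta> x \<oplus>\<^bsub>clev \<beta>\<^esub> c = lincomb clev cact \<beta> \<alpha> (?w @ v)"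
        using append[OF w' v(2)] w(1) by simp
      then show "cproj i \<beta> x \<oplus>\<^bsub>clev \<beta>\<^esub> c \<in> lincomb clev cact \<beta> \<alpha> ` ?L" using w' v(2) by auto
    qed
  qed
  then show ?thesis using \<alpha>(1) by blast
qed

text \<open>Both sides of each identity are additive in \<open>c\<close>, so by
  \<open>clev_eqI\<close> it is enough to compare them on the elements
  \<open>cproj i \<alpha> x\<close>, where they reduce to the same identity in
  \<open>D i\<close>.\<close>

lemma operator_structure_colim: "operator_structure k \<iota> clev cact (\<Union>i\<in>I. labels (D i))"
proof (intro operator_structure.intro operator_structure_axioms.intro field_tower_axioms clev_group
  cact_additive clev_grounded)
  fix \<alpha> :: 'v assume \<alpha>: "\<alpha> \<in> ON"
  have sc: "cact (Scalar \<alpha> a) \<in> additive_maps (clev \<alpha>) (clev \<alpha>)" if "a \<in> carrier (k \<alpha>)" for a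
    using cact_additive[of "Scalar \<alpha> a"] that \<alpha> by simp
  have tr: "cact (Transition \<beta> \<alpha>) \<in> additive_maps (clev \<alpha>) (clev \<beta>)" if "\<alpha> \<in> ON" "\<beta> \<in> ON" "\<alpha> \<preceq> \<beta>" for \<alpha> \<beta>
    using cact_additive[of "Transition \<beta> \<alpha>"] that by simp
  have la: "cact (Label s \<alpha>) \<in> additive_maps (clev \<alpha>) (clev \<alpha>)" if "\<alpha> \<in> ON" for s \<alpha>
    using cact_additive[of "Label s \<alpha>"] that by simp
  have add: "cproj i \<alpha> (x \<oplus>\<^bsub>level (D i) \<alpha>\<^esub> y) = cproj i \<alpha> x \<oplus>\<^bsub>clev \<alpha>\<^esub> cproj i \<alpha> y"
    if "i \<in> I" "x \<in> lev (D i) \<alpha>" "y \<in> lev (D i) \<alpha>" for i x y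
    using that by (rule additive_maps_add[OF cproj_additive[OF \<alpha>]])
  show "small (carrier (clev \<alpha>))" unfolding clev_def
    by (rule group_diagram.small_colim[OF group_diagram_at[OF \<alpha>]])
  interpret K: cring "k \<alpha>" using \<alpha> by (rule cring_level)
  note cl = operator_structure.scalar_closed[OF structure_at \<alpha>] operator_structure.transition_closed[OF
    structure_at \<alpha>]
     operator_structure.label_closed[OF structure_at \<alpha>]
  note eqI = clev_eqI[OF \<alpha> _ _ clev_group[OF \<alpha>]]
  note pr = cact_cproj'(1,3)[OF _ \<alpha>] cact_cproj'(2)[OF _ \<alpha>]
  fix c assume c: "c \<in> carrier (clev \<alpha>)"
  {
    fix a b assume ab: "a \<in> carrier (k \<alpha>)" "b \<in> carrier (k \<alpha>)"
    show "cact (Scalar \<alpha> (a \<oplus>\<^bsub>k \<alpha>\<^esub> b)) c = cact (Scalar \<alpha> a) c \<oplus>\<^bsub>clev \<alpha>\<^esub> cact (Scalar \<alpha> b) c"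
      by (rule eqI[OF _ _ _ c], rule sc, use ab in simp, rule add_additive_maps[OF clev_group[OF \<alpha>]
        sc[OF ab(1)] sc[OF ab(2)]])
        (use ab cl operator_structure.scalar_add[OF structure_at \<alpha>] in \<open>simp del: opr.simps add: pr add\<close>)
    show "cact (Scalar \<alpha> (a \<otimes>\<^bsub>k \<alpha>\<^esub> b)) c = cact (Scalar \<alpha> a) (cact (Scalar \<alpha> b) c)"
      by (rule eqI[OF _ _ _ c], rule sc, use ab in simp, rule additive_maps_comp[OF sc[OF ab(2)]
        sc[OF ab(1)]])
        (use ab cl operator_structure.scalar_mult[OF structure_at \<alpha>] in \<open>simp del: opr.simps add: pr\<close>)
  }
  show "cact (Scalar \<alpha> \<one>\<^bsub>k \<alpha>\<^esub>) c = c"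
    by (rule eqI[of _ "\<lambda>c. c", OF _ _ _ c], rule sc, simp, rule additive_mapsI)
      (use cl operator_structure.scalar_one[OF structure_at \<alpha>] in \<open>simp_all del: opr.simps add: pr\<close>)
  show "cact (Transition \<alpha> \<alpha>) c = c"
    by (rule eqI[of _ "\<lambda>c. c", OF _ _ _ c], rule tr[OF \<alpha> \<alpha>], simp, rule additive_mapsI)
      (use cl \<alpha> operator_structure.transition_id[OF structure_at \<alpha>] in \<open>simp_all del: opr.simps add: pr\<close>)
  show "cact (Label s \<alpha>) c = \<zero>\<^bsub>clev \<alpha>\<^esub>" if s: "s \<notin> (\<Union>i\<in>I. labels (D i))" for s
  proof (rule eqI[OF la[OF \<alpha>] zero_additive_maps[OF clev_group[OF \<alpha>]] _ c])
    fix i x assume "i \<in> I" "x \<in> lev (D i) \<alpha>"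
    then show "cact (Label s \<alpha>) (cproj i \<alpha> x) = \<zero>\<^bsub>clev \<alpha>\<^esub>"
      using s operator_structure.label_zero[OF structure_at, of i \<alpha> s x] \<alpha>
        additive_maps_zero[OF cproj_additive[OF \<alpha>], of i] level_group[OF Ob \<alpha>] clev_group[OF \<alpha>]
      by (simp del: opr.simps add: pr)
  qed
  {
    fix a s assume a: "a \<in> carrier (k \<alpha>)"
    show "cact (Label s \<alpha>) (cact (Scalar \<alpha> a) c) = cact (Scalar \<alpha> a) (cact (Label s \<alpha>) c)"
      by (rule eqI[OF _ _ _ c], rule additive_maps_comp[OF sc[OF a] la[OF \<alpha>]], rule
        additive_maps_comp[OF la[OF \<alpha>] sc[OF a]])
        (use a cl operator_structure.label_scalar[OF structure_at \<alpha>] in \<open>simp del: opr.simps add: pr\<close>)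
  }
  fix \<beta> :: 'v assume \<beta>: "\<beta> \<in> ON" "\<alpha> \<preceq> \<beta>"
  note eqI' = clev_eqI[OF \<alpha> _ _ clev_group[OF \<beta>(1)]]
  note cl' = operator_structure.transition_closed[OF structure_at \<alpha> \<beta>]
    operator_structure.label_closed[OF structure_at \<beta>(1)]
  note pr' = cact_cproj'[OF _ \<beta>(1)] cact_cproj'(2)[OF _ \<alpha> \<beta>]
  have sc': "cact (Scalar \<beta> a) \<in> additive_maps (clev \<beta>) (clev \<beta>)" if "a \<in> carrier (k \<beta>)" for a
    using cact_additive[of "Scalar \<beta> a"] that \<beta> by simp
  {
    fix a assume a: "a \<in> carrier (k \<alpha>)"
    have a': "\<iota> \<beta> \<alpha> a \<in> carrier (k \<beta>)" using ring_hom_closed[OF incl_hom[OF \<alpha> \<beta>] a] .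
    show "cact (Transition \<beta> \<alpha>) (cact (Scalar \<alpha> a) c) = cact (Scalar \<beta> (\<iota> \<beta> \<alpha> a)) (cact (Transition \<beta> \<alpha>) c)"
      by (rule eqI'[OF _ _ _ c], rule additive_maps_comp[OF sc[OF a] tr[OF \<alpha> \<beta>]], rule
        additive_maps_comp[OF tr[OF \<alpha> \<beta>] sc'[OF a']])
        (use a a' cl cl' operator_structure.transition_scalar[OF structure_at \<alpha> \<beta>] in \<open>simp del:
          opr.simps add: pr pr'\<close>)
  }
  show "cact (Label s \<beta>) (cact (Transition \<beta> \<alpha>) c) = cact (Transition \<beta> \<alpha>) (cact (Label s \<alpha>) c)" for s
    by (rule eqI'[OF _ _ _ c], rule additive_maps_comp[OF tr[OF \<alpha> \<beta>] la[OF \<beta>(1)]], rule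
      additive_maps_comp[OF la[OF \<alpha>] tr[OF \<alpha> \<beta>]])
      (use cl cl' operator_structure.label_transition[OF structure_at \<alpha> \<beta>] in \<open>simp del: opr.simps add:
        pr pr'\<close>)
  fix \<gamma> :: 'v assume \<gamma>: "\<gamma> \<in> ON" "\<beta> \<preceq> \<gamma>"
  have le: "\<alpha> \<preceq> \<gamma>" using ord_le_trans[OF \<gamma>(1) \<beta>(2) \<gamma>(2)] .
  show "cact (Transition \<gamma> \<beta>) (cact (Transition \<beta> \<alpha>) c) = cact (Transition \<gamma> \<alpha>) c"
    by (rule clev_eqI[OF \<alpha> _ _ clev_group[OF \<gamma>(1)] _ c], rule additive_maps_comp[OF tr[OF \<alpha> \<beta>]
      tr[OF \<beta>(1) \<gamma>]], rule tr[OF \<alpha> \<gamma>(1) le])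
      (use cl' \<gamma> le operator_structure.transition_comp[OF structure_at \<alpha> \<beta>(1) \<gamma>(1) \<beta>(2) \<gamma>(2)]
        in \<open>simp del: opr.simps add: pr pr'\<close>)
next
  show "small (\<Union>i\<in>I. labels (D i))"
    using operator_structure.small_labels[OF structure_at] by (intro small_UN small_index)
qed

text \<open>All labels of the diagram are united. A label of one object acts by zero on the images
  of the objects that lack it, in accordance with the convention for absent labels.\<close>

definition colimit where
  "colimit = mk_decorated clev cact (\<Union>i\<in>I. labels (D i))"

definition inclusion :: "'v \<Rightarrow> 'v \<Rightarrow> 'v \<Rightarrow> 'v" where
  "inclusion i = mk_mor (D i) (cproj i)"

lemma colimit_Ob: "colimit \<in> Ob decorations"
  unfolding colimit_def by (rule operator_structure.mk_decorated_in_Ob[OF operator_structure_colim])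

lemma level_colimit [simp]: "lev colimit \<alpha> = carrier (clev \<alpha>)" "\<zero>\<^bsub>level colimit \<alpha>\<^esub> = \<zero>\<^bsub>clev \<alpha>\<^esub>"
    "add (level colimit \<alpha>) = add (clev \<alpha>)"
    "additive_maps (level colimit \<alpha>) N = additive_maps (clev \<alpha>) N"
    "additive_maps N (level colimit \<alpha>) = additive_maps N (clev \<alpha>)"
  by (simp_all add: colimit_def)

lemma opr_colimit: "q \<in> operators \<Longrightarrow> x \<in> carrier (clev (source q)) \<Longrightarrow> opr colimit q x = cact q x"
  unfolding colimit_def by (rule operator_structure.opr_mk_decorated[OF operator_structure_colim])

lemma inclusion_apply: "\<alpha> \<in> ON \<Longrightarrow> x \<in> lev (D i) \<alpha> \<Longrightarrow> inclusion i \<alpha> x = cproj i \<alpha> x"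
  by (simp add: inclusion_def mk_mor_apply)

lemma inclusion_Mor: "i \<in> I \<Longrightarrow> inclusion i \<in> Mor decorations (D i) colimit"
  unfolding inclusion_def
  by (rule mk_mor_in_Mor[OF Ob colimit_Ob])
    (auto simp: cproj_additive opr_colimit cact_cproj cproj_closed operators_levels)

lemma inclusion_edge:
  assumes "(i, j, \<phi>) \<in> E" shows "cmp decorations (D i) (D j) colimit (inclusion j) \<phi> = inclusion i"
proof -
  have ij: "i \<in> I" "j \<in> I" "\<phi> \<in> Mor decorations (D i) (D j)" using edge[OF assms] by auto
  show ?thesis
    by (rule Mor_eqI[OF Ob[OF ij(1)] colimit_Ob cmp_Mor[OF Ob[OF ij(1)] Ob[OF ij(2)] colimit_Ob ij(3)
      inclusion_Mor[OF ij(2)]] inclusion_Mor[OF ij(1)]])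
      (simp add: cmp_apply inclusion_apply Mor_closed[OF Ob[OF ij(1)] Ob[OF ij(2)] ij(3)] cproj_edge[OF
        _ assms])
qed

text \<open>The lifts are formed separately at each level. That they commute with operators, and
  that they are unique, is checked on the images of the \<open>D i\<close>, where equivariance of
  \<open>\<mu> i\<close> applies.\<close>

lemma colimit_universal:
  assumes T: "T \<in> Ob decorations" and \<mu>: "\<And>i. i \<in> I \<Longrightarrow> \<mu> i \<in> Mor decorations (D i) T"
    and compat: "\<And>i j \<phi>. (i, j, \<phi>) \<in> E \<Longrightarrow> cmp decorations (D i) (D j) T (\<mu> j) \<phi> = \<mu> i"
  shows "\<exists>!h. h \<in> Mor decorations colimit T \<and> (\<forall>i\<in>I. cmp decorations (D i) colimit T h (inclusion i) = \<mu> i)"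
proof -
  have c: "\<mu> j \<alpha> (\<phi> \<alpha> x) = \<mu> i \<alpha> x" if "(i, j, \<phi>) \<in> E" "\<alpha> \<in> ON" "x \<in> lev (D i) \<alpha>" for i j \<phi> \<alpha> x
    using compat[OF that(1)] cmp_apply[OF that(2,3)] by metis
  have eval: "cmp decorations (D i) colimit T h (inclusion i) = \<mu> i \<longleftrightarrow>
      (\<forall>\<alpha>\<in>ON. \<forall>x\<in>lev (D i) \<alpha>. h \<alpha> (cproj i \<alpha> x) = \<mu> i \<alpha> x)"
    if "h \<in> Mor decorations colimit T" "i \<in> I" for h i
  proof -
    have ap: "cmp decorations (D i) colimit T h (inclusion i) \<alpha> x = h \<alpha> (cproj i \<alpha> x)"
      if "\<alpha> \<in> ON" "x \<in> lev (D i) \<alpha>" for \<alpha> x using that by (simp add: cmp_apply inclusion_apply)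
    show ?thesis
      using ap Mor_eqI[OF Ob[OF that(2)] T cmp_Mor[OF Ob[OF that(2)] colimit_Ob T inclusion_Mor[OF
        that(2)] that(1)] \<mu>[OF that(2)]]
      by metis
  qed
  let ?f = "\<lambda>\<alpha>. clift \<alpha> (level T \<alpha>) (\<lambda>i. \<mu> i \<alpha>)"
  have f: "?f \<alpha> \<in> additive_maps (clev \<alpha>) (level T \<alpha>)" if "\<alpha> \<in> ON" for \<alpha>
    using that c by (intro clift_additive level_group[OF T] Mor_additive[OF Ob T \<mu>]) auto
  have fp: "?f \<alpha> (cproj i \<alpha> x) = \<mu> i \<alpha> x" if "\<alpha> \<in> ON" "i \<in> I" "x \<in> lev (D i) \<alpha>" for \<alpha> i x
    using that c by (intro clift_cproj level_group[OF T] Mor_additive[OF Ob T \<mu>]) auto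
  have h: "mk_mor colimit ?f \<in> Mor decorations colimit T"
  proof (rule mk_mor_in_Mor[OF colimit_Ob T])
    fix q x assume q: "q \<in> operators" and x: "x \<in> lev colimit (source q)"
    have l: "source q \<in> ON" "target q \<in> ON" using operators_levels[OF q] by auto
    have "?f (target q) (cact q x) = opr T q (?f (source q) x)"
    proof (rule clev_eqI[of "source q" "\<lambda>x. ?f (target q) (cact q x)" "level T (target q)"
      "\<lambda>x. opr T q (?f (source q) x)",
          OF l(1) _ _ level_group[OF T l(2)]])
      show "(\<lambda>x. ?f (target q) (cact q x)) \<in> additive_maps (clev (source q)) (level T (target q))"
        by (rule additive_maps_comp[OF cact_additive[OF q] f[OF l(2)]])
      show "(\<lambda>x. opr T q (?f (source q) x)) \<in> additive_maps (clev (source q)) (level T (target q))"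
        by (rule additive_maps_comp[OF f[OF l(1)] opr_additive[OF T q]])
      fix i x assume "i \<in> I" "x \<in> lev (D i) (source q)"
      then show "?f (target q) (cact q (cproj i (source q) x)) = opr T q (?f (source q) (cproj i (source
        q) x))"
        using q l fp opr_closed[OF Ob q] Mor_opr[OF Ob T \<mu>] by (simp add: cact_cproj)
    qed (use x in simp)
    then show "?f (target q) (opr colimit q x) = opr T q (?f (source q) x)" using opr_colimit[OF q] x by simp
  qed (simp add: f)
  show ?thesis
  proof (rule ex1I[of _ "mk_mor colimit ?f"], intro conjI h ballI)
    fix i assume "i \<in> I" then show "cmp decorations (D i) colimit T (mk_mor colimit ?f) (inclusion i) = \<mu> i"
      unfolding eval[OF h \<open>i \<in> I\<close>] by (auto simp: mk_mor_apply cproj_closed fp)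
  next
    fix g assume g: "g \<in> Mor decorations colimit T \<and> (\<forall>i\<in>I. cmp decorations (D i) colimit T g (inclusion
      i) = \<mu> i)"
    then have gM: "g \<in> Mor decorations colimit T" by simp
    show "g = mk_mor colimit ?f"
    proof (rule Mor_eqI[OF colimit_Ob T gM h])
      fix \<alpha> x assume \<alpha>: "\<alpha> \<in> ON" and x: "x \<in> lev colimit \<alpha>"
      have "g \<alpha> x = ?f \<alpha> x"
        by (rule clev_eqI[of \<alpha> "g \<alpha>", OF \<alpha> _ f[OF \<alpha>] level_group[OF T \<alpha>]])
          (use Mor_additive[OF colimit_Ob T gM \<alpha>] x g eval[OF gM] \<alpha> fp in auto)
      then show "g \<alpha> x = mk_mor colimit ?f \<alpha> x" using \<alpha> x by (simp add: mk_mor_apply)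
    qed
  qed
qed

text \<open>The test object is a bare abelian group at one level, not a grounded chain, so vanishing
  in the colimit can be examined without constructing further objects.\<close>

lemma inclusion_eq_zeroD:
  assumes \<alpha>: "\<alpha> \<in> ON" and i: "i \<in> I" and x: "x \<in> lev (D i) \<alpha>" and "inclusion i \<alpha> x = \<zero>\<^bsub>level colimit \<alpha>\<^esub>"
  obtains R where "R \<subseteq> E" "finite R"
    "\<And>N t. \<lbrakk>abelian_group N; \<And>j. j \<in> I \<Longrightarrow> t j \<in> additive_maps (level (D j) \<alpha>) N;
      \<And>j l \<phi> y. (j, l, \<phi>) \<in> R \<Longrightarrow> y \<in> lev (D j) \<alpha> \<Longrightarrow> t l (\<phi> \<alpha> y) = t j y\<rbrakk> \<Longrightarrow> t i x = \<zero>\<^bsub>(N :: ('v, 'v) module)\<^esub>"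
proof -
  have "cproj i \<alpha> x = \<zero>\<^bsub>clev \<alpha>\<^esub>" using assms by (simp add: inclusion_apply)
  note zero = this[unfolded clev_def cproj_def]
  obtain R' where R': "R' \<subseteq> edges_at \<alpha>" "finite R'"
    "\<And>N t. group_diagram.cocone_on I (\<lambda>i. level (D i) \<alpha>) R' N t \<Longrightarrow> t i x = \<zero>\<^bsub>N\<^esub>"
    by (rule group_diagram.coproj_eq_zeroD[OF group_diagram_at[OF \<alpha>] i x zero]) blast
  \<comment> \<open>Different morphisms may coincide at level \<open>\<alpha>\<close>, so a finite
    set of preimages in \<open>E\<close> is selected.\<close>
  then obtain R where R: "R \<subseteq> E" "finite R" "R' = (\<lambda>(i, j, \<phi>). (i, j, \<phi> \<alpha>)) ` R"
    using finite_subset_image[OF R'(2) R'(1)[unfolded edges_at_def]] by blast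
  show thesis
  proof (rule that[OF R(1,2)])
    fix N :: "('v, 'v) module" and t
    assume *: "abelian_group N" "\<And>j. j \<in> I \<Longrightarrow> t j \<in> additive_maps (level (D j) \<alpha>) N"
      "\<And>j l \<phi> y. (j, l, \<phi>) \<in> R \<Longrightarrow> y \<in> lev (D j) \<alpha> \<Longrightarrow> t l (\<phi> \<alpha> y) = t j y"
    show "t i x = \<zero>\<^bsub>N\<^esub>"
      by (rule R'(3)) (use * R(3) in \<open>auto simp: group_diagram.cocone_on_def[OF group_diagram_at[OF \<alpha>]]\<close>)
  qed
qed

lemma colimit_induct:
  assumes \<alpha>: "\<alpha> \<in> ON" and "c \<in> lev colimit \<alpha>" "P \<zero>\<^bsub>level colimit \<alpha>\<^esub>"
    and "\<And>i x c. i \<in> I \<Longrightarrow> x \<in> lev (D i) \<alpha> \<Longrightarrow> c \<in> lev colimit \<alpha> \<Longrightarrow> P c \<Longrightarrow> P (inclusion i \<alpha> x \<oplus>\<^bsub>level colimit \<alpha>\<^esub> c)"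
  shows "P c"
  using group_diagram.colim_induct[OF group_diagram_at[OF \<alpha>], of c "edges_at \<alpha>" P] assms
  unfolding clev_def[symmetric] cproj_def[symmetric] by (auto simp: inclusion_apply)

end

section \<open>Abelianness\<close>

context field_tower
begin

section \<open>Zero object, biproducts and cokernels\<close>

lemma zero_objectI:
  assumes Z: "Z \<in> Ob decorations" and triv: "\<And>\<alpha> x. \<alpha> \<in> ON \<Longrightarrow> x \<in> lev Z \<alpha> \<Longrightarrow> x = \<zero>\<^bsub>level Z \<alpha>\<^esub>"
  shows "zero_object decorations Z"
  unfolding zero_object_def
proof (intro conjI ballI Z)
  fix A assume A: "A \<in> Ob decorations"
  show "\<exists>!f. f \<in> Mor decorations Z A"
  proof (rule ex1I, rule zero_Mor[OF Z A])
    fix f assume f: "f \<in> Mor decorations Z A"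
    show "f = zero_mor decorations Z A"
    proof (rule Mor_eqI[OF Z A f zero_Mor[OF Z A]])
      fix \<alpha> x assume x: "\<alpha> \<in> ON" "x \<in> lev Z \<alpha>"
      then show "f \<alpha> x = zero_mor decorations Z A \<alpha> x"
        using zero_apply[OF x, of A] triv[OF x] Mor_zero[OF Z A f x(1)] by metis
    qed
  qed
  show "\<exists>!f. f \<in> Mor decorations A Z"
  proof (rule ex1I, rule zero_Mor[OF A Z])
    fix f assume f: "f \<in> Mor decorations A Z"
    show "f = zero_mor decorations A Z"
      by (rule Mor_eqI[OF A Z f zero_Mor[OF A Z]]) (simp add: zero_apply triv Mor_closed[OF A Z f])
  qed
qed

text \<open>The colimit of the empty diagram: its elements are sums of no letters.\<close>

lemma ex_zero_object: "\<exists>Z. zero_object decorations Z"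
proof -
  interpret D: decorated_diagram k \<iota> "{}" "\<lambda>_. undefined" "{}"
    by unfold_locales auto
  have "x = \<zero>\<^bsub>level D.colimit \<alpha>\<^esub>" if "\<alpha> \<in> ON" "x \<in> lev D.colimit \<alpha>" for \<alpha> x
    using that(2) by (rule D.colimit_induct[OF that(1)]) auto
  then show ?thesis using zero_objectI[OF D.colimit_Ob] by blast
qed

text \<open>The coproduct comes from a diagram without edges on two points; the projections are
  given by identity and zero. The sum of the two idempotents is the identity because both agree on
  the coprojections. The mixed composites are recorded for the nilpotent operator of
  \<open>doubling\<close>.\<close>

lemma ex_biproduct:
  assumes A: "A \<in> Ob decorations" and B: "B \<in> Ob decorations"
  obtains P p q i j where "is_biproduct decorations A B P p q i j"
    "cmp decorations B P A p j = zero_mor decorations B A"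
    "cmp decorations A P B q i = zero_mor decorations A B"
proof -
  obtain a b :: 'v where ab: "a \<noteq> b" "small {a, b}" by (rule two_points)
  let ?D = "\<lambda>i. if i = a then A else B"
  interpret D: decorated_diagram k \<iota> "{a, b}" ?D "{}"
    using A B ab by unfold_locales (auto split: if_splits)
  let ?P = D.colimit and ?i = "D.inclusion a" and ?j = "D.inclusion b"
  note P = D.colimit_Ob
  have i: "?i \<in> Mor decorations A ?P" and j: "?j \<in> Mor decorations B ?P"
    using D.inclusion_Mor[of a] D.inclusion_Mor[of b] ab(1) by auto
  have ex: "\<exists>h. h \<in> Mor decorations ?P T \<and> cmp decorations A ?P T h ?i = f \<and> cmp decorations B ?P T h ?j = g"
    if T: "T \<in> Ob decorations" and "f \<in> Mor decorations A T" "g \<in> Mor decorations B T" for T f g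
  proof -
    have "\<exists>!h. h \<in> Mor decorations ?P T \<and>
        (\<forall>i\<in>{a, b}. cmp decorations (?D i) ?P T h (D.inclusion i) = (if i = a then f else g))"
      by (rule D.colimit_universal[OF T]) (use that in auto)
    then show ?thesis using ab(1) by auto
  qed
  obtain p where p: "p \<in> Mor decorations ?P A" "cmp decorations A ?P A p ?i = idn decorations A"
    "cmp decorations B ?P A p ?j = zero_mor decorations B A"
    using ex[OF A idn_Mor[OF A] zero_Mor[OF B A]] by blast
  obtain q where q: "q \<in> Mor decorations ?P B" "cmp decorations A ?P B q ?i = zero_mor decorations A B"
    "cmp decorations B ?P B q ?j = idn decorations B"
    using ex[OF B zero_Mor[OF A B] idn_Mor[OF B]] by blast
  have pi: "p \<alpha> (?i \<alpha> x) = x" and qi: "q \<alpha> (?i \<alpha> x) = \<zero>\<^bsub>level B \<alpha>\<^esub>" if "\<alpha> \<in> ON" "x \<in> lev A \<alpha>" for \<alpha> x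
    using p(2) q(2) cmp_apply[OF that] idn_apply[OF that] zero_apply[OF that] by metis+
  have pj: "p \<alpha> (?j \<alpha> x) = \<zero>\<^bsub>level A \<alpha>\<^esub>" and qj: "q \<alpha> (?j \<alpha> x) = x" if "\<alpha> \<in> ON" "x \<in> lev B \<alpha>" for \<alpha> x
    using p(3) q(3) cmp_apply[OF that] idn_apply[OF that] zero_apply[OF that] by metis+
  let ?e = "add_mor decorations ?P ?P (cmp decorations ?P A ?P ?i p) (cmp decorations ?P B ?P ?j q)"
  have ip: "cmp decorations ?P A ?P ?i p \<in> Mor decorations ?P ?P" by (rule cmp_Mor[OF P A P p(1) i])
  have jq: "cmp decorations ?P B ?P ?j q \<in> Mor decorations ?P ?P" by (rule cmp_Mor[OF P B P q(1) j])
  have e: "?e \<in> Mor decorations ?P ?P" by (rule add_Mor[OF P P ip jq])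
  have e_apply: "?e \<alpha> x = ?i \<alpha> (p \<alpha> x) \<oplus>\<^bsub>level ?P \<alpha>\<^esub> ?j \<alpha> (q \<alpha> x)" if "\<alpha> \<in> ON" "x \<in> lev ?P \<alpha>" for \<alpha> x
    using that by (simp add: add_apply cmp_apply)
  have gr: "abelian_group (level ?P \<alpha>)" if "\<alpha> \<in> ON" for \<alpha> by (rule level_group[OF P that])
  have ei: "cmp decorations A ?P ?P ?e ?i = ?i"
  proof (rule Mor_eqI[OF A P cmp_Mor[OF A P P i e] i])
    fix \<alpha> x assume x: "\<alpha> \<in> ON" "x \<in> lev A \<alpha>"
    interpret abelian_group "level ?P \<alpha>" using x(1) by (rule gr)
    show "cmp decorations A ?P ?P ?e ?i \<alpha> x = ?i \<alpha> x"
      unfolding cmp_apply[OF x] e_apply[OF x(1) Mor_closed[OF A P i x]]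
      using x Mor_closed[OF A P i x] by (simp only: pi qi Mor_zero[OF B P j] r_zero)
  qed
  have ej: "cmp decorations B ?P ?P ?e ?j = ?j"
  proof (rule Mor_eqI[OF B P cmp_Mor[OF B P P j e] j])
    fix \<alpha> x assume x: "\<alpha> \<in> ON" "x \<in> lev B \<alpha>"
    interpret abelian_group "level ?P \<alpha>" using x(1) by (rule gr)
    show "cmp decorations B ?P ?P ?e ?j \<alpha> x = ?j \<alpha> x"
      unfolding cmp_apply[OF x] e_apply[OF x(1) Mor_closed[OF B P j x]]
      using x Mor_closed[OF B P j x] by (simp only: pj qj Mor_zero[OF A P i] l_zero)
  qed
  interpret C: category decorations by (rule category_decorations)
  have "?e = idn decorations ?P"
    using D.colimit_universal[OF P, of D.inclusion] D.inclusion_Mor e ei ej idn_Mor[OF P]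
      C.cmp_idn_left[OF A P i] C.cmp_idn_left[OF B P j] ab(1) by (auto split: if_splits)
  then have "is_biproduct decorations A B ?P p q ?i ?j"
    using P p q i j by (simp add: is_biproduct_def)
  then show thesis using that p(3) q(2) by blast
qed

text \<open>The coequalizer of \<open>f\<close> and the zero map. The second clause is exactness at
  each level: nothing outside the image of \<open>f\<close> is killed.\<close>

lemma ex_cokernel:
  assumes A: "A \<in> Ob decorations" and B: "B \<in> Ob decorations" and f: "f \<in> Mor decorations A B"
  obtains Q q where "is_cokernel decorations A B Q f q"
    "\<And>\<alpha> y. \<alpha> \<in> ON \<Longrightarrow> y \<in> lev B \<alpha> \<Longrightarrow> q \<alpha> y = \<zero>\<^bsub>level Q \<alpha>\<^esub> \<Longrightarrow> y \<in> f \<alpha> ` lev A \<alpha>"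
proof -
  obtain a b :: 'v where ab: "a \<noteq> b" "small {a, b}" by (rule two_points)
  let ?D = "\<lambda>i. if i = a then A else B" and ?E = "{(a, b, f), (a, b, zero_mor decorations A B)}"
  interpret D: decorated_diagram k \<iota> "{a, b}" ?D ?E
    using A B ab f zero_Mor[OF A B] by unfold_locales (auto split: if_splits)
  let ?Q = D.colimit and ?q = "D.inclusion b"
  note Q = D.colimit_Ob
  have q: "?q \<in> Mor decorations B ?Q" using D.inclusion_Mor[of b] ab(1) by auto
  have ia: "cmp decorations A B ?Q ?q f = D.inclusion a"
    "cmp decorations A B ?Q ?q (zero_mor decorations A B) = D.inclusion a"
    using D.inclusion_edge[of a b] ab(1) by auto
  have q0: "cmp decorations A B T t (zero_mor decorations A B) = zero_mor decorations A T"
    if "T \<in> Ob decorations" "t \<in> Mor decorations B T" for T t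
    by (rule Mor_eqI[OF A that(1) cmp_Mor[OF A B that(1) zero_Mor[OF A B] that(2)] zero_Mor[OF A that(1)]])
      (simp add: cmp_apply zero_apply Mor_zero[OF B that])
  have "is_cokernel decorations A B ?Q f ?q"
    unfolding is_cokernel_def
  proof (intro conjI Q q ballI impI)
    show "cmp decorations A B ?Q ?q f = zero_mor decorations A ?Q" using ia q0[OF Q q] by simp
    fix T t assume T: "T \<in> Ob decorations" and t: "t \<in> Mor decorations B T"
      and tf: "cmp decorations A B T t f = zero_mor decorations A T"
    let ?\<mu> = "\<lambda>i. if i = a then zero_mor decorations A T else t"
    have "\<exists>!h. h \<in> Mor decorations ?Q T \<and> (\<forall>i\<in>{a, b}. cmp decorations (?D i) ?Q T h (D.inclusion i) = ?\<mu> i)"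
    proof (rule D.colimit_universal[OF T])
      show "?\<mu> i \<in> Mor decorations (?D i) T" if "i \<in> {a, b}" for i using that t zero_Mor[OF A T] by auto
      show "cmp decorations (?D i) (?D j) T (?\<mu> j) \<phi> = ?\<mu> i" if "(i, j, \<phi>) \<in> ?E" for i j \<phi>
        using that ab(1) tf q0[OF T t] by auto
    qed
    \<comment> \<open>The condition at the vertex \<open>a\<close> is automatic, since
      \<open>D.inclusion a\<close> factors through the zero map into \<open>B\<close>.\<close>
    moreover have "cmp decorations A ?Q T h (D.inclusion a) = zero_mor decorations A T"
      if h: "h \<in> Mor decorations ?Q T" for h
    proof -
      interpret C: category decorations by (rule category_decorations)
      have "cmp decorations A ?Q T h (D.inclusion a) = cmp decorations A B T (cmp decorations B ?Q T h
        ?q) (zero_mor decorations A B)"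
        unfolding ia(2)[symmetric] by (rule C.cmp_assoc[OF A B Q T zero_Mor[OF A B] q h])
      then show ?thesis using q0[OF T cmp_Mor[OF B Q T q h]] by simp
    qed
    ultimately show "\<exists>!h. h \<in> Mor decorations ?Q T \<and> cmp decorations B ?Q T h ?q = t"
      using ab(1) by auto
  qed
  moreover have "y \<in> f \<alpha> ` lev A \<alpha>" if \<alpha>: "\<alpha> \<in> ON" and y: "y \<in> lev B \<alpha>" and qy: "?q \<alpha> y = \<zero>\<^bsub>level ?Q \<alpha>\<^esub>"
    for \<alpha> y
  proof -
    interpret A: abelian_group "level A \<alpha>" by (rule level_group[OF A \<alpha>])
    have H: "f \<alpha> ` lev A \<alpha> \<subseteq> lev B \<alpha>" "\<zero>\<^bsub>level B \<alpha>\<^esub> \<in> f \<alpha> ` lev A \<alpha>"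
      using Mor_closed[OF A B f \<alpha>] Mor_zero[OF A B f \<alpha>, symmetric] by auto
    have H': "x \<oplus>\<^bsub>level B \<alpha>\<^esub> y \<in> f \<alpha> ` lev A \<alpha>" if "x \<in> f \<alpha> ` lev A \<alpha>" "y \<in> f \<alpha> ` lev A \<alpha>" for x y
      using that Mor_add[OF A B f \<alpha>, symmetric] by auto
    have H'': "\<ominus>\<^bsub>level B \<alpha>\<^esub> x \<in> f \<alpha> ` lev A \<alpha>" if "x \<in> f \<alpha> ` lev A \<alpha>" for x
      using that Mor_minus[OF A B f \<alpha>, symmetric] by auto
    obtain N :: "('v, 'v) module" and p where N: "abelian_group N" "p \<in> additive_maps (level B \<alpha>) N"
      "\<And>x. x \<in> lev B \<alpha> \<Longrightarrow> p x = \<zero>\<^bsub>N\<^esub> \<longleftrightarrow> x \<in> f \<alpha> ` lev A \<alpha>"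
      using quotient_group[OF level_group[OF B \<alpha>] H H' H''] by blast
    have pf: "p (f \<alpha> x) = \<zero>\<^bsub>N\<^esub>" if "x \<in> lev A \<alpha>" for x using N(3)[of "f \<alpha> x"] H(1) that by auto
    have p0: "p \<zero>\<^bsub>level B \<alpha>\<^esub> = \<zero>\<^bsub>N\<^esub>" using additive_maps_zero[OF N(2) level_group[OF B \<alpha>] N(1)] .
    \<comment> \<open>A test cocone into the quotient of \<open>level B \<alpha>\<close> by the
      image of \<open>f \<alpha>\<close>: both parallel edges become zero, so \<open>y\<close> must
      die in this quotient.\<close>
    let ?t = "\<lambda>i. if i = a then (\<lambda>_. \<zero>\<^bsub>N\<^esub>) else p"
    obtain R where R: "R \<subseteq> ?E" "\<And>N t. \<lbrakk>abelian_group N; \<And>j. j \<in> {a, b} \<Longrightarrow> t j \<in> additive_maps (level (?D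
      j) \<alpha>) N;
      \<And>j l \<phi> y. (j, l, \<phi>) \<in> R \<Longrightarrow> y \<in> lev (?D j) \<alpha> \<Longrightarrow> t l (\<phi> \<alpha> y) = t j y\<rbrakk> \<Longrightarrow> t b y = \<zero>\<^bsub>(N :: ('v, 'v) module)\<^esub>"
    proof (rule D.inclusion_eq_zeroD[OF \<alpha>, of b y])
      show "y \<in> lev (?D b) \<alpha>" using ab(1) y by auto
      show "?q \<alpha> y = \<zero>\<^bsub>level ?Q \<alpha>\<^esub>" by (rule qy)
    qed auto
    have "?t b y = \<zero>\<^bsub>N\<^esub>"
    proof (rule R(2)[OF N(1)])
      show "?t j \<in> additive_maps (level (?D j) \<alpha>) N" if "j \<in> {a, b}" for j
        using that N(2) zero_additive_maps[OF N(1)] by auto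
      show "?t l (\<phi> \<alpha> y) = ?t j y" if "(j, l, \<phi>) \<in> R" "y \<in> lev (?D j) \<alpha>" for j l \<phi> y
        using subsetD[OF R(1) that(1)] that(2) ab(1) pf p0 zero_apply[OF \<alpha>, of y A B] by auto
    qed
    then show ?thesis using ab(1) N(3)[OF y] by auto
  qed
  ultimately show thesis by (rule that)
qed

text \<open>The cokernel map and the zero map agree after composition with \<open>e\<close>, hence
  are equal; exactness of the cokernel then puts every element into the image.\<close>

lemma epi_surjective:
  assumes A: "A \<in> Ob decorations" and B: "B \<in> Ob decorations" and e: "epi_mor decorations A B e"
    and y: "\<alpha> \<in> ON" "y \<in> lev B \<alpha>"
  shows "\<exists>x\<in>lev A \<alpha>. e \<alpha> x = y"
proof -
  have eM: "e \<in> Mor decorations A B" using e by (simp add: epi_mor_def)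
  obtain Q q where q: "is_cokernel decorations A B Q e q"
    "\<And>\<alpha> y. \<alpha> \<in> ON \<Longrightarrow> y \<in> lev B \<alpha> \<Longrightarrow> q \<alpha> y = \<zero>\<^bsub>level Q \<alpha>\<^esub> \<Longrightarrow> y \<in> e \<alpha> ` lev A \<alpha>"
    using ex_cokernel[OF A B eM] by blast
  have Q: "Q \<in> Ob decorations" and qM: "q \<in> Mor decorations B Q"
    and qe: "cmp decorations A B Q q e = zero_mor decorations A Q"
    using q(1) by (auto simp: is_cokernel_def)
  have "cmp decorations A B Q (zero_mor decorations B Q) e = zero_mor decorations A Q"
    by (rule Mor_eqI[OF A Q cmp_Mor[OF A B Q eM zero_Mor[OF B Q]] zero_Mor[OF A Q]])
      (simp add: cmp_apply zero_apply Mor_closed[OF A B eM])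
  then have "q = zero_mor decorations B Q" using e Q qM qe zero_Mor[OF B Q] by (auto simp: epi_mor_def)
  then show ?thesis using q(2)[OF y] zero_apply[OF y, of Q] by auto
qed

text \<open>\<open>m\<close> is a kernel of its cokernel: a map killed by the cokernel takes values
  in the image of \<open>m\<close>. Injectivity makes the chosen preimages unique, so they depend
  additively and equivariantly on the argument.\<close>

lemma mono_is_kernel:
  assumes A: "A \<in> Ob decorations" and B: "B \<in> Ob decorations" and m: "mono_mor decorations A B m"
  shows "\<exists>C\<in>Ob decorations. \<exists>g\<in>Mor decorations B C. is_kernel decorations A B C m g"
proof -
  have mM: "m \<in> Mor decorations A B" using m by (simp add: mono_mor_def)
  obtain Q q where q: "is_cokernel decorations A B Q m q"
    "\<And>\<alpha> y. \<alpha> \<in> ON \<Longrightarrow> y \<in> lev B \<alpha> \<Longrightarrow> q \<alpha> y = \<zero>\<^bsub>level Q \<alpha>\<^esub> \<Longrightarrow> y \<in> m \<alpha> ` lev A \<alpha>"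
    using ex_cokernel[OF A B mM] by blast
  have Q: "Q \<in> Ob decorations" and qM: "q \<in> Mor decorations B Q"
    and qm: "cmp decorations A B Q q m = zero_mor decorations A Q"
    using q(1) by (auto simp: is_cokernel_def)
  have inj: "x = y" if x: "\<alpha> \<in> ON" "x \<in> lev A \<alpha>" "y \<in> lev A \<alpha>" "m \<alpha> x = m \<alpha> y" for \<alpha> x y
  proof -
    interpret A: abelian_group "level A \<alpha>" by (rule level_group[OF A x(1)])
    interpret B: abelian_group "level B \<alpha>" by (rule level_group[OF B x(1)])
    have "m \<alpha> (x \<ominus>\<^bsub>level A \<alpha>\<^esub> y) = \<zero>\<^bsub>level B \<alpha>\<^esub>"
      using x Mor_closed[OF A B mM] by (simp add: A.minus_eq Mor_add[OF A B mM] Mor_minus[OF A B mM] B.r_neg)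
    then have "x \<ominus>\<^bsub>level A \<alpha>\<^esub> y = \<zero>\<^bsub>level A \<alpha>\<^esub>" using mono_injective[OF A B m x(1)] x by simp
    then show ?thesis using x by - (rule A.eq_if_minus_eq_zero; simp)
  qed
  have "is_kernel decorations A B Q m q"
    unfolding is_kernel_def
  proof (intro conjI A mM qm ballI impI)
    fix T t assume T: "T \<in> Ob decorations" and t: "t \<in> Mor decorations T B"
      and qt: "cmp decorations T B Q q t = zero_mor decorations T Q"
    define h where "h \<alpha> x = (SOME y. y \<in> lev A \<alpha> \<and> m \<alpha> y = t \<alpha> x)" for \<alpha> x
    have h: "h \<alpha> x \<in> lev A \<alpha>" "m \<alpha> (h \<alpha> x) = t \<alpha> x" if x: "\<alpha> \<in> ON" "x \<in> lev T \<alpha>" for \<alpha> x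
    proof -
      have "q \<alpha> (t \<alpha> x) = \<zero>\<^bsub>level Q \<alpha>\<^esub>" using qt cmp_apply[OF x] zero_apply[OF x] by metis
      then have "t \<alpha> x \<in> m \<alpha> ` lev A \<alpha>" using q(2)[OF x(1)] Mor_closed[OF T B t x] by blast
      then have "\<exists>y. y \<in> lev A \<alpha> \<and> m \<alpha> y = t \<alpha> x" by auto
      then have "h \<alpha> x \<in> lev A \<alpha> \<and> m \<alpha> (h \<alpha> x) = t \<alpha> x" unfolding h_def by (rule someI_ex)
      then show "h \<alpha> x \<in> lev A \<alpha>" "m \<alpha> (h \<alpha> x) = t \<alpha> x" by auto
    qed
    have hM: "mk_mor T h \<in> Mor decorations T A"
    proof (rule mk_mor_in_Mor[OF T A])
      fix \<alpha> :: 'v assume \<alpha>: "\<alpha> \<in> ON"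
      interpret A: abelian_group "level A \<alpha>" by (rule level_group[OF A \<alpha>])
      interpret T: abelian_group "level T \<alpha>" by (rule level_group[OF T \<alpha>])
      show "h \<alpha> \<in> additive_maps (level T \<alpha>) (level A \<alpha>)"
      proof (rule additive_mapsI)
        fix x y assume xy: "x \<in> lev T \<alpha>" "y \<in> lev T \<alpha>"
        show "h \<alpha> (x \<oplus>\<^bsub>level T \<alpha>\<^esub> y) = h \<alpha> x \<oplus>\<^bsub>level A \<alpha>\<^esub> h \<alpha> y"
          by (rule inj[OF \<alpha>]) (use h[OF \<alpha>] xy \<alpha> in \<open>simp_all add: Mor_add[OF A B mM] Mor_add[OF T B t]\<close>)
      qed (rule h(1)[OF \<alpha>])
    next
      fix o' x assume o: "o' \<in> operators" and x: "x \<in> lev T (source o')"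
      have l: "source o' \<in> ON" "target o' \<in> ON" using operators_levels[OF o] by auto
      show "h (target o') (opr T o' x) = opr A o' (h (source o') x)"
        by (rule inj[OF l(2)])
          (use h[OF l(1) x] opr_closed[OF T o x] in
           \<open>simp_all add: h[OF l(2)] opr_closed[OF A o] Mor_opr[OF A B mM o] Mor_opr[OF T B t o x]\<close>)
    qed
    show "\<exists>!h. h \<in> Mor decorations T A \<and> cmp decorations T A B m h = t"
    proof (rule ex1I[of _ "mk_mor T h"], intro conjI hM)
      show "cmp decorations T A B m (mk_mor T h) = t"
        by (rule Mor_eqI[OF T B cmp_Mor[OF T A B hM mM] t]) (simp add: cmp_apply mk_mor_apply h)
      fix g assume g: "g \<in> Mor decorations T A \<and> cmp decorations T A B m g = t"
      then show "g = mk_mor T h"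
        using m T hM \<open>cmp decorations T A B m (mk_mor T h) = t\<close> by (auto simp: mono_mor_def)
    qed
  qed
  then show ?thesis using Q qM by blast
qed

text \<open>\<open>e\<close> is a cokernel of its kernel: a map \<open>t\<close> killing the kernel
  is constant on the fibres of \<open>e\<close>, so composing it with any choice of preimages is
  independent of the choice.\<close>

lemma epi_is_cokernel:
  assumes A: "A \<in> Ob decorations" and B: "B \<in> Ob decorations" and e: "epi_mor decorations A B e"
  shows "\<exists>C\<in>Ob decorations. \<exists>g\<in>Mor decorations C A. is_cokernel decorations C A B g e"
proof -
  have eM: "e \<in> Mor decorations A B" using e by (simp add: epi_mor_def)
  note surj = epi_surjective[OF A B e]
  let ?K = "kernel_object A B e" and ?i = "kernel_incl A B e"
  note K = kernel_Ob[OF A B eM] and i = kernel_incl_Mor[OF A B eM]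
  have "is_cokernel decorations ?K A B ?i e"
    unfolding is_cokernel_def
  proof (intro conjI B eM ballI impI)
    show "cmp decorations ?K A B e ?i = zero_mor decorations ?K B"
      using is_kernel_kernel[OF A B eM] by (simp add: is_kernel_def)
    fix T t assume T: "T \<in> Ob decorations" and t: "t \<in> Mor decorations A T"
      and ti: "cmp decorations ?K A T t ?i = zero_mor decorations ?K T"
    have t0: "t \<alpha> x = t \<alpha> y" if x: "\<alpha> \<in> ON" "x \<in> lev A \<alpha>" "y \<in> lev A \<alpha>" "e \<alpha> x = e \<alpha> y" for \<alpha> x y
    proof -
      interpret A: abelian_group "level A \<alpha>" by (rule level_group[OF A x(1)])
      interpret B: abelian_group "level B \<alpha>" by (rule level_group[OF B x(1)])
      interpret T: abelian_group "level T \<alpha>" by (rule level_group[OF T x(1)])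
      have d: "x \<ominus>\<^bsub>level A \<alpha>\<^esub> y \<in> lev ?K \<alpha>"
        using x Mor_closed[OF A B eM] by (simp add: A.minus_eq Mor_add[OF A B eM] Mor_minus[OF A B eM]
          B.r_neg)
      have "t \<alpha> (x \<ominus>\<^bsub>level A \<alpha>\<^esub> y) = \<zero>\<^bsub>level T \<alpha>\<^esub>"
        using ti cmp_apply[OF x(1) d] zero_apply[OF x(1) d] kernel_incl_apply[OF A B eM x(1) d] by metis
      then have "t \<alpha> x \<ominus>\<^bsub>level T \<alpha>\<^esub> t \<alpha> y = \<zero>\<^bsub>level T \<alpha>\<^esub>"
        using x by (simp add: A.minus_eq T.minus_eq Mor_add[OF A T t] Mor_minus[OF A T t])
      then show ?thesis using x Mor_closed[OF A T t] by - (rule T.eq_if_minus_eq_zero; simp)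
    qed
    define s where "s \<alpha> y = (SOME x. x \<in> lev A \<alpha> \<and> e \<alpha> x = y)" for \<alpha> y
    have s: "s \<alpha> y \<in> lev A \<alpha>" "e \<alpha> (s \<alpha> y) = y" if "\<alpha> \<in> ON" "y \<in> lev B \<alpha>" for \<alpha> y
    proof -
      have "s \<alpha> y \<in> lev A \<alpha> \<and> e \<alpha> (s \<alpha> y) = y" unfolding s_def
        using surj[OF that] by (intro someI_ex[of "\<lambda>x. x \<in> lev A \<alpha> \<and> e \<alpha> x = y"]) blast
      then show "s \<alpha> y \<in> lev A \<alpha>" "e \<alpha> (s \<alpha> y) = y" by auto
    qed
    let ?h = "\<lambda>\<alpha> y. t \<alpha> (s \<alpha> y)"
    have he: "?h \<alpha> (e \<alpha> x) = t \<alpha> x" if "\<alpha> \<in> ON" "x \<in> lev A \<alpha>" for \<alpha> x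
      by (rule t0) (use that s Mor_closed[OF A B eM] in simp_all)
    have hM: "mk_mor B ?h \<in> Mor decorations B T"
    proof (rule mk_mor_in_Mor[OF B T])
      fix \<alpha> :: 'v assume \<alpha>: "\<alpha> \<in> ON"
      interpret A: abelian_group "level A \<alpha>" by (rule level_group[OF A \<alpha>])
      show "?h \<alpha> \<in> additive_maps (level B \<alpha>) (level T \<alpha>)"
      proof (rule additive_mapsI)
        fix x y assume "x \<in> lev B \<alpha>" "y \<in> lev B \<alpha>"
        then obtain x' y' where xy: "x' \<in> lev A \<alpha>" "y' \<in> lev A \<alpha>" "x = e \<alpha> x'" "y = e \<alpha> y'"
          using surj[OF \<alpha>] by metis
        have "?h \<alpha> (e \<alpha> (x' \<oplus>\<^bsub>level A \<alpha>\<^esub> y')) = ?h \<alpha> (e \<alpha> x') \<oplus>\<^bsub>level T \<alpha>\<^esub> ?h \<alpha> (e \<alpha> y')"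
          using xy \<alpha> by (simp only: he A.a_closed Mor_add[OF A T t])
        then show "?h \<alpha> (x \<oplus>\<^bsub>level B \<alpha>\<^esub> y) = ?h \<alpha> x \<oplus>\<^bsub>level T \<alpha>\<^esub> ?h \<alpha> y"
          using xy by (simp add: Mor_add[OF A B eM \<alpha>])
      qed (use s[OF \<alpha>] Mor_closed[OF A T t \<alpha>] in simp)
    next
      fix o' x assume o: "o' \<in> operators" and x: "x \<in> lev B (source o')"
      have l: "source o' \<in> ON" "target o' \<in> ON" using operators_levels[OF o] by auto
      obtain y where y: "y \<in> lev A (source o')" "x = e (source o') y" using surj[OF l(1) x] by metis
      have "?h (target o') (e (target o') (opr A o' y)) = opr T o' (?h (source o') (e (source o') y))"
        using y l opr_closed[OF A o y(1)] by (simp only: he Mor_opr[OF A T t o])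
      then show "?h (target o') (opr B o' x) = opr T o' (?h (source o') x)"
        using y by (simp add: Mor_opr[OF A B eM o])
    qed
    show "\<exists>!h. h \<in> Mor decorations B T \<and> cmp decorations A B T h e = t"
    proof (rule ex1I[of _ "mk_mor B ?h"], intro conjI hM)
      show c: "cmp decorations A B T (mk_mor B ?h) e = t"
        by (rule Mor_eqI[OF A T cmp_Mor[OF A B T eM hM] t]) (simp add: cmp_apply mk_mor_apply he
          Mor_closed[OF A B eM])
      fix g assume g: "g \<in> Mor decorations B T \<and> cmp decorations A B T g e = t"
      then show "g = mk_mor B ?h" using e T hM c by (auto simp: epi_mor_def)
    qed
  qed
  then show ?thesis using K i by blast
qed

lemma abelian_decorations: "abelian decorations"
  unfolding abelian_def additive_def
proof (intro conjI ballI allI impI preadditive_decorations ex_zero_object)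
  fix A B assume AB: "A \<in> Ob decorations" "B \<in> Ob decorations"
  show "\<exists>P p q i j. is_biproduct decorations A B P p q i j" using ex_biproduct[OF AB] by metis
  show "\<exists>C\<in>Ob decorations. \<exists>g\<in>Mor decorations B C. is_kernel decorations A B C m g"
    if "mono_mor decorations A B m" for m by (rule mono_is_kernel[OF AB that])
  show "\<exists>C\<in>Ob decorations. \<exists>g\<in>Mor decorations C A. is_cokernel decorations C A B g e"
    if "epi_mor decorations A B e" for e by (rule epi_is_cokernel[OF AB that])
  fix f assume f: "f \<in> Mor decorations A B"
  show "\<exists>K k. is_kernel decorations K A B k f" using is_kernel_kernel[OF AB f] by blast
  show "\<exists>Q q. is_cokernel decorations A B Q f q" using ex_cokernel[OF AB f] by metis
qed

end

section \<open>Cocompleteness and exactness of filtered colimits\<close>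

text \<open>Any finite graph in a filtered category has a cocone. A common target for the vertices
  is found by joining them one at a time, and the edges are then made to commute one at a
  time.\<close>

lemma filtered_cocone:
  assumes J: "category J" and filt: "filtered J" and T: "finite T" "T \<subseteq> Ob J"
    and U: "finite U" "\<And>i j u. (i, j, u) \<in> U \<Longrightarrow> i \<in> T \<and> j \<in> T \<and> u \<in> Mor J i j"
  obtains l w where "l \<in> Ob J" "\<And>i. i \<in> T \<Longrightarrow> w i \<in> Mor J i l"
    "\<And>i j u. (i, j, u) \<in> U \<Longrightarrow> cmp J i j l (w j) u = w i"
proof -
  interpret category J by (rule J)
  have "\<exists>l\<in>Ob J. \<exists>w. \<forall>i\<in>T. w i \<in> Mor J i l"
    using T
  proof (induction T rule: finite_induct)
    case empty then show ?case using filt by (auto simp: filtered_def)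
  next
    case (insert x T)
    then obtain l w where l: "l \<in> Ob J" "\<And>i. i \<in> T \<Longrightarrow> w i \<in> Mor J i l" by auto
    have "x \<in> Ob J" using insert.prems by simp
    then obtain l' a b where l': "l' \<in> Ob J" "a \<in> Mor J l l'" "b \<in> Mor J x l'"
      using filt l(1) unfolding filtered_def by blast
    let ?w = "\<lambda>i. if i = x then b else cmp J i l l' a (w i)"
    have "\<forall>i\<in>insert x T. ?w i \<in> Mor J i l'"
      using l l' insert.prems by (auto intro: cmp_in)
    then show ?case by (intro bexI[OF _ l'(1)] exI[of _ ?w])
  qed
  moreover have "\<exists>l\<in>Ob J. \<exists>w. (\<forall>i\<in>T. w i \<in> Mor J i l) \<and> (\<forall>(i, j, u)\<in>U. cmp J i j l (w j) u = w i)"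
    if "\<exists>l\<in>Ob J. \<exists>w. \<forall>i\<in>T. w i \<in> Mor J i l"
    using U
  proof (induction U rule: finite_induct)
    case empty then show ?case using that by auto
  next
    case (insert e U)
    have "\<exists>l\<in>Ob J. \<exists>w. (\<forall>i\<in>T. w i \<in> Mor J i l) \<and> (\<forall>(i, j, u)\<in>U. cmp J i j l (w j) u = w i)"
      by (rule insert.IH) (use insert.prems in blast)
    then obtain l w where l: "l \<in> Ob J" "\<forall>i\<in>T. w i \<in> Mor J i l"
      "\<forall>(i, j, u)\<in>U. cmp J i j l (w j) u = w i" by blast
    obtain i j u where e: "e = (i, j, u)" by (cases e)
    have ij: "i \<in> T" "j \<in> T" "u \<in> Mor J i j" "i \<in> Ob J" "j \<in> Ob J" using insert.prems[of i j u] e T(2) by auto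
    have "cmp J i j l (w j) u \<in> Mor J i l" using ij l by (auto intro: cmp_in)
    then obtain l' z where z: "l' \<in> Ob J" "z \<in> Mor J l l'" "cmp J i l l' z (cmp J i j l (w j) u) =
      cmp J i l l' z (w i)"
      using filt l(1) bspec[OF l(2) ij(1)] ij(4) unfolding filtered_def by blast
    \<comment> \<open>Composing with \<open>z\<close> equalizes the new edge and preserves the
      equations already obtained.\<close>
    let ?w = "\<lambda>i. cmp J i l l' z (w i)"
    have 1: "\<forall>i\<in>T. ?w i \<in> Mor J i l'" using l z T(2) by (auto intro: cmp_in)
    have 2: "cmp J a b l' (?w b) c = ?w a" if "(a, b, c) \<in> insert e U" for a b c
    proof -
      have ab: "a \<in> T" "b \<in> T" "c \<in> Mor J a b" using insert.prems[OF that] by auto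
      have "cmp J a b l' (?w b) c = cmp J a l l' z (cmp J a b l (w b) c)"
        using cmp_assoc[of a b l l' c "w b" z] subsetD[OF T(2) ab(1)] subsetD[OF T(2) ab(2)] ab l z by auto
      also have "\<dots> = ?w a" using that l(3) e z(3) by auto
      finally show ?thesis .
    qed
    show ?case by (intro bexI[OF _ z(1)] exI[of _ ?w] conjI 1) (use 2 in blast)
  qed
  ultimately obtain l w where "l \<in> Ob J" "\<forall>i\<in>T. w i \<in> Mor J i l"
    "\<forall>(i, j, u)\<in>U. cmp J i j l (w j) u = w i" by blast
  then show thesis by (intro that[of l w]) auto
qed

context field_tower
begin

section \<open>Colimits of functors from small categories\<close>

definition arrows :: "('v, 'v) precategory \<Rightarrow> ('v \<times> 'v \<times> 'v) set" where
  "arrows J = {(i, j, u). i \<in> Ob J \<and> j \<in> Ob J \<and> u \<in> Mor J i j}"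

definition diagram_edges where
  "diagram_edges J F = (\<lambda>(i, j, u). (i, j, on_mor F i j u)) ` arrows J"

lemma diagram_edgesI:
  "i \<in> Ob J \<Longrightarrow> j \<in> Ob J \<Longrightarrow> u \<in> Mor J i j \<Longrightarrow> (i, j, on_mor F i j u) \<in> diagram_edges J F"
  by (force simp: diagram_edges_def arrows_def)

context
  fixes J :: "('v, 'v) precategory" and F
  assumes J: "small_category J" and F: "is_functor J decorations F"
begin

lemma functor_Ob: "i \<in> Ob J \<Longrightarrow> on_ob F i \<in> Ob decorations"
  using F by (simp add: is_functor_def)

lemma functor_Mor: "i \<in> Ob J \<Longrightarrow> j \<in> Ob J \<Longrightarrow> u \<in> Mor J i j \<Longrightarrow> on_mor F i j u \<in> Mor decorations (on_ob F i)
  (on_ob F j)"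
  using F by (simp add: is_functor_def)

lemma functor_cmp_apply:
  assumes "i \<in> Ob J" "j \<in> Ob J" "l \<in> Ob J" "u \<in> Mor J i j" "v \<in> Mor J j l" "\<alpha> \<in> ON" "x \<in> lev (on_ob F i) \<alpha>"
  shows "on_mor F i l (cmp J i j l v u) \<alpha> x = on_mor F j l v \<alpha> (on_mor F i j u \<alpha> x)"
proof -
  have "on_mor F i l (cmp J i j l v u) =
      cmp decorations (on_ob F i) (on_ob F j) (on_ob F l) (on_mor F j l v) (on_mor F i j u)"
    using F assms(1-5) by (simp add: is_functor_def)
  then show ?thesis using cmp_apply[OF assms(6,7)] by metis
qed

interpretation D: decorated_diagram k \<iota> "Ob J" "on_ob F" "diagram_edges J F"
  by unfold_locales (use J F in \<open>auto simp: small_category_def is_functor_def diagram_edges_def arrows_def\<close>)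

lemma is_colimit_colimit: "is_colimit J decorations F D.colimit D.inclusion"
  unfolding is_colimit_def
proof (intro conjI allI impI)
  show "is_cocone J decorations F D.colimit D.inclusion"
    unfolding is_cocone_def
    using D.colimit_Ob D.inclusion_Mor D.inclusion_edge[OF diagram_edgesI] by blast
  fix T \<mu> assume "is_cocone J decorations F T \<mu>"
  then show "\<exists>!h. h \<in> Mor decorations D.colimit T \<and> (\<forall>i\<in>Ob J. cmp decorations (on_ob F i) D.colimit T h
    (D.inclusion i) = \<mu> i)"
    by (intro D.colimit_universal) (auto simp: is_cocone_def diagram_edges_def arrows_def)
qed

text \<open>Exactness concerns arbitrary colimits, whereas elements are understood only in the
  constructed one. The comparison maps carry that information over.\<close>

lemma colimit_iso:
  assumes A: "is_colimit J decorations F A \<iota>A"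
  obtains g h where "g \<in> Mor decorations A D.colimit" "h \<in> Mor decorations D.colimit A"
    "\<And>\<alpha> x. \<alpha> \<in> ON \<Longrightarrow> x \<in> lev A \<alpha> \<Longrightarrow> h \<alpha> (g \<alpha> x) = x"
    "\<And>i \<alpha> x. i \<in> Ob J \<Longrightarrow> \<alpha> \<in> ON \<Longrightarrow> x \<in> lev (on_ob F i) \<alpha> \<Longrightarrow> g \<alpha> (\<iota>A i \<alpha> x) = D.inclusion i \<alpha> x"
    "\<And>i \<alpha> x. i \<in> Ob J \<Longrightarrow> \<alpha> \<in> ON \<Longrightarrow> x \<in> lev (on_ob F i) \<alpha> \<Longrightarrow> h \<alpha> (D.inclusion i \<alpha> x) = \<iota>A i \<alpha> x"
proof -
  note C = is_colimit_colimit
  have cA: "is_cocone J decorations F A \<iota>A" and cC: "is_cocone J decorations F D.colimit D.inclusion"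
    using A C by (simp_all add: is_colimit_def)
  have AO: "A \<in> Ob decorations" and AM: "\<And>i. i \<in> Ob J \<Longrightarrow> \<iota>A i \<in> Mor decorations (on_ob F i) A"
    using cA by (simp_all add: is_cocone_def)
  obtain g where g: "g \<in> Mor decorations A D.colimit"
    "\<And>i. i \<in> Ob J \<Longrightarrow> cmp decorations (on_ob F i) A D.colimit g (\<iota>A i) = D.inclusion i"
    using A cC unfolding is_colimit_def by blast
  obtain h where h: "h \<in> Mor decorations D.colimit A"
    "\<And>i. i \<in> Ob J \<Longrightarrow> cmp decorations (on_ob F i) D.colimit A h (D.inclusion i) = \<iota>A i"
    using C cA unfolding is_colimit_def by blast
  have gi: "g \<alpha> (\<iota>A i \<alpha> x) = D.inclusion i \<alpha> x" and hi: "h \<alpha> (D.inclusion i \<alpha> x) = \<iota>A i \<alpha> x"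
    if "i \<in> Ob J" "\<alpha> \<in> ON" "x \<in> lev (on_ob F i) \<alpha>" for i \<alpha> x
    using g(2)[OF that(1)] h(2)[OF that(1)] cmp_apply[OF that(2,3)] by metis+
  let ?hg = "cmp decorations A D.colimit A h g"
  have hg: "?hg \<in> Mor decorations A A" by (rule cmp_Mor[OF AO D.colimit_Ob AO g(1) h(1)])
  have "cmp decorations (on_ob F i) A A ?hg (\<iota>A i) = \<iota>A i" if i: "i \<in> Ob J" for i
    by (rule Mor_eqI[OF functor_Ob[OF i] AO cmp_Mor[OF functor_Ob[OF i] AO AO AM[OF i] hg] AM[OF i]])
      (simp add: cmp_apply Mor_closed[OF functor_Ob[OF i] AO AM[OF i]] gi hi i)
  moreover have "cmp decorations (on_ob F i) A A (idn decorations A) (\<iota>A i) = \<iota>A i" if i: "i \<in> Ob J" for i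
    by (rule category.cmp_idn_left[OF category_decorations functor_Ob[OF i] AO AM[OF i]])
  ultimately have "?hg = idn decorations A"
    using A cA hg idn_Mor[OF AO] unfolding is_colimit_def by blast
  then have "h \<alpha> (g \<alpha> x) = x" if "\<alpha> \<in> ON" "x \<in> lev A \<alpha>" for \<alpha> x
    using cmp_apply[OF that] idn_apply[OF that] by metis
  then show thesis using that g(1) h(1) gi hi by blast
qed

section \<open>Elements of filtered colimits\<close>

context
  assumes filt: "filtered J"
begin

text \<open>A sum of images of two stages is the image of a sum formed at a common later stage;
  induction over sums leaves a single term.\<close>

lemma filtered_colimit_represented:
  assumes A: "is_colimit J decorations F A \<iota>A" and \<alpha>: "\<alpha> \<in> ON" and x: "x \<in> lev A \<alpha>"
  shows "\<exists>i\<in>Ob J. \<exists>y\<in>lev (on_ob F i) \<alpha>. \<iota>A i \<alpha> y = x"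
proof -
  have "\<exists>i\<in>Ob J. \<exists>y\<in>lev (on_ob F i) \<alpha>. D.inclusion i \<alpha> y = c" if "c \<in> lev D.colimit \<alpha>" for c
    using that
  proof (rule D.colimit_induct[OF \<alpha>])
    obtain i where i: "i \<in> Ob J" using filt by (auto simp: filtered_def)
    then show "\<exists>i\<in>Ob J. \<exists>y\<in>lev (on_ob F i) \<alpha>. D.inclusion i \<alpha> y = \<zero>\<^bsub>level D.colimit \<alpha>\<^esub>"
      using Mor_zero[OF functor_Ob[OF i] D.colimit_Ob D.inclusion_Mor[OF i] \<alpha>]
        abelian_groupE(2)[OF level_group[OF functor_Ob[OF i] \<alpha>]] by blast
    fix i y c assume i: "i \<in> Ob J" and y: "y \<in> lev (on_ob F i) \<alpha>"
      and "\<exists>j\<in>Ob J. \<exists>z\<in>lev (on_ob F j) \<alpha>. D.inclusion j \<alpha> z = c"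
    then obtain j z where j: "j \<in> Ob J" and z: "z \<in> lev (on_ob F j) \<alpha>" "D.inclusion j \<alpha> z = c" by blast
    obtain l u v where l: "l \<in> Ob J" "u \<in> Mor J i l" "v \<in> Mor J j l"
      using filt i j unfolding filtered_def by blast
    have e: "(i, l, on_mor F i l u) \<in> diagram_edges J F" "(j, l, on_mor F j l v) \<in> diagram_edges J F"
      using i j l by (auto intro: diagram_edgesI)
    note fu = Mor_closed[OF functor_Ob[OF i] functor_Ob[OF l(1)] functor_Mor[OF i l(1,2)] \<alpha> y]
      and fv = Mor_closed[OF functor_Ob[OF j] functor_Ob[OF l(1)] functor_Mor[OF j l(1,3)] \<alpha> z(1)]
    have "D.inclusion l \<alpha> (on_mor F i l u \<alpha> y \<oplus>\<^bsub>level (on_ob F l) \<alpha>\<^esub> on_mor F j l v \<alpha> z) =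
        D.inclusion i \<alpha> y \<oplus>\<^bsub>level D.colimit \<alpha>\<^esub> c"
      using Mor_add[OF functor_Ob[OF l(1)] D.colimit_Ob D.inclusion_Mor[OF l(1)] \<alpha> fu fv]
        D.cproj_edge[OF \<alpha> e(1) y] D.cproj_edge[OF \<alpha> e(2) z(1)] z fu fv y \<alpha>
      by (simp add: D.inclusion_apply)
    then show "\<exists>l\<in>Ob J. \<exists>x\<in>lev (on_ob F l) \<alpha>. D.inclusion l \<alpha> x = D.inclusion i \<alpha> y \<oplus>\<^bsub>level D.colimit \<alpha>\<^esub> c"
      using l(1) abelian_groupE(1)[OF level_group[OF functor_Ob[OF l(1)] \<alpha>] fu fv] by blast
  qed
  moreover obtain g h where gh: "g \<in> Mor decorations A D.colimit" "h \<in> Mor decorations D.colimit A"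
    "\<And>\<alpha> x. \<alpha> \<in> ON \<Longrightarrow> x \<in> lev A \<alpha> \<Longrightarrow> h \<alpha> (g \<alpha> x) = x"
    "\<And>i \<alpha> x. i \<in> Ob J \<Longrightarrow> \<alpha> \<in> ON \<Longrightarrow> x \<in> lev (on_ob F i) \<alpha> \<Longrightarrow> h \<alpha> (D.inclusion i \<alpha> x) = \<iota>A i \<alpha> x"
    using colimit_iso[OF A] by metis
  moreover have "A \<in> Ob decorations" using A by (simp add: is_colimit_def is_cocone_def)
  ultimately have "\<exists>i\<in>Ob J. \<exists>y\<in>lev (on_ob F i) \<alpha>. D.inclusion i \<alpha> y = g \<alpha> x"
    using Mor_closed[OF _ D.colimit_Ob gh(1) \<alpha> x] by blast
  then show ?thesis using gh(3)[OF \<alpha> x] gh(4) \<alpha> by metis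
qed

text \<open>Only finitely many arrows are responsible for the vanishing. They have a cocone in
  \<open>J\<close> with some vertex \<open>l\<close>, and the maps to stage \<open>l\<close> form a
  cocone of groups over these arrows, in which \<open>x\<close> must already vanish.\<close>

lemma filtered_colimit_zeroD:
  assumes A: "is_colimit J decorations F A \<iota>A" and \<alpha>: "\<alpha> \<in> ON" and i: "i \<in> Ob J"
    and x: "x \<in> lev (on_ob F i) \<alpha>" and zero: "\<iota>A i \<alpha> x = \<zero>\<^bsub>level A \<alpha>\<^esub>"
  shows "\<exists>j\<in>Ob J. \<exists>u\<in>Mor J i j. on_mor F i j u \<alpha> x = \<zero>\<^bsub>level (on_ob F j) \<alpha>\<^esub>"
proof -
  have AO: "A \<in> Ob decorations" using A by (simp add: is_colimit_def is_cocone_def)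
  obtain g where g: "g \<in> Mor decorations A D.colimit"
    "\<And>i \<alpha> x. i \<in> Ob J \<Longrightarrow> \<alpha> \<in> ON \<Longrightarrow> x \<in> lev (on_ob F i) \<alpha> \<Longrightarrow> g \<alpha> (\<iota>A i \<alpha> x) = D.inclusion i \<alpha> x"
    using colimit_iso[OF A] by metis
  have "D.inclusion i \<alpha> x = \<zero>\<^bsub>level D.colimit \<alpha>\<^esub>"
    using g(2)[OF i \<alpha> x] Mor_zero[OF AO D.colimit_Ob g(1) \<alpha>] zero by simp
  then obtain R where R: "R \<subseteq> diagram_edges J F" "finite R"
    "\<And>N t. \<lbrakk>abelian_group N; \<And>j. j \<in> Ob J \<Longrightarrow> t j \<in> additive_maps (level (on_ob F j) \<alpha>) N;
      \<And>j l \<phi> y. (j, l, \<phi>) \<in> R \<Longrightarrow> y \<in> lev (on_ob F j) \<alpha> \<Longrightarrow> t l (\<phi> \<alpha> y) = t j y\<rbrakk> \<Longrightarrow> t i x = \<zero>\<^bsub>(N :: ('v, 'v)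
        module)\<^esub>"
    by (rule D.inclusion_eq_zeroD[OF \<alpha> i x]) blast
  obtain U where U: "U \<subseteq> arrows J" "finite U" "R = (\<lambda>(i, j, u). (i, j, on_mor F i j u)) ` U"
    using finite_subset_image[OF R(2) R(1)[unfolded diagram_edges_def]] by blast
  \<comment> \<open>The endpoints of the arrows in \<open>U\<close>, together with \<open>i\<close>,
    which might not be an endpoint.\<close>
  define T where "T = insert i (fst ` U \<union> (fst \<circ> snd) ` U)"
  have T: "finite T" "T \<subseteq> Ob J" using U i by (auto simp: T_def arrows_def)
  have UT: "a \<in> T \<and> b \<in> T \<and> u \<in> Mor J a b" if "(a, b, u) \<in> U" for a b u
    using that U(1) by (force simp: T_def arrows_def)
  have "category J" using J by (simp add: small_category_def)
  then obtain l w where l: "l \<in> Ob J" "\<And>i. i \<in> T \<Longrightarrow> w i \<in> Mor J i l"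
    "\<And>i j u. (i, j, u) \<in> U \<Longrightarrow> cmp J i j l (w j) u = w i"
    using filtered_cocone[OF _ filt T U(2) UT] by metis
  let ?N = "level (on_ob F l) \<alpha>"
  \<comment> \<open>The zero map serves at the objects outside \<open>T\<close>; no edge of
    \<open>R\<close> meets them.\<close>
  let ?t = "\<lambda>j. if j \<in> T then on_mor F j l (w j) \<alpha> else (\<lambda>_. \<zero>\<^bsub>?N\<^esub>)"
  have "?t i x = \<zero>\<^bsub>?N\<^esub>"
  proof (rule R(3)[OF level_group[OF functor_Ob[OF l(1)] \<alpha>]])
    show "?t j \<in> additive_maps (level (on_ob F j) \<alpha>) ?N" if "j \<in> Ob J" for j
      using that l \<alpha> by (auto intro: Mor_additive functor_Ob functor_Mor zero_additive_maps level_group)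
    fix a b \<phi> y assume r: "(a, b, \<phi>) \<in> R" and y: "y \<in> lev (on_ob F a) \<alpha>"
    then obtain u where u: "(a, b, u) \<in> U" "\<phi> = on_mor F a b u" using U(3) by auto
    have ab: "a \<in> T" "b \<in> T" "u \<in> Mor J a b" using UT[OF u(1)] by auto
    have "on_mor F b l (w b) \<alpha> (on_mor F a b u \<alpha> y) = on_mor F a l (cmp J a b l (w b) u) \<alpha> y"
      by (rule functor_cmp_apply[symmetric]) (use ab T(2) l(1,2) \<alpha> y in auto)
    then show "?t b (\<phi> \<alpha> y) = ?t a y" using ab u l(3)[OF u(1)] by simp
  qed
  moreover have "i \<in> T" by (simp add: T_def)
  ultimately show ?thesis using l(1) l(2)[of i] by auto
qed

end

end

lemma cocomplete_decorations: "cocomplete TYPE('v) decorations"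
  unfolding cocomplete_def using is_colimit_colimit by blast

section \<open>Exactness of filtered colimits\<close>

lemma cokernel_epi:
  assumes B: "B \<in> Ob decorations" and f: "f \<in> Mor decorations A B" and A: "A \<in> Ob decorations"
    and q: "is_cokernel decorations A B Q f q"
  shows "epi_mor decorations B Q q"
  unfolding epi_mor_def
proof (intro conjI ballI impI)
  have Q: "Q \<in> Ob decorations" and qM: "q \<in> Mor decorations B Q"
    and qf: "cmp decorations A B Q q f = zero_mor decorations A Q" using q by (auto simp: is_cokernel_def)
  show "q \<in> Mor decorations B Q" by fact
  fix T g h assume T: "T \<in> Ob decorations" and gh: "g \<in> Mor decorations Q T" "h \<in> Mor decorations Q T"
    and eq: "cmp decorations B Q T g q = cmp decorations B Q T h q"
  let ?t = "cmp decorations B Q T g q"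
  have t: "?t \<in> Mor decorations B T" by (rule cmp_Mor[OF B Q T qM gh(1)])
  have "cmp decorations A B T ?t f = zero_mor decorations A T"
  proof (rule Mor_eqI[OF A T cmp_Mor[OF A B T f t] zero_Mor[OF A T]])
    fix \<alpha> x assume x: "\<alpha> \<in> ON" "x \<in> lev A \<alpha>"
    have "q \<alpha> (f \<alpha> x) = \<zero>\<^bsub>level Q \<alpha>\<^esub>" using qf cmp_apply[OF x] zero_apply[OF x] by metis
    then show "cmp decorations A B T ?t f \<alpha> x = zero_mor decorations A T \<alpha> x"
      using x Mor_closed[OF A B f x] Mor_zero[OF Q T gh(1)] by (simp add: cmp_apply zero_apply)
  qed
  then have "\<exists>!h. h \<in> Mor decorations Q T \<and> cmp decorations B Q T h q = ?t"
    using q T t by (auto simp: is_cokernel_def)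
  then show "g = h" using gh eq by auto
qed

lemma kernel_mono:
  assumes A: "A \<in> Ob decorations" and f: "f \<in> Mor decorations A B" and B: "B \<in> Ob decorations"
    and m: "is_kernel decorations K A B m f"
  shows "mono_mor decorations K A m"
  unfolding mono_mor_def
proof (intro conjI ballI impI)
  have K: "K \<in> Ob decorations" and mM: "m \<in> Mor decorations K A"
    and fm: "cmp decorations K A B f m = zero_mor decorations K B" using m by (auto simp: is_kernel_def)
  show "m \<in> Mor decorations K A" by fact
  fix T g h assume T: "T \<in> Ob decorations" and gh: "g \<in> Mor decorations T K" "h \<in> Mor decorations T K"
    and eq: "cmp decorations T K A m g = cmp decorations T K A m h"
  let ?t = "cmp decorations T K A m g"
  have t: "?t \<in> Mor decorations T A" by (rule cmp_Mor[OF T K A gh(1) mM])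
  have "cmp decorations T A B f ?t = zero_mor decorations T B"
  proof (rule Mor_eqI[OF T B cmp_Mor[OF T A B t f] zero_Mor[OF T B]])
    fix \<alpha> x assume x: "\<alpha> \<in> ON" "x \<in> lev T \<alpha>"
    note gx = Mor_closed[OF T K gh(1) x]
    have "f \<alpha> (m \<alpha> (g \<alpha> x)) = \<zero>\<^bsub>level B \<alpha>\<^esub>" using fm cmp_apply[OF x(1) gx] zero_apply[OF x(1) gx] by metis
    then show "cmp decorations T A B f ?t \<alpha> x = zero_mor decorations T B \<alpha> x"
      using x by (simp add: cmp_apply zero_apply)
  qed
  then have "\<exists>!h. h \<in> Mor decorations T K \<and> cmp decorations T K A m h = ?t"
    using m T t by (auto simp: is_kernel_def)
  then show "g = h" using gh eq by auto
qed

text \<open>An element killed by \<open>u\<close> comes from a stage, is killed by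
  \<open>\<eta>\<close> at a later stage, and vanishes there by injectivity; so \<open>u\<close> is
  a monomorphism. The cokernel property of \<open>v\<close> is assembled from the stages, and the
  kernel property then follows in the abelian category.\<close>

lemma exact_filtered_colimits_decorations: "exact_filtered_colimits TYPE('v) decorations"
  unfolding exact_filtered_colimits_def
proof (intro allI impI, elim conjE)
  fix J :: "('v, 'v) precategory" and F G H \<eta> \<theta> A B C \<iota>A \<iota>B \<iota>C u v
  assume J: "small_category J" and filt: "filtered J"
    and F: "is_functor J decorations F" and G: "is_functor J decorations G"
      and H: "is_functor J decorations H"
    and \<eta>: "is_nat_trans J decorations F G \<eta>" and \<theta>: "is_nat_trans J decorations G H \<theta>"
    and ses: "\<forall>i\<in>Ob J. short_exact decorations (on_ob F i) (on_ob G i) (on_ob H i) (\<eta> i) (\<theta> i)"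
    and A: "is_colimit J decorations F A \<iota>A" and B: "is_colimit J decorations G B \<iota>B"
      and C: "is_colimit J decorations H C \<iota>C"
    and u: "u \<in> Mor decorations A B" and v: "v \<in> Mor decorations B C"
    and uA: "\<forall>i\<in>Ob J. cmp decorations (on_ob F i) A B u (\<iota>A i) = cmp decorations (on_ob F i) (on_ob G i)
      B (\<iota>B i) (\<eta> i)"
    and vB: "\<forall>i\<in>Ob J. cmp decorations (on_ob G i) B C v (\<iota>B i) = cmp decorations (on_ob G i) (on_ob H i)
      C (\<iota>C i) (\<theta> i)"
  note FO = functor_Ob[OF J F] and GO = functor_Ob[OF J G] and HO = functor_Ob[OF J H]
  have AO: "A \<in> Ob decorations" and BO: "B \<in> Ob decorations" and CO: "C \<in> Ob decorations"
    using A B C by (simp_all add: is_colimit_def is_cocone_def)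
  have \<iota>AM: "\<iota>A i \<in> Mor decorations (on_ob F i) A" and \<iota>BM: "\<iota>B i \<in> Mor decorations (on_ob G i) B"
    and \<iota>CM: "\<iota>C i \<in> Mor decorations (on_ob H i) C" if "i \<in> Ob J" for i
    using A B C that by (simp_all add: is_colimit_def is_cocone_def)
  have \<eta>M: "\<eta> i \<in> Mor decorations (on_ob F i) (on_ob G i)" and \<theta>M: "\<theta> i \<in> Mor decorations (on_ob G i)
    (on_ob H i)"
    and ker: "is_kernel decorations (on_ob F i) (on_ob G i) (on_ob H i) (\<eta> i) (\<theta> i)"
    and coker: "is_cokernel decorations (on_ob F i) (on_ob G i) (on_ob H i) (\<eta> i) (\<theta> i)" if "i \<in> Ob J" for i
    using ses that by (simp_all add: short_exact_def)
  have u_apply: "u \<alpha> (\<iota>A i \<alpha> x) = \<iota>B i \<alpha> (\<eta> i \<alpha> x)" if "i \<in> Ob J" "\<alpha> \<in> ON" "x \<in> lev (on_ob F i) \<alpha>" for i \<alpha> x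
    using uA that(1) cmp_apply[OF that(2,3)] by metis
  have v_apply: "v \<alpha> (\<iota>B i \<alpha> x) = \<iota>C i \<alpha> (\<theta> i \<alpha> x)" if "i \<in> Ob J" "\<alpha> \<in> ON" "x \<in> lev (on_ob G i) \<alpha>" for i \<alpha> x
    using vB that(1) cmp_apply[OF that(2,3)] by metis
  have \<theta>\<eta>: "\<theta> i \<alpha> (\<eta> i \<alpha> x) = \<zero>\<^bsub>level (on_ob H i) \<alpha>\<^esub>" if "i \<in> Ob J" "\<alpha> \<in> ON" "x \<in> lev (on_ob F i) \<alpha>" for i \<alpha> x
    using ker[OF that(1)] cmp_apply[OF that(2,3)] zero_apply[OF that(2,3)] unfolding is_kernel_def by metis
  note reprA = filtered_colimit_represented[OF J F filt A] and reprB = filtered_colimit_represented[OF J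
    G filt B]
    and reprC = filtered_colimit_represented[OF J H filt C]
  have \<theta>_surj: "\<exists>x\<in>lev (on_ob G i) \<alpha>. \<theta> i \<alpha> x = y" if "i \<in> Ob J" "\<alpha> \<in> ON" "y \<in> lev (on_ob H i) \<alpha>" for i \<alpha> y
    using epi_surjective[OF GO[OF that(1)] HO[OF that(1)] cokernel_epi[OF GO[OF that(1)] \<eta>M[OF that(1)]
      FO[OF that(1)] coker[OF that(1)]] that(2,3)] .
  have v_surj: "\<exists>i\<in>Ob J. \<exists>y\<in>lev (on_ob G i) \<alpha>. v \<alpha> (\<iota>B i \<alpha> y) = x \<and> \<iota>C i \<alpha> (\<theta> i \<alpha> y) = x"
    if "\<alpha> \<in> ON" "x \<in> lev C \<alpha>" for \<alpha> x
    using reprC[OF that] \<theta>_surj v_apply that(1) by metis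
  have \<eta>_inj: "x = \<zero>\<^bsub>level (on_ob F i) \<alpha>\<^esub>"
    if "i \<in> Ob J" "\<alpha> \<in> ON" "x \<in> lev (on_ob F i) \<alpha>" "\<eta> i \<alpha> x = \<zero>\<^bsub>level (on_ob G i) \<alpha>\<^esub>" for i \<alpha> x
    using mono_injective[OF FO[OF that(1)] GO[OF that(1)] kernel_mono[OF GO[OF that(1)] \<theta>M[OF that(1)]
      HO[OF that(1)] ker[OF that(1)]] that(2-4)] .
  have u_inj: "x = \<zero>\<^bsub>level A \<alpha>\<^esub>" if \<alpha>: "\<alpha> \<in> ON" and x: "x \<in> lev A \<alpha>" "u \<alpha> x = \<zero>\<^bsub>level B \<alpha>\<^esub>" for \<alpha> x
  proof -
    obtain i y where i: "i \<in> Ob J" and y: "y \<in> lev (on_ob F i) \<alpha>" "\<iota>A i \<alpha> y = x" using reprA[OF \<alpha> x(1)]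
      by blast
    have "\<iota>B i \<alpha> (\<eta> i \<alpha> y) = \<zero>\<^bsub>level B \<alpha>\<^esub>" using u_apply[OF i \<alpha> y(1)] x(2) y(2) by simp
    then obtain j w where j: "j \<in> Ob J" "w \<in> Mor J i j" "on_mor G i j w \<alpha> (\<eta> i \<alpha> y) = \<zero>\<^bsub>level (on_ob G j) \<alpha>\<^esub>"
      using filtered_colimit_zeroD[OF J G filt B \<alpha> i Mor_closed[OF FO[OF i] GO[OF i] \<eta>M[OF i] \<alpha> y(1)]]
        by blast
    have "cmp decorations (on_ob F i) (on_ob F j) (on_ob G j) (\<eta> j) (on_mor F i j w) =
      cmp decorations (on_ob F i) (on_ob G i) (on_ob G j) (on_mor G i j w) (\<eta> i)"
      using \<eta> i j by (simp add: is_nat_trans_def)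
    then have "\<eta> j \<alpha> (on_mor F i j w \<alpha> y) = \<zero>\<^bsub>level (on_ob G j) \<alpha>\<^esub>"
      using cmp_apply[OF \<alpha> y(1)] j(3) by metis
    then have "on_mor F i j w \<alpha> y = \<zero>\<^bsub>level (on_ob F j) \<alpha>\<^esub>"
      by (rule \<eta>_inj[OF j(1) \<alpha> Mor_closed[OF FO[OF i] FO[OF j(1)] functor_Mor[OF J F i j(1,2)] \<alpha> y(1)]])
    moreover have "cmp decorations (on_ob F i) (on_ob F j) A (\<iota>A j) (on_mor F i j w) = \<iota>A i"
      using A i j by (simp add: is_colimit_def is_cocone_def)
    ultimately have "\<iota>A i \<alpha> y = \<zero>\<^bsub>level A \<alpha>\<^esub>"
      using cmp_apply[OF \<alpha> y(1)] Mor_zero[OF FO[OF j(1)] AO \<iota>AM[OF j(1)] \<alpha>] by metis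
    then show ?thesis using y(2) by simp
  qed
  have u_mono: "mono_mor decorations A B u" by (rule injective_mono[OF AO BO u u_inj])
  have vu: "cmp decorations A B C v u = zero_mor decorations A C"
  proof (rule Mor_eqI[OF AO CO cmp_Mor[OF AO BO CO u v] zero_Mor[OF AO CO]])
    fix \<alpha> x assume x: "\<alpha> \<in> ON" "x \<in> lev A \<alpha>"
    obtain i y where i: "i \<in> Ob J" and y: "y \<in> lev (on_ob F i) \<alpha>" "\<iota>A i \<alpha> y = x" using reprA[OF x] by blast
    have "v \<alpha> (u \<alpha> (\<iota>A i \<alpha> y)) = \<zero>\<^bsub>level C \<alpha>\<^esub>"
      using u_apply[OF i x(1) y(1)] v_apply[OF i x(1) Mor_closed[OF FO[OF i] GO[OF i] \<eta>M[OF i] x(1) y(1)]]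
        \<theta>\<eta>[OF i x(1) y(1)] Mor_zero[OF HO[OF i] CO \<iota>CM[OF i] x(1)] by simp
    then show "cmp decorations A B C v u \<alpha> x = zero_mor decorations A C \<alpha> x"
      using x y(2) by (simp add: cmp_apply zero_apply)
  qed
  have v_coker: "is_cokernel decorations A B C u v"
    unfolding is_cokernel_def
  proof (intro conjI CO v vu ballI impI)
    fix T t assume T: "T \<in> Ob decorations" and t: "t \<in> Mor decorations B T"
      and tu: "cmp decorations A B T t u = zero_mor decorations A T"
    have tu_apply: "t \<alpha> (u \<alpha> x) = \<zero>\<^bsub>level T \<alpha>\<^esub>" if "\<alpha> \<in> ON" "x \<in> lev A \<alpha>" for \<alpha> x
      using tu cmp_apply[OF that] zero_apply[OF that] by metis
    \<comment> \<open>\<open>t\<close> kills the image of \<open>u\<close>, so at each stage it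
      factors through the cokernel \<open>\<theta> i\<close>. Surjectivity of
      \<open>\<theta> i\<close> makes these factors a cocone on \<open>H\<close>.\<close>
    have "\<exists>g. g \<in> Mor decorations (on_ob H i) T \<and>
        cmp decorations (on_ob G i) (on_ob H i) T g (\<theta> i) = cmp decorations (on_ob G i) B T t (\<iota>B i)"
          if i: "i \<in> Ob J" for i
    proof -
      let ?t = "cmp decorations (on_ob G i) B T t (\<iota>B i)"
      have t': "?t \<in> Mor decorations (on_ob G i) T" by (rule cmp_Mor[OF GO[OF i] BO T \<iota>BM[OF i] t])
      have "cmp decorations (on_ob F i) (on_ob G i) T ?t (\<eta> i) = zero_mor decorations (on_ob F i) T"
        by (rule Mor_eqI[OF FO[OF i] T cmp_Mor[OF FO[OF i] GO[OF i] T \<eta>M[OF i] t'] zero_Mor[OF FO[OF i] T]])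
          (simp add: cmp_apply zero_apply Mor_closed[OF FO[OF i] GO[OF i] \<eta>M[OF i]] u_apply[OF i,
            symmetric] tu_apply
             Mor_closed[OF FO[OF i] AO \<iota>AM[OF i]])
      then show ?thesis using coker[OF i] T t' unfolding is_cokernel_def by blast
    qed
    then obtain g where g: "\<And>i. i \<in> Ob J \<Longrightarrow> g i \<in> Mor decorations (on_ob H i) T"
      and g': "\<And>i. i \<in> Ob J \<Longrightarrow> cmp decorations (on_ob G i) (on_ob H i) T (g i) (\<theta> i) = cmp decorations
        (on_ob G i) B T t (\<iota>B i)"
      by metis
    have g_apply: "g i \<alpha> (\<theta> i \<alpha> x) = t \<alpha> (\<iota>B i \<alpha> x)" if "i \<in> Ob J" "\<alpha> \<in> ON" "x \<in> lev (on_ob G i) \<alpha>" for i \<alpha> x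
      using g'[OF that(1)] cmp_apply[OF that(2,3)] by metis
    have "is_cocone J decorations H T g"
      unfolding is_cocone_def
    proof (intro conjI T ballI g)
      fix i j w assume i: "i \<in> Ob J" and j: "j \<in> Ob J" and w: "w \<in> Mor J i j"
      note HM = functor_Mor[OF J H i j w] and GM = functor_Mor[OF J G i j w]
      show "cmp decorations (on_ob H i) (on_ob H j) T (g j) (on_mor H i j w) = g i"
      proof (rule Mor_eqI[OF HO[OF i] T cmp_Mor[OF HO[OF i] HO[OF j] T HM g[OF j]] g[OF i]])
        fix \<alpha> x assume x: "\<alpha> \<in> ON" "x \<in> lev (on_ob H i) \<alpha>"
        obtain y where y: "y \<in> lev (on_ob G i) \<alpha>" "\<theta> i \<alpha> y = x" using \<theta>_surj[OF i x] by blast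
        have "cmp decorations (on_ob G i) (on_ob G j) (on_ob H j) (\<theta> j) (on_mor G i j w) =
          cmp decorations (on_ob G i) (on_ob H i) (on_ob H j) (on_mor H i j w) (\<theta> i)"
          using \<theta> i j w by (simp add: is_nat_trans_def)
        then have 1: "on_mor H i j w \<alpha> (\<theta> i \<alpha> y) = \<theta> j \<alpha> (on_mor G i j w \<alpha> y)"
          using cmp_apply[OF x(1) y(1)] by metis
        have "cmp decorations (on_ob G i) (on_ob G j) B (\<iota>B j) (on_mor G i j w) = \<iota>B i"
          using B i j w by (simp add: is_colimit_def is_cocone_def)
        then have 2: "\<iota>B j \<alpha> (on_mor G i j w \<alpha> y) = \<iota>B i \<alpha> y" using cmp_apply[OF x(1) y(1)] by metis
        have "g j \<alpha> (on_mor H i j w \<alpha> x) = g i \<alpha> x"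
          using 1 2 y g_apply[OF i x(1) y(1)] g_apply[OF j x(1) Mor_closed[OF GO[OF i] GO[OF j]
            GM x(1) y(1)]] by simp
        then show "cmp decorations (on_ob H i) (on_ob H j) T (g j) (on_mor H i j w) \<alpha> x = g i \<alpha> x"
          using cmp_apply[OF x] by simp
      qed
    qed
    then obtain h where h: "h \<in> Mor decorations C T"
      and h': "\<And>i. i \<in> Ob J \<Longrightarrow> cmp decorations (on_ob H i) C T h (\<iota>C i) = g i"
      using C unfolding is_colimit_def by blast
    show "\<exists>!h. h \<in> Mor decorations C T \<and> cmp decorations B C T h v = t"
    proof (rule ex1I[of _ h], intro conjI h)
      show hv: "cmp decorations B C T h v = t"
      proof (rule Mor_eqI[OF BO T cmp_Mor[OF BO CO T v h] t])
        fix \<alpha> x assume x: "\<alpha> \<in> ON" "x \<in> lev B \<alpha>"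
        obtain i y where i: "i \<in> Ob J" and y: "y \<in> lev (on_ob G i) \<alpha>" "\<iota>B i \<alpha> y = x" using reprB[OF x]
          by blast
        have "h \<alpha> (\<iota>C i \<alpha> (\<theta> i \<alpha> y)) = g i \<alpha> (\<theta> i \<alpha> y)"
          using h'[OF i] cmp_apply[OF x(1) Mor_closed[OF GO[OF i] HO[OF i] \<theta>M[OF i] x(1) y(1)]] by metis
        then have "h \<alpha> (v \<alpha> x) = t \<alpha> x" using v_apply[OF i x(1) y(1)] g_apply[OF i x(1) y(1)] y(2) by simp
        then show "cmp decorations B C T h v \<alpha> x = t \<alpha> x" using cmp_apply[OF x] by simp
      qed
      fix h2 assume h2: "h2 \<in> Mor decorations C T \<and> cmp decorations B C T h2 v = t"
      show "h2 = h"
      proof (rule Mor_eqI[OF CO T _ h])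
        fix \<alpha> x assume x: "\<alpha> \<in> ON" "x \<in> lev C \<alpha>"
        obtain i y where i: "i \<in> Ob J" and y: "y \<in> lev (on_ob G i) \<alpha>" "v \<alpha> (\<iota>B i \<alpha> y) = x"
          using v_surj[OF x] by blast
        note b = Mor_closed[OF GO[OF i] BO \<iota>BM[OF i] x(1) y(1)]
        have "h2 \<alpha> (v \<alpha> (\<iota>B i \<alpha> y)) = h \<alpha> (v \<alpha> (\<iota>B i \<alpha> y))" using h2 hv cmp_apply[OF x(1) b] by metis
        then show "h2 \<alpha> x = h \<alpha> x" using y(2) by simp
      qed (use h2 in simp)
    qed
  qed
  \<comment> \<open>The monomorphism \<open>u\<close> is a kernel of some \<open>g\<close>. As
    \<open>g\<close> kills \<open>u\<close>, it factors through the cokernel \<open>v\<close>, so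
    whatever \<open>v\<close> kills is killed by \<open>g\<close> and lifts along
    \<open>u\<close>.\<close>
  obtain K g where K: "K \<in> Ob decorations" and g: "g \<in> Mor decorations B K"
    and gker: "is_kernel decorations A B K u g"
    using mono_is_kernel[OF AO BO u_mono] by blast
  have "is_kernel decorations A B C u v"
    unfolding is_kernel_def
  proof (intro conjI AO u vu ballI impI)
    fix T t assume T: "T \<in> Ob decorations" and t: "t \<in> Mor decorations T B"
      and vt: "cmp decorations T B C v t = zero_mor decorations T C"
    obtain h where h: "h \<in> Mor decorations C K" "cmp decorations B C K h v = g"
      using v_coker K g gker unfolding is_cokernel_def is_kernel_def by blast
    have "cmp decorations T B K g t = zero_mor decorations T K"
    proof (rule Mor_eqI[OF T K cmp_Mor[OF T BO K t g] zero_Mor[OF T K]])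
      fix \<alpha> x assume x: "\<alpha> \<in> ON" "x \<in> lev T \<alpha>"
      have "g \<alpha> (t \<alpha> x) = h \<alpha> (v \<alpha> (t \<alpha> x))" using h(2) cmp_apply[OF x(1) Mor_closed[OF T BO t x]] by metis
      also have "\<dots> = \<zero>\<^bsub>level K \<alpha>\<^esub>"
        using vt cmp_apply[OF x] zero_apply[OF x] Mor_zero[OF CO K h(1) x(1)] by metis
      finally show "cmp decorations T B K g t \<alpha> x = zero_mor decorations T K \<alpha> x"
        using x by (simp add: cmp_apply zero_apply)
    qed
    then show "\<exists>!h. h \<in> Mor decorations T A \<and> cmp decorations T A B u h = t"
      using gker T t unfolding is_kernel_def by blast
  qed
  then show "short_exact decorations A B C u v"
    using AO BO CO u v v_coker by (simp add: short_exact_def)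
qed

end

section \<open>Projective and injective objects\<close>

context field_tower
begin

text \<open>The doubled object \<open>P \<oplus> P\<close> on which a fresh label acts as the nilpotent
  \<open>(x, y) \<mapsto> (0, x)\<close>, i.e. \<open>P \<otimes> k[t]/(t\<^sup>2)\<close>.\<close>

lemma doubling:
  assumes P: "P \<in> Ob decorations"
  obtains P' t p j where "P' \<in> Ob decorations" "t \<notin> labels P"
    "p \<in> Mor decorations P' P" "\<And>\<alpha> x. \<alpha> \<in> ON \<Longrightarrow> x \<in> lev P \<alpha> \<Longrightarrow> \<exists>y\<in>lev P' \<alpha>. p \<alpha> y = x"
    "j \<in> Mor decorations P P'" "\<And>\<alpha> x. \<alpha> \<in> ON \<Longrightarrow> x \<in> lev P \<alpha> \<Longrightarrow> j \<alpha> x = \<zero>\<^bsub>level P' \<alpha>\<^esub> \<Longrightarrow> x = \<zero>\<^bsub>level P \<alpha>\<^esub>"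
    "\<And>\<alpha> x. \<alpha> \<in> ON \<Longrightarrow> x \<in> lev P' \<alpha> \<Longrightarrow> opr P' (Label t \<alpha>) x = j \<alpha> (p \<alpha> x)"
proof -
  obtain B p q i j where bi: "is_biproduct decorations P P B p q i j"
    and pj: "cmp decorations P B P p j = zero_mor decorations P P"
    using ex_biproduct[OF P P] by metis
  have B: "B \<in> Ob decorations" and p: "p \<in> Mor decorations B P" and q: "q \<in> Mor decorations B P"
    and i: "i \<in> Mor decorations P B" and j: "j \<in> Mor decorations P B"
    and pi: "cmp decorations P B P p i = idn decorations P" and qj: "cmp decorations P B P q j =
      idn decorations P"
    using bi by (auto simp: is_biproduct_def)
  have pi_apply: "p \<alpha> (i \<alpha> x) = x" and qj_apply: "q \<alpha> (j \<alpha> x) = x" and pj_apply: "p \<alpha> (j \<alpha> x) = \<zero>\<^bsub>level P \<alpha>\<^esub>"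
    if "\<alpha> \<in> ON" "x \<in> lev P \<alpha>" for \<alpha> x
    using pi qj pj cmp_apply[OF that] idn_apply[OF that] zero_apply[OF that] by metis+
  interpret O: operator_structure k \<iota> "level B" "opr B" "labels B" by (rule operator_structure_opr[OF B])
  have "small (labels B \<union> labels P)"
    by (intro small_Un O.small_labels operator_structure.small_labels[OF operator_structure_opr[OF P]])
  \<comment> \<open>\<open>t\<close> avoids \<open>labels B\<close>, so no given action is
    overwritten, and \<open>labels P\<close>, so it acts by zero on \<open>P\<close>.\<close>
  then obtain t where t: "t \<notin> labels B" "t \<notin> labels P" using ex_notin_small by blast
  define act where "act = (\<lambda>o'. case o' of Label s \<alpha> \<Rightarrow> if s = t then (\<lambda>x. j \<alpha> (p \<alpha> x)) else opr B o' | _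
    \<Rightarrow> opr B o')"
  have act: "act (Scalar \<alpha> a) = opr B (Scalar \<alpha> a)" "act (Transition \<beta> \<alpha>) = opr B (Transition \<beta> \<alpha>)"
    "act (Label s \<alpha>) = (if s = t then (\<lambda>x. j \<alpha> (p \<alpha> x)) else opr B (Label s \<alpha>))" for \<alpha> \<beta> a s
    by (simp_all add: act_def)
  note pc = Mor_closed[OF B P p] and jc = Mor_closed[OF P B j]
  have jp_opr: "j (target o') (p (target o') (opr B o' x)) = opr B o' (j (source o') (p (source o') x))"
    if "o' \<in> operators" "x \<in> lev B (source o')" for o' x
    using that operators_levels[OF that(1)] by (simp add: Mor_opr[OF B P p] Mor_opr[OF P B j] pc)
  interpret O': operator_structure k \<iota> "level B" act "insert t (labels B)"
  proof (intro operator_structure.intro operator_structure_axioms.intro, goal_cases)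
    case (5 o')
    show ?case
    proof (cases o')
      case (Label s \<alpha>)
      then show ?thesis
        using 5 additive_maps_comp[OF Mor_additive[OF B P p] Mor_additive[OF P B j]] O.act_additive[OF 5]
        by (auto simp: act simp del: opr.simps)
    qed (use O.act_additive[OF 5] in \<open>simp_all add: act del: opr.simps\<close>)
  next
    case (12 \<alpha> a x s) then show ?case using jp_opr[of "Scalar \<alpha> a" x]
      by (simp add: act O.label_scalar del: opr.simps)
  next
    case (13 \<alpha> \<beta> x s) then show ?case using jp_opr[of "Transition \<beta> \<alpha>" x]
      by (simp add: act O.label_transition del: opr.simps)
  next
    case 15 show ?case using O.grounded by (simp add: act lincomb_def del: opr.simps)
  qed (simp_all add: act field_tower_axioms O.group O.small_group O.small_labels small_insert
    O.scalar_add O.scalar_mult O.scalar_one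
      O.transition_id O.transition_comp O.transition_scalar O.label_zero del: opr.simps)
  let ?P' = "mk_decorated (level B) act (insert t (labels B))"
  have opr: "opr ?P' o' x = act o' x" if "o' \<in> operators" "x \<in> lev B (source o')" for o' x
    using O'.opr_mk_decorated that .
  have "mk_mor ?P' p \<in> Mor decorations ?P' P"
  proof (rule mk_mor_in_Mor[OF O'.mk_decorated_in_Ob P])
    fix o' x assume o: "o' \<in> operators" "x \<in> lev ?P' (source o')"
    then have l: "source o' \<in> ON" "x \<in> lev B (source o')" using operators_levels by auto
    show "p (target o') (opr ?P' o' x) = opr P o' (p (source o') x)"
      \<comment> \<open>For the new label both sides vanish: on the left because \<open>p\<close>
        kills the image of \<open>j\<close>, on the right because \<open>t\<close> is absent from
        \<open>P\<close>.\<close>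
      using opr[OF o(1) l(2)] Mor_opr[OF B P p o(1) l(2)] pj_apply[OF l(1) pc[OF l]] t(2)
        by (cases o') (auto simp: act)
  qed (simp add: Mor_additive[OF B P p])
  moreover have "\<exists>y\<in>lev ?P' \<alpha>. mk_mor ?P' p \<alpha> y = x" if "\<alpha> \<in> ON" "x \<in> lev P \<alpha>" for \<alpha> x
    using that Mor_closed[OF P B i that] by (intro bexI[of _ "i \<alpha> x"]) (auto simp: mk_mor_apply pi_apply)
  moreover have "mk_mor P j \<in> Mor decorations P ?P'"
  proof (rule mk_mor_in_Mor[OF P O'.mk_decorated_in_Ob])
    fix o' x assume o: "o' \<in> operators" "x \<in> lev P (source o')"
    then have l: "source o' \<in> ON" using operators_levels by auto
    show "j (target o') (opr P o' x) = opr ?P' o' (j (source o') x)"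
      \<comment> \<open>For the new label the right side applies \<open>j\<close> after
        \<open>p\<close> to an element of the image of \<open>j\<close>, which gives zero; so does
        the absent label on \<open>P\<close>.\<close>
      using opr[OF o(1) jc[OF l o(2)]] Mor_opr[OF P B j o] pj_apply[OF l o(2)] t(2)
        Mor_zero[OF P B j l] by (cases o') (auto simp: act)
  qed (simp add: Mor_additive[OF P B j])
  moreover have "x = \<zero>\<^bsub>level P \<alpha>\<^esub>" if "\<alpha> \<in> ON" "x \<in> lev P \<alpha>" "mk_mor P j \<alpha> x = \<zero>\<^bsub>level ?P' \<alpha>\<^esub>" for \<alpha> x
    using that qj_apply[OF that(1,2)] Mor_zero[OF B P q that(1)] by (simp add: mk_mor_apply)
  moreover have "opr ?P' (Label t \<alpha>) x = mk_mor P j \<alpha> (mk_mor ?P' p \<alpha> x)" if "\<alpha> \<in> ON" "x \<in> lev ?P' \<alpha>" for \<alpha> x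
    using opr[of "Label t \<alpha>" x] that pc by (simp add: act mk_mor_apply)
  ultimately show thesis using that[OF O'.mk_decorated_in_Ob t(2)] by blast
qed

text \<open>A section \<open>g\<close> of \<open>p\<close> would commute with the new label
  \<open>t\<close>: \<open>j x\<close> is \<open>t\<close> acting on \<open>g x\<close>, hence
  \<open>g\<close> applied to \<open>t\<close> acting on \<open>x\<close>, and the latter is zero in
  \<open>P\<close>. Since \<open>j\<close> is injective, \<open>x\<close> is zero.\<close>

lemma projective_zero:
  assumes "projective_object decorations P" shows "zero_object decorations P"
proof -
  have P: "P \<in> Ob decorations" using assms by (simp add: projective_object_def)
  obtain P' t p j where P': "P' \<in> Ob decorations" and t: "t \<notin> labels P"
    and p: "p \<in> Mor decorations P' P" "\<And>\<alpha> x. \<alpha> \<in> ON \<Longrightarrow> x \<in> lev P \<alpha> \<Longrightarrow> \<exists>y\<in>lev P' \<alpha>. p \<alpha> y = x"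
    and "j \<in> Mor decorations P P'" and j: "\<And>\<alpha> x. \<alpha> \<in> ON \<Longrightarrow> x \<in> lev P \<alpha> \<Longrightarrow> j \<alpha> x = \<zero>\<^bsub>level P' \<alpha>\<^esub> \<Longrightarrow>
      x = \<zero>\<^bsub>level P \<alpha>\<^esub>"
    and opr: "\<And>\<alpha> x. \<alpha> \<in> ON \<Longrightarrow> x \<in> lev P' \<alpha> \<Longrightarrow> opr P' (Label t \<alpha>) x = j \<alpha> (p \<alpha> x)"
    by (rule doubling[OF P], rule that)
  have "epi_mor decorations P' P p" by (rule surjective_epi[OF P' P p])
  then obtain g where g: "g \<in> Mor decorations P P'" "cmp decorations P P' P p g = idn decorations P"
    using assms P P' idn_Mor[OF P] unfolding projective_object_def by blast
  show ?thesis
  proof (rule zero_objectI[OF P])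
    fix \<alpha> x assume x: "\<alpha> \<in> ON" "x \<in> lev P \<alpha>"
    have "p \<alpha> (g \<alpha> x) = x" using g(2) cmp_apply[OF x] idn_apply[OF x] by metis
    then have "j \<alpha> x = opr P' (Label t \<alpha>) (g \<alpha> x)" using opr[OF x(1) Mor_closed[OF P P' g(1) x]] by simp
    also have "\<dots> = g \<alpha> (opr P (Label t \<alpha>) x)" using Mor_opr[OF P P' g(1), of "Label t \<alpha>" x] x by simp
    also have "\<dots> = \<zero>\<^bsub>level P' \<alpha>\<^esub>" using t Mor_zero[OF P P' g(1) x(1)] by simp
    finally show "x = \<zero>\<^bsub>level P \<alpha>\<^esub>" by (rule j[OF x])
  qed
qed

text \<open>Dually, a retraction \<open>r\<close> of \<open>j\<close> commutes with
  \<open>t\<close>. Writing \<open>x = p y\<close>, the element \<open>j x\<close> is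
  \<open>t\<close> acting on \<open>y\<close>, so \<open>x = r (j x)\<close> is \<open>t\<close>
  acting on \<open>r y\<close>, which is zero in \<open>P\<close>.\<close>

lemma injective_zero:
  assumes "injective_object decorations P" shows "zero_object decorations P"
proof -
  have P: "P \<in> Ob decorations" using assms by (simp add: injective_object_def)
  obtain P' t p j where P': "P' \<in> Ob decorations" and t: "t \<notin> labels P"
    and p: "p \<in> Mor decorations P' P" "\<And>\<alpha> x. \<alpha> \<in> ON \<Longrightarrow> x \<in> lev P \<alpha> \<Longrightarrow> \<exists>y\<in>lev P' \<alpha>. p \<alpha> y = x"
    and j: "j \<in> Mor decorations P P'" "\<And>\<alpha> x. \<alpha> \<in> ON \<Longrightarrow> x \<in> lev P \<alpha> \<Longrightarrow> j \<alpha> x = \<zero>\<^bsub>level P' \<alpha>\<^esub> \<Longrightarrow> x = \<zero>\<^bsub>level P \<alpha>\<^esub>"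
    and opr: "\<And>\<alpha> x. \<alpha> \<in> ON \<Longrightarrow> x \<in> lev P' \<alpha> \<Longrightarrow> opr P' (Label t \<alpha>) x = j \<alpha> (p \<alpha> x)"
    by (rule doubling[OF P], rule that)
  have "mono_mor decorations P P' j" by (rule injective_mono[OF P P' j])
  then obtain r where r: "r \<in> Mor decorations P' P" "cmp decorations P P' P r j = idn decorations P"
    using assms P P' idn_Mor[OF P] unfolding injective_object_def by blast
  show ?thesis
  proof (rule zero_objectI[OF P])
    fix \<alpha> x assume x: "\<alpha> \<in> ON" "x \<in> lev P \<alpha>"
    obtain y where y: "y \<in> lev P' \<alpha>" "p \<alpha> y = x" using p(2)[OF x] by blast
    have "x = r \<alpha> (j \<alpha> x)" using r(2) cmp_apply[OF x] idn_apply[OF x] by metis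
    also have "\<dots> = r \<alpha> (opr P' (Label t \<alpha>) y)" using opr[OF x(1) y(1)] y(2) by simp
    also have "\<dots> = opr P (Label t \<alpha>) (r \<alpha> y)" using Mor_opr[OF P' P r(1), of "Label t \<alpha>" y] x(1) y(1) by simp
    also have "\<dots> = \<zero>\<^bsub>level P \<alpha>\<^esub>" using t by simp
    finally show "x = \<zero>\<^bsub>level P \<alpha>\<^esub>" .
  qed
qed

end

section \<open>Countable products\<close>

text \<open>An infinite independent sequence, chosen step by step outside the span of its
  predecessors. A product over \<open>nat\<close> then detects infinite degree: the terms of this
  sequence lie in no finite span.\<close>

lemma (in ring) infinite_dimension_sequence:
  assumes K: "subfield K R" and inf: "infinite_dimension K (carrier R)"
  obtains b :: "nat \<Rightarrow> 'a" where "range b \<subseteq> carrier R" "\<And>Us. set Us \<subseteq> carrier R \<Longrightarrow> \<not> range b \<subseteq> Span K Us"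
proof -
  have ex: "\<exists>x. x \<in> carrier R \<and> x \<notin> Span K Us" if "set Us \<subseteq> carrier R" for Us
  proof (rule ccontr)
    assume "\<not> ?thesis"
    then have "Span K Us = carrier R" using Span_in_carrier[OF subfieldE(3)[OF K] that] by auto
    then show False using Span_finite_dimension[OF K that] inf by simp
  qed
  \<comment> \<open>Dependent choice of nested independent lists; each is extended at its head, so
    \<open>b n\<close> below is the element newly added.\<close>
  have "\<exists>f. \<forall>n. (independent K (f n) \<and> length (f n) = n) \<and> (\<exists>x. f (Suc n) = x # f n)"
  proof (rule dependent_nat_choice)
    show "\<exists>Us. independent K Us \<and> length Us = 0" by auto
    fix Us n assume Us: "independent K Us \<and> length Us = n"
    then obtain x where "x \<in> carrier R" "x \<notin> Span K Us" using ex[OF independent_in_carrier] by blast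
    then have "independent K (x # Us)" using Us by (intro li_Cons) auto
    then show "\<exists>Vs. (independent K Vs \<and> length Vs = Suc n) \<and> (\<exists>x. Vs = x # Us)" using Us
      by (intro exI[of _ "x # Us"]) simp
  qed
  then obtain f where f: "\<And>n. independent K (f n)" "\<And>n. length (f n) = n" "\<And>n. \<exists>x. f (Suc n) = x # f n"
    by blast
  define b where "b n = hd (f (Suc n))" for n
  have b: "f (Suc n) = b n # f n" for n using f(3)[of n] by (auto simp: b_def)
  have sub: "set (f n) \<subseteq> range b" for n
  proof (induction n)
    case 0 show ?case using f(2)[of 0] by simp
  qed (simp add: b)
  show thesis
  proof
    show "range b \<subseteq> carrier R" using independent_in_carrier[OF f(1)[of "Suc _"]] by (auto simp: b)
    fix Us assume "set Us \<subseteq> carrier R"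
    then obtain Vs where Vs: "independent K Vs" "Span K Vs = Span K Us" using filter_base[OF K] by metis
    show "\<not> range b \<subseteq> Span K Us"
    proof
      assume "range b \<subseteq> Span K Us"
      \<comment> \<open>One independent vector more than the basis \<open>Vs\<close> of the span can
        hold.\<close>
      then have "set (f (Suc (length Vs))) \<subseteq> Span K Vs" using sub Vs(2) by blast
      then show False using independent_length_le[OF K f(1) Vs(1)] f(2) by fastforce
    qed
  qed
qed

context field_tower
begin

text \<open>\<open>k \<alpha>\<close> where \<open>P\<close> holds and zero elsewhere. The
  constantly true \<open>P\<close> gives the constant chain whose power is studied;
  \<open>\<gamma> \<preceq> \<delta>\<close> as a predicate of \<open>\<delta>\<close> gives the
  test chain that starts at level \<open>\<gamma>\<close>.\<close>

definition line_level :: "('v \<Rightarrow> bool) \<Rightarrow> 'v \<Rightarrow> ('v, 'v) module" where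
  "line_level P \<alpha> = \<lparr>carrier = (if P \<alpha> then carrier (k \<alpha>) else {\<zero>\<^bsub>k \<alpha>\<^esub>}), mult = mult (k \<alpha>), one = one (k \<alpha>),
    zero = zero (k \<alpha>), add = add (k \<alpha>), smult = mult (k \<alpha>)\<rparr>"

definition line_act :: "'v operator \<Rightarrow> 'v \<Rightarrow> 'v" where
  "line_act q = (case q of Scalar \<alpha> a \<Rightarrow> mult (k \<alpha>) a | Transition \<beta> \<alpha> \<Rightarrow> \<iota> \<beta> \<alpha> | Label s \<alpha> \<Rightarrow> (\<lambda>_. \<zero>\<^bsub>k \<alpha>\<^esub>))"

definition line :: "('v \<Rightarrow> bool) \<Rightarrow> ('v chain, 'v, 'v \<Rightarrow> 'v \<Rightarrow> 'v) decorated" where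
  "line P = mk_decorated (line_level P) line_act {}"

lemma line_level_sel [simp]:
  "carrier (line_level P \<alpha>) = (if P \<alpha> then carrier (k \<alpha>) else {\<zero>\<^bsub>k \<alpha>\<^esub>})" "zero (line_level P \<alpha>) = zero (k \<alpha>)"
  "add (line_level P \<alpha>) = add (k \<alpha>)"
  by (simp_all add: line_level_def)

lemma line_act_simps [simp]:
  "line_act (Scalar \<alpha> a) = mult (k \<alpha>) a" "line_act (Transition \<beta> \<alpha>) = \<iota> \<beta> \<alpha>" "line_act (Label s \<alpha>) =
    (\<lambda>_. \<zero>\<^bsub>k \<alpha>\<^esub>)"
  by (simp_all add: line_act_def)

lemma incl_zero: assumes "\<alpha> \<in> ON" "\<beta> \<in> ON" "\<alpha> \<preceq> \<beta>" shows "\<iota> \<beta> \<alpha> \<zero>\<^bsub>k \<alpha>\<^esub> = \<zero>\<^bsub>k \<beta>\<^esub>"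
proof -
  interpret A: cring "k \<alpha>" by (rule cring_level[OF assms(1)])
  interpret B: cring "k \<beta>" by (rule cring_level[OF assms(2)])
  show ?thesis using ring_hom_zero[OF incl_hom[OF assms] A.ring_axioms B.ring_axioms] .
qed

text \<open>The unit of \<open>k \<gamma>\<close> spans every higher level, which grounds the chain
  at \<open>\<gamma>\<close>. Upward closure of \<open>P\<close> ensures that transitions never lead
  from a full level to one cut down to zero.\<close>

lemma operator_structure_line:
  assumes up: "\<And>\<alpha> \<beta>. \<alpha> \<in> ON \<Longrightarrow> \<beta> \<in> ON \<Longrightarrow> \<alpha> \<preceq> \<beta> \<Longrightarrow> P \<alpha> \<Longrightarrow> P \<beta>" and \<gamma>: "\<gamma> \<in> ON" "P \<gamma>"
  shows "operator_structure k \<iota> (line_level P) line_act {}"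
proof (intro operator_structure.intro operator_structure_axioms.intro field_tower_axioms)
  fix \<alpha> :: 'v assume \<alpha>: "\<alpha> \<in> ON"
  interpret A: cring "k \<alpha>" by (rule cring_level[OF \<alpha>])
  show "abelian_group (line_level P \<alpha>)"
  proof (rule abelian_groupI)
    fix x assume x: "x \<in> carrier (line_level P \<alpha>)"
    show "\<exists>y\<in>carrier (line_level P \<alpha>). y \<oplus>\<^bsub>line_level P \<alpha>\<^esub> x = \<zero>\<^bsub>line_level P \<alpha>\<^esub>"
      using x by (intro bexI[of _ "\<ominus>\<^bsub>k \<alpha>\<^esub> x"]) (auto simp: A.l_neg split: if_splits)
  qed (auto simp: A.a_ac split: if_splits)
  show "small (carrier (line_level P \<alpha>))" using small_field[OF \<alpha>] by (auto intro: small_finite)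
  fix x assume x: "x \<in> carrier (line_level P \<alpha>)"
  then have x': "x \<in> carrier (k \<alpha>)" by (auto split: if_splits)
  show "line_act (Scalar \<alpha> \<one>\<^bsub>k \<alpha>\<^esub>) x = x" "line_act (Transition \<alpha> \<alpha>) x = x" "line_act (Label s \<alpha>) x =
    \<zero>\<^bsub>line_level P \<alpha>\<^esub>" for s
    using x' incl_id[OF \<alpha>] by simp_all
  {
    fix a b assume ab: "a \<in> carrier (k \<alpha>)" "b \<in> carrier (k \<alpha>)"
    show "line_act (Scalar \<alpha> (a \<oplus>\<^bsub>k \<alpha>\<^esub> b)) x = line_act (Scalar \<alpha> a) x \<oplus>\<^bsub>line_level P \<alpha>\<^esub> line_act
      (Scalar \<alpha> b) x"
      "line_act (Scalar \<alpha> (a \<otimes>\<^bsub>k \<alpha>\<^esub> b)) x = line_act (Scalar \<alpha> a) (line_act (Scalar \<alpha> b) x)"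
      using x' ab by (simp_all add: A.l_distr A.m_assoc)
  }
  show "line_act (Label s \<alpha>) (line_act (Scalar \<alpha> a) x) = line_act (Scalar \<alpha> a) (line_act (Label s \<alpha>) x)"
    if "a \<in> carrier (k \<alpha>)" for a s using that by simp
  fix \<beta> :: 'v assume \<beta>: "\<beta> \<in> ON" "\<alpha> \<preceq> \<beta>"
  show "line_act (Transition \<beta> \<alpha>) (line_act (Scalar \<alpha> a) x) = line_act (Scalar \<beta> (\<iota> \<beta> \<alpha> a)) (line_act
    (Transition \<beta> \<alpha>) x)"
    if "a \<in> carrier (k \<alpha>)" for a using that x' ring_hom_mult[OF incl_hom[OF \<alpha> \<beta>]] by simp
  show "line_act (Label s \<beta>) (line_act (Transition \<beta> \<alpha>) x) = line_act (Transition \<beta> \<alpha>) (line_act (Label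
    s \<alpha>) x)" for s
    using incl_zero[OF \<alpha> \<beta>] by simp
  fix \<delta> :: 'v assume \<delta>: "\<delta> \<in> ON" "\<beta> \<preceq> \<delta>"
  show "line_act (Transition \<delta> \<beta>) (line_act (Transition \<beta> \<alpha>) x) = line_act (Transition \<delta> \<alpha>) x"
    using incl_comp[OF \<alpha> \<beta>(1) \<delta>(1) \<beta>(2) \<delta>(2) x'] by simp
next
  fix q assume q: "q \<in> operators"
  show "line_act q \<in> additive_maps (line_level P (source q)) (line_level P (target q))"
  proof (cases q)
    case (Scalar \<alpha> a)
    then interpret B: cring "k \<alpha>" using q by (simp add: cring_level)
    show ?thesis using Scalar q by (intro additive_mapsI) (auto simp: B.r_distr split: if_splits)
  next
    case (Transition \<beta> \<alpha>)
    then have ab: "\<alpha> \<in> ON" "\<beta> \<in> ON" "\<alpha> \<preceq> \<beta>" using q by auto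
    note h = incl_hom[OF ab]
    interpret A: cring "k \<alpha>" using ab by (simp add: cring_level)
    interpret B: cring "k \<beta>" using ab by (simp add: cring_level)
    show ?thesis using Transition up[OF ab] incl_zero[OF ab] ring_hom_closed[OF h] ring_hom_add[OF h]
      by (intro additive_mapsI) (auto split: if_splits)
  next
    case (Label s \<alpha>)
    then interpret B: cring "k \<alpha>" using q by (simp add: cring_level)
    show ?thesis using Label by (intro additive_mapsI) (auto split: if_splits)
  qed
next
  have "carrier (line_level P \<beta>) \<subseteq> lincomb (line_level P) line_act \<beta> \<gamma> ` lists (carrier (k \<beta>) \<times> carrier
    (line_level P \<gamma>))"
    if \<beta>: "\<beta> \<in> ON" "\<gamma> \<prec> \<beta>" for \<beta>
  proof
    interpret A: cring "k \<gamma>" by (rule cring_level[OF \<gamma>(1)])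
    interpret B: cring "k \<beta>" by (rule cring_level[OF \<beta>(1)])
    fix x assume "x \<in> carrier (line_level P \<beta>)"
    then have x: "x \<in> carrier (k \<beta>)" by (auto split: if_splits)
    have "x = lincomb (line_level P) line_act \<beta> \<gamma> [(x, \<one>\<^bsub>k \<gamma>\<^esub>)]"
      using x ring_hom_one[OF incl_hom[OF \<gamma>(1) \<beta>(1) ord_less_imp_le[OF \<beta>(2)]]] by (simp add: lincomb_def)
    moreover have "[(x, \<one>\<^bsub>k \<gamma>\<^esub>)] \<in> lists (carrier (k \<beta>) \<times> carrier (line_level P \<gamma>))" using x \<gamma> by simp
    ultimately show "x \<in> lincomb (line_level P) line_act \<beta> \<gamma> ` lists (carrier (k \<beta>) \<times> carrier
      (line_level P \<gamma>))"
      by (rule image_eqI)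
  qed
  then show "\<exists>\<alpha>\<in>ON. \<forall>\<beta>\<in>ON. \<alpha> \<prec> \<beta> \<longrightarrow> carrier (line_level P \<beta>) \<subseteq>
      lincomb (line_level P) line_act \<beta> \<alpha> ` lists (carrier (k \<beta>) \<times> carrier (line_level P \<alpha>))"
    using \<gamma>(1) by blast
qed simp

lemma not_has_products_decorations: "\<not> has_products decorations (UNIV :: nat set)"
proof
  assume "has_products decorations (UNIV :: nat set)"
  let ?A = "line (\<lambda>_. True)"
  obtain \<alpha>0 :: 'v where "\<alpha>0 \<in> ON" using ordinal_upper_bound[of "{}"] by auto
  then have SA: "operator_structure k \<iota> (line_level (\<lambda>_. True)) line_act {}"
    by (intro operator_structure_line) auto
  then have A: "?A \<in> Ob decorations" unfolding line_def by (rule operator_structure.mk_decorated_in_Ob)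
  have "\<exists>P \<pi>. is_product decorations (UNIV :: nat set) (\<lambda>_. ?A) P \<pi>"
    using \<open>has_products decorations UNIV\<close>[unfolded has_products_def, rule_format, of "\<lambda>_. ?A"] A by simp
  then obtain P \<pi> where prod: "is_product decorations (UNIV :: nat set) (\<lambda>_. ?A) P \<pi>" by blast
  have P: "P \<in> Ob decorations" and \<pi>: "\<And>n. \<pi> n \<in> Mor decorations P ?A" using prod
    by (auto simp: is_product_def)
  interpret O: operator_structure k \<iota> "level P" "opr P" "labels P" by (rule operator_structure_opr[OF P])
  obtain \<alpha> where \<alpha>: "\<alpha> \<in> ON" "\<And>\<beta>. \<beta> \<in> ON \<Longrightarrow> \<alpha> \<prec> \<beta> \<Longrightarrow>
      lev P \<beta> \<subseteq> lincomb (level P) (opr P) \<beta> \<alpha> ` lists (carrier (k \<beta>) \<times> lev P \<alpha>)"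
    using O.grounded by blast
  define \<gamma> where "\<gamma> = succ \<alpha>"
  have \<gamma>: "\<gamma> \<in> ON" "\<alpha> \<prec> \<gamma>" "\<alpha> \<preceq> \<gamma>"
    using succ_in_ON[OF \<alpha>(1)] ord_less_succ ord_less_imp_le unfolding \<gamma>_def by blast+
  interpret K: field "k \<gamma>" by (rule field[OF \<gamma>(1)])
  interpret Ka: field "k \<alpha>" by (rule field[OF \<alpha>(1)])
  let ?K = "\<iota> \<gamma> \<alpha> ` carrier (k \<alpha>)"
  interpret h: ring_hom_ring "k \<alpha>" "k \<gamma>" "\<iota> \<gamma> \<alpha>"
    by (rule ring_hom_ringI2[OF Ka.ring_axioms K.ring_axioms incl_hom[OF \<alpha>(1) \<gamma>(1,3)]])
  have sub: "subfield ?K (k \<gamma>)"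
    using h.img_is_subfield(2)[OF Ka.carrier_is_subfield] K.one_not_zero by simp
  obtain b :: "nat \<Rightarrow> 'v" where b: "range b \<subseteq> carrier (k \<gamma>)" "\<And>Us. set Us \<subseteq> carrier (k \<gamma>) \<Longrightarrow>
    \<not> range b \<subseteq> K.Span ?K Us"
    using K.infinite_dimension_sequence[OF sub infinite_degree[OF \<alpha>(1) \<gamma>(1,2)]] by blast
  have bc: "b n \<in> carrier (k \<gamma>)" for n using b(1) by auto
  \<comment> \<open>Starting at \<open>\<gamma>\<close>, this test object can send its generator to
    any element of \<open>k \<gamma>\<close>. Maps out of the constant chain itself would be
    determined at the lowest level and reach only scalars from there.\<close>
  let ?Q = "line (\<lambda>\<delta>. \<gamma> \<preceq> \<delta>)"
  have SQ: "operator_structure k \<iota> (line_level (\<lambda>\<delta>. \<gamma> \<preceq> \<delta>)) line_act {}"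
    using \<gamma>(1) ord_le_trans by (intro operator_structure_line[of _ \<gamma>]) auto
  then have Q: "?Q \<in> Ob decorations" unfolding line_def by (rule operator_structure.mk_decorated_in_Ob)
  have levA: "lev ?A \<delta> = carrier (k \<delta>)" for \<delta> by (simp add: line_def)
  have oprA: "opr ?A q x = line_act q x" if "q \<in> operators" "x \<in> carrier (k (source q))" for q x
    unfolding line_def by (rule operator_structure.opr_mk_decorated[OF SA]) (use that in simp_all)
  \<comment> \<open>Multiplication by the image of \<open>b n\<close>; at level
    \<open>\<gamma>\<close> it takes the generator \<open>\<one>\<close> to
    \<open>b n\<close>.\<close>
  let ?f = "\<lambda>n \<delta> x. if \<gamma> \<preceq> \<delta> then x \<otimes>\<^bsub>k \<delta>\<^esub> \<iota> \<delta> \<gamma> (b n) else \<zero>\<^bsub>k \<delta>\<^esub>"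
  have f: "mk_mor ?Q (?f n) \<in> Mor decorations ?Q ?A" for n
  proof (rule mk_mor_in_Mor[OF Q A])
    fix \<delta> :: 'v assume \<delta>: "\<delta> \<in> ON"
    interpret D: cring "k \<delta>" by (rule cring_level[OF \<delta>])
    show "?f n \<delta> \<in> additive_maps (level ?Q \<delta>) (level ?A \<delta>)"
      using ring_hom_closed[OF incl_hom[OF \<gamma>(1) \<delta>] bc] D.l_distr
      by (intro additive_mapsI) (auto simp: line_def)
  next
    fix q x assume q: "q \<in> operators" and x: "x \<in> lev ?Q (source q)"
    have l: "source q \<in> ON" "target q \<in> ON" using operators_levels[OF q] by auto
    interpret S: cring "k (source q)" by (rule cring_level[OF l(1)])
    interpret T: cring "k (target q)" by (rule cring_level[OF l(2)])
    have x': "x \<in> carrier (k (source q))" using x by (auto simp: line_def split: if_splits)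
    have xl: "x \<in> carrier (line_level (\<lambda>\<delta>. \<gamma> \<preceq> \<delta>) (source q))" using x by (simp add: line_def)
    have oprQ: "opr ?Q q x = line_act q x"
      unfolding line_def by (rule operator_structure.opr_mk_decorated[OF SQ q xl])
    have fx: "?f n (source q) x \<in> carrier (k (source q))"
      using ring_hom_closed[OF incl_hom[OF \<gamma>(1) l(1)] bc] x' by auto
    show "?f n (target q) (opr ?Q q x) = opr ?A q (?f n (source q) x)"
      unfolding oprQ oprA[OF q fx]
    proof (cases q)
      case (Scalar \<delta> a)
      then interpret D: cring "k \<delta>" using q by (simp add: cring_level)
      show "?f n (target q) (line_act q x) = line_act q (?f n (source q) x)"
        using Scalar q x' ring_hom_closed[OF incl_hom[OF \<gamma>(1) l(1)] bc] by (auto simp: D.m_assoc)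
    next
      case (Transition \<beta> \<delta>)
      then have ab: "\<delta> \<in> ON" "\<beta> \<in> ON" "\<delta> \<preceq> \<beta>" using q by auto
      show "?f n (target q) (line_act q x) = line_act q (?f n (source q) x)"
      proof (cases "\<gamma> \<preceq> \<delta>")
        case True
        then show ?thesis
          using Transition ord_le_trans[OF ab(2) True ab(3)] x' ring_hom_mult[OF incl_hom[OF ab]]
            ring_hom_closed[OF incl_hom[OF \<gamma>(1) ab(1) True] bc] incl_comp[OF \<gamma>(1) ab(1,2) True ab(3) bc]
              by simp
      next
        case False
        then have "x = \<zero>\<^bsub>k \<delta>\<^esub>" using x Transition by (simp add: line_def)
        then show ?thesis
          using False Transition incl_zero[OF ab] ring_hom_closed[OF incl_hom[OF \<gamma>(1) l(2)] bc] T.l_null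
            by auto
      qed
    next
      case (Label s \<delta>)
      then interpret D: cring "k \<delta>" using q by (simp add: cring_level)
      show "?f n (target q) (line_act q x) = line_act q (?f n (source q) x)"
        using Label ring_hom_closed[OF incl_hom[OF \<gamma>(1) l(1)] bc] by auto
    qed
  qed
  obtain h where h: "h \<in> Mor decorations ?Q P" "\<And>n. cmp decorations ?Q P ?A (\<pi> n) h = mk_mor ?Q (?f n)"
    using prod[unfolded is_product_def, THEN conjunct2, THEN conjunct2, rule_format, OF Q, of "\<lambda>n.
      mk_mor ?Q (?f n)"] f
    by auto
  let ?y = "h \<gamma> \<one>\<^bsub>k \<gamma>\<^esub>"
  have one: "\<one>\<^bsub>k \<gamma>\<^esub> \<in> lev ?Q \<gamma>" by (simp add: line_def)
  have \<pi>y: "\<pi> n \<gamma> ?y = b n" for n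
  proof -
    have "\<pi> n \<gamma> ?y = mk_mor ?Q (?f n) \<gamma> \<one>\<^bsub>k \<gamma>\<^esub>" using h(2)[of n] cmp_apply[OF \<gamma>(1) one] by metis
    then show ?thesis using mk_mor_apply[OF \<gamma>(1) one, of "?f n"] incl_id[OF \<gamma>(1) bc] bc by simp
  qed
  have "?y \<in> lev P \<gamma>" by (rule Mor_closed[OF Q P h(1) \<gamma>(1) one])
  then obtain w where w: "?y = lincomb (level P) (opr P) \<gamma> \<alpha> w" "w \<in> lists (carrier (k \<gamma>) \<times> lev P \<alpha>)"
    using \<alpha>(2)[OF \<gamma>(1,2)] by blast
  \<comment> \<open>The coefficients in \<open>w\<close> do not depend on the coordinate
    \<open>n\<close>; only the elements of \<open>k \<alpha>\<close> given by the coordinates of the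
    vectors do. Hence all \<open>b n\<close> lie in the span over \<open>?K\<close> of the single
    finite list \<open>map fst w\<close>.\<close>
  have "\<exists>Ks. set Ks \<subseteq> ?K \<and> \<pi> n \<gamma> (lincomb (level P) (opr P) \<gamma> \<alpha> w) = K.combine Ks (map fst w)" for n
    using w(2)
  proof (induction w)
    case Nil then show ?case using Mor_zero[OF P A \<pi> \<gamma>(1)] by (intro exI[of _ "[]"]) (simp add: line_def)
  next
    case (Cons p w)
    then obtain Ks where Ks: "set Ks \<subseteq> ?K" "\<pi> n \<gamma> (lincomb (level P) (opr P) \<gamma> \<alpha> w) = K.combine Ks (map
      fst w)" by blast
    obtain c x where p: "p = (c, x)" "c \<in> carrier (k \<gamma>)" "x \<in> lev P \<alpha>" using Cons by (cases p) auto
    let ?x = "\<pi> n \<alpha> x"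
    have xc: "?x \<in> carrier (k \<alpha>)" using Mor_closed[OF P A \<pi> \<alpha>(1) p(3)] levA by simp
    note tx = O.transition_closed[OF \<alpha>(1) \<gamma>(1,3) p(3)]
    have "\<pi> n \<gamma> (opr P (Scalar \<gamma> c) (opr P (Transition \<gamma> \<alpha>) x)) = c \<otimes>\<^bsub>k \<gamma>\<^esub> \<iota> \<gamma> \<alpha> ?x"
      using Mor_opr[OF P A \<pi>, of "Scalar \<gamma> c" "opr P (Transition \<gamma> \<alpha>) x"] Mor_opr[OF P A \<pi>, of
        "Transition \<gamma> \<alpha>" x]
        oprA[of "Transition \<gamma> \<alpha>" ?x] oprA[of "Scalar \<gamma> c" "\<iota> \<gamma> \<alpha> ?x"] p tx \<alpha>(1) \<gamma> xc h.hom_closed[OF xc]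
      by (simp del: opr.simps)
    then have "\<pi> n \<gamma> (lincomb (level P) (opr P) \<gamma> \<alpha> (p # w)) = c \<otimes>\<^bsub>k \<gamma>\<^esub> \<iota> \<gamma> \<alpha> ?x \<oplus>\<^bsub>k \<gamma>\<^esub> K.combine Ks
      (map fst w)"
      using Mor_add[OF P A \<pi> \<gamma>(1) O.scalar_closed[OF \<gamma>(1) p(2) tx] O.lincomb_closed[OF \<alpha>(1) \<gamma>(1,3), of
        w]] Cons.hyps Ks(2)
      by (simp add: p(1) line_def del: opr.simps)
    \<comment> \<open>By commutativity the roles are exchanged: \<open>c\<close> is now the spanning
      vector and the coordinate from \<open>k \<alpha>\<close> the scalar.\<close>
    also have "\<dots> = K.combine (\<iota> \<gamma> \<alpha> ?x # Ks) (map fst (p # w))"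
      using p h.hom_closed[OF xc] by (simp add: K.m_comm)
    finally show ?case using Ks(1) xc by (intro exI[of _ "\<iota> \<gamma> \<alpha> ?x # Ks"]) auto
  qed
  moreover have wc: "set (map fst w) \<subseteq> carrier (k \<gamma>)" using in_lists_TimesD[OF w(2)] by auto
  ultimately have "range b \<subseteq> K.Span ?K (map fst w)"
    using K.Span_eq_combine_set[OF sub wc] \<pi>y w(1) by fastforce
  then show False using b(2)[OF wc] by simp
qed

end

theorem theorem2p4:
  fixes k :: "'v::set_universe \<Rightarrow> 'v ring"
    and \<iota> :: "'v \<Rightarrow> 'v \<Rightarrow> 'v \<Rightarrow> 'v"
  assumes "field_tower k \<iota>"
  shows "AB5 TYPE('v) (set_decoration TYPE('v) (grounded_chains k \<iota>)) \<and>
    \<not> has_products (set_decoration TYPE('v) (grounded_chains k \<iota>)) (UNIV :: nat set) \<and>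
    (\<forall>I. injective_object (set_decoration TYPE('v) (grounded_chains k \<iota>)) I \<longrightarrow>
      zero_object (set_decoration TYPE('v) (grounded_chains k \<iota>)) I) \<and>
    (\<forall>P. projective_object (set_decoration TYPE('v) (grounded_chains k \<iota>)) P \<longrightarrow>
      zero_object (set_decoration TYPE('v) (grounded_chains k \<iota>)) P)"
proof -
  interpret field_tower k \<iota> by (rule assms)
  show ?thesis
    using abelian_decorations cocomplete_decorations exact_filtered_colimits_decorations
      not_has_products_decorations injective_zero projective_zero
    by (simp add: AB5_def)
qed

end
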